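(* Let $L$ be a finite geometric lattice of rank $\ell\ge 2$ with bottom $\hat 0$, let $P=L\setminus\{\hat 0\}$, and let $p>0$ be an integer. Let $\mathscr{OS}^p$ be the degree $p$ Orlik--Solomon sheaf over $\mathbb{Z}$ on $L$, restricted to $P$. For $z\in L_p=\{x\in L\mid \operatorname{rank}(x)=p\}$ put $Q_z=\{x\in P\mid z\not\le x\}$. Then \[ H_i(P;\mathscr{OS}^p)\cong \begin{cases}\displaystyle\bigoplus_{z\in L_p}\mathrm{OS}^p(L_{\le z})\otimes_{\mathbb{Z}}\widetilde H_{\ell-2}(\Delta Q_z;\mathbb{Z}), & i=\ell-1,\\ 0,& i\ne \ell-1.\end{cases} \] Furthermore, for each $z\in L_p$, $\mathrm{OS}^p(L_{\le z})$ is free abelian of rank $(-1)^{\operatorname{rank} z}\mu(\hat 0,z)$, and $\widetilde H_{\ell-2}(\Delta Q_z;\mathbb{Z})$ is free abelian of rank \[ b_z=(-1)^{\ell-2}\sum_{x\in L_{\ge z}}\mu(\hat 0,x). \] Therefore $H_{\ell-1}(P;\mathscr{OS}^p)$ is free abelian of rank $\sum_{z\in L_p}(-1)^{\operatorname{rank} z}\mu(\hat 0,z)\,b_z$.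
   Context: All posets are finite. A geometric lattice is a ranked lattice that is atomic (every element is a join of atoms) and semimodular: $\operatorname{rank}(x)+\operatorname{rank}(y)\ge\operatorname{rank}(x\wedge y)+\operatorname{rank}(x\vee y)$. Write $L_{\le x}=\{y\in L\mid y\le x\}$ and $L_{\ge x}=\{y\in L\mid y\ge x\}$; $\mu$ is the Möbius function of $L$. $\Delta Q$ denotes the order complex of a poset $Q$ (simplices are the nonempty finite chains), and $\widetilde H_*$ is reduced simplicial homology. Orlik--Solomon algebra: let $K$ be a geometric lattice with totally ordered atoms $a_1,\dots,a_n$, and let $\bigwedge^\bullet E$ be the exterior algebra over $\mathbb{Z}$ on degree 1 generators $e_1,\dots,e_n$. For $I=\{i_1<\cdots<i_k\}$ put $e_I=e_{i_1}\cdots e_{i_k}$ and $\partial e_I=\sum_{j=1}^k(-1)^{j-1}e_{i_1}\cdots\widehat{e_{i_j}}\cdots e_{i_k}$. A set of atoms is independent if the rank of its join equals its cardinality; a circuit is a minimal dependent set of atoms. Then $\mathrm{OS}^\bullet(K)=\bigwedge^\bullet E/\langle \partial e_I\mid \{a_i\}_{i\in I}\text{ is a circuit}\rangle$, graded by degree, with degree $p$ piece $\mathrm{OS}^p(K)$. Orlik--Solomon sheaf: a sheaf of abelian groups on a poset is a contravariant functor from the poset to abelian groups. For each $x\in L$, $L_{\le x}$ is a geometric lattice whose atoms are the atoms of $L$ below $x$ (with the induced order). Set $\mathscr{OS}^p(x)=\mathrm{OS}^p(L_{\le x})$; for $x\le y$ the structure map $\mathscr{OS}^p(y)\to\mathscr{OS}^p(x)$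 is the degree $p$ part of the (well-defined) surjective algebra homomorphism $\mathrm{OS}^\bullet(L_{\le y})\to\mathrm{OS}^\bullet(L_{\le x})$ sending $e_i\mapsto e_i$ if $a_i\le x$ and $e_i\mapsto 0$ if $a_i\not\le x$. Sheaf homology: for a sheaf $\mathscr{F}$ on $P$ with structure maps $\mathscr{F}^y_x:\mathscr{F}(y)\to\mathscr{F}(x)$ ($x\le y$), $H_*(P;\mathscr{F})$ denotes the left derived functors of the colimit evaluated at $\mathscr F$; equivalently it is the homology of the complex $T_n(P;\mathscr{F})=\bigoplus_{x_n<\cdots<x_0}\mathscr{F}(x_0)$ with differential, for $s\in\mathscr{F}(x_0)$ placed in the summand of $\sigma=(x_n<\cdots<x_0)$, $d(s_\sigma)=\mathscr{F}^{x_0}_{x_1}(s)_{d_0\sigma}+\sum_{i=1}^n(-1)^i s_{d_i\sigma}$, where $d_i\sigma$ deletes $x_i$. *)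

theory Defs
  imports
    "HOL-Algebra.Lattice"
    "HOL-Algebra.QuotRing"
    "HOL-Algebra.Free_Abelian_Groups"
begin

section \<open>Geometric lattices\<close>

text \<open>A poset is a set \<open>K\<close> in a type of class \<^class>\<open>order\<close>, with the induced order; lattice
  operations are those of the poset \<open>K\<close>, not of the ambient type.\<close>

abbreviation poset_of :: "'a::order set \<Rightarrow> 'a gorder" where
  "poset_of K \<equiv> \<lparr>carrier = K, eq = (=), le = (\<le>)\<rparr>"

definition down_set :: "'a::order set \<Rightarrow> 'a \<Rightarrow> 'a set" where
  "down_set K x = {y \<in> K. y \<le> x}"

definition up_set :: "'a::order set \<Rightarrow> 'a \<Rightarrow> 'a set" where
  "up_set K x = {y \<in> K. x \<le> y}"

definition covers :: "'a::order set \<Rightarrow> 'a \<Rightarrow> 'a \<Rightarrow> bool" where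
  "covers K y x \<longleftrightarrow> x \<in> K \<and> y \<in> K \<and> x < y \<and> \<not> (\<exists>w\<in>K. x < w \<and> w < y)"

text \<open>The length of a longest chain of \<open>K\<close> with top element \<open>x\<close>; the length of a chain is its number
  of elements minus one, i.e. its number of elements strictly below \<open>x\<close>.\<close>

definition poset_rank :: "'a::order set \<Rightarrow> 'a \<Rightarrow> nat" where
  "poset_rank K x = Max (card ` {C. C \<subseteq> {y \<in> K. y < x} \<and> Complete_Partial_Order.chain (\<le>) C})"

definition ranked :: "'a::order set \<Rightarrow> bool" where
  "ranked K \<longleftrightarrow> (\<forall>x y. covers K y x \<longrightarrow> poset_rank K y = poset_rank K x + 1)"

definition lattice_rank :: "'a::order set \<Rightarrow> nat" where
  "lattice_rank K = poset_rank K \<top>\<^bsub>poset_of K\<^esub>"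

definition rank_level :: "'a::order set \<Rightarrow> nat \<Rightarrow> 'a set" where
  "rank_level K p = {x \<in> K. poset_rank K x = p}"

definition atoms :: "'a::order set \<Rightarrow> 'a set" where
  "atoms K = {a. covers K a \<bottom>\<^bsub>poset_of K\<^esub>}"

definition geometric_lattice :: "'a::order set \<Rightarrow> bool" where
  "geometric_lattice K \<longleftrightarrow>
     finite K \<and> K \<noteq> {} \<and> lattice (poset_of K) \<and> ranked K \<and>
     (\<forall>x\<in>K. \<exists>A \<subseteq> atoms K. x = \<Squnion>\<^bsub>poset_of K\<^esub> A) \<and>
     (\<forall>x\<in>K. \<forall>y\<in>K. poset_rank K x + poset_rank K y
        \<ge> poset_rank K (x \<sqinter>\<^bsub>poset_of K\<^esub> y) + poset_rank K (x \<squnion>\<^bsub>poset_of K\<^esub> y))"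

function mobius :: "'a::order set \<Rightarrow> 'a \<Rightarrow> 'a \<Rightarrow> int" where
  "mobius K x y =
     (if finite K \<and> x \<in> K \<and> y \<in> K \<and> x \<le> y
      then if x = y then 1 else - (\<Sum>w\<in>{w \<in> K. x \<le> w \<and> w < y}. mobius K x w)
      else 0)"
  by auto
termination
proof (relation "measure (\<lambda>(K, x, y). card {w \<in> K. w < y})", goal_cases)
  case (2 K x y w)
  then have "{v \<in> K. v < w} \<subset> {v \<in> K. v < y}"
    by auto
  with 2 show ?case
    by (auto intro!: psubset_card_mono)
qed auto

declare mobius.simps [simp del]


section \<open>Abelian groups\<close>

text \<open>Abelian groups are written multiplicatively, as in \<open>HOL-Algebra\<close>.\<close>

definition free_abelian_of_rank :: "('g, 'm) monoid_scheme \<Rightarrow> int \<Rightarrow> bool" where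
  "free_abelian_of_rank G r \<longleftrightarrow>
     comm_group G \<and> (\<exists>n::nat. r = int n \<and> G \<cong> free_Abelian_group {..<n})"

definition tensor_relations ::
    "('g, 'm) monoid_scheme \<Rightarrow> ('h, 'n) monoid_scheme \<Rightarrow> ('g \<times> 'h \<Rightarrow>\<^sub>0 int) set" where
  "tensor_relations G H =
     {frag_of (x \<otimes>\<^bsub>G\<^esub> x', y) - frag_of (x, y) - frag_of (x', y) | x x' y.
        x \<in> carrier G \<and> x' \<in> carrier G \<and> y \<in> carrier H} \<union>
     {frag_of (x, y \<otimes>\<^bsub>H\<^esub> y') - frag_of (x, y) - frag_of (x, y') | x y y'.
        x \<in> carrier G \<and> y \<in> carrier H \<and> y' \<in> carrier H}"

definition tensor_product ::
    "('g, 'm) monoid_scheme \<Rightarrow> ('h, 'n) monoid_scheme \<Rightarrow> ('g \<times> 'h \<Rightarrow>\<^sub>0 int) set monoid" where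
  "tensor_product G H =
     (let F = free_Abelian_group (carrier G \<times> carrier H)
      in F Mod generate F (tensor_relations G H))"


section \<open>Reduced simplicial homology of order complexes\<close>

text \<open>For a finite set \<open>s\<close> linearly ordered by \<open>lt\<close>, the alternating sum of the sets obtained by
  deleting one element; the exponent is the zero-based position of the deleted element.\<close>

definition alternating_deletion :: "('a \<Rightarrow> 'a \<Rightarrow> bool) \<Rightarrow> 'a set \<Rightarrow> 'a set \<Rightarrow>\<^sub>0 int" where
  "alternating_deletion lt s =
     (\<Sum>v\<in>s. frag_cmul ((-1) ^ card {w \<in> s. lt w v}) (frag_of (s - {v})))"

definition order_complex :: "'a::order set \<Rightarrow> 'a set set" where
  "order_complex Q = {s. s \<subseteq> Q \<and> s \<noteq> {} \<and> finite s \<and> Complete_Partial_Order.chain (\<le>) s}"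

text \<open>The augmented chain complex of a simplicial complex \<open>X\<close>: the group indexed by \<open>k\<close> is free on
  the simplices with \<open>k\<close> vertices, so it sits in degree \<open>k - 1\<close>, and the empty set generates
  degree \<open>-1\<close>. Every simplex has to be linearly ordered by the order of \<open>'a\<close>.\<close>

definition aug_chain_group :: "'a set set \<Rightarrow> nat \<Rightarrow> ('a set \<Rightarrow>\<^sub>0 int) monoid" where
  "aug_chain_group X k = free_Abelian_group {s \<in> insert {} X. card s = k}"

abbreviation simplicial_boundary :: "('a::order set \<Rightarrow>\<^sub>0 int) \<Rightarrow> ('a set \<Rightarrow>\<^sub>0 int)" where
  "simplicial_boundary \<equiv> frag_extend (alternating_deletion (<))"

definition reduced_homology :: "nat \<Rightarrow> 'a::order set set \<Rightarrow> ('a set \<Rightarrow>\<^sub>0 int) set monoid" where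
  "reduced_homology n X =
     (aug_chain_group X (n + 1))
        \<lparr>carrier := kernel (aug_chain_group X (n + 1)) (aug_chain_group X n) simplicial_boundary\<rparr>
     Mod (simplicial_boundary ` carrier (aug_chain_group X (n + 2)))"


section \<open>The Orlik--Solomon algebra\<close>

text \<open>The exterior algebra over the integers on the degree 1 generators \<open>e\<^sub>a\<close> with \<open>a \<in> A\<close>, where
  \<open>A\<close> is linearly ordered by \<open>lt\<close>. The monomial \<open>e\<^sub>I\<close> is \<^term>\<open>frag_of I\<close>. The sign of
  \<open>e\<^sub>I e\<^sub>J = \<plusminus> e\<^bsub>I \<union> J\<^esub>\<close> counts the transpositions needed to sort the factors.\<close>

definition monomial_mult :: "('a \<Rightarrow> 'a \<Rightarrow> bool) \<Rightarrow> 'a set \<Rightarrow> 'a set \<Rightarrow> 'a set \<Rightarrow>\<^sub>0 int" where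
  "monomial_mult lt I J =
     (if I \<inter> J = {}
      then frag_cmul ((-1) ^ card {(i, j). i \<in> I \<and> j \<in> J \<and> lt j i}) (frag_of (I \<union> J))
      else 0)"

abbreviation ext_mult ::
    "('a \<Rightarrow> 'a \<Rightarrow> bool) \<Rightarrow> ('a set \<Rightarrow>\<^sub>0 int) \<Rightarrow> ('a set \<Rightarrow>\<^sub>0 int) \<Rightarrow> ('a set \<Rightarrow>\<^sub>0 int)" where
  "ext_mult lt x y \<equiv> frag_extend (\<lambda>I. frag_extend (monomial_mult lt I) y) x"

definition exterior_algebra :: "('a \<Rightarrow> 'a \<Rightarrow> bool) \<Rightarrow> 'a set \<Rightarrow> ('a set \<Rightarrow>\<^sub>0 int) ring" where
  "exterior_algebra lt A =
     \<lparr>carrier = {x. Poly_Mapping.keys x \<subseteq> Fpow A},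
      monoid.mult = ext_mult lt,
      one = frag_of {}, ring.zero = 0, ring.add = (+)\<rparr>"

lemma frag_extend_addfun: "frag_extend (\<lambda>I. f I + g I) x = frag_extend f x + frag_extend g x"
  by (simp add: frag_extend_def sum.distrib frag_cmul_distrib2)

lemma ext_mult_add_right: "ext_mult lt x (y + z) = ext_mult lt x y + ext_mult lt x z"
  by (simp add: frag_extend_add frag_extend_addfun)

lemma ext_mult_add_left: "ext_mult lt (x + y) z = ext_mult lt x z + ext_mult lt y z"
  by (simp add: frag_extend_add)

lemma ext_mult_diff_left: "ext_mult lt (x - y) z = ext_mult lt x z - ext_mult lt y z"
  by (simp add: frag_extend_diff)

lemma ext_mult_diff_right: "ext_mult lt x (y - z) = ext_mult lt x y - ext_mult lt x z"
  by (simp add: eq_diff_eq flip: ext_mult_add_right)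

lemma frag_extend_cmulfun: "frag_extend (\<lambda>I. frag_cmul c (f I)) x = frag_cmul c (frag_extend f x)"
  by (simp add: frag_extend_def frag_cmul_sum mult.commute)

lemma ext_mult_assoc_basis:
  assumes "finite I" "finite J" "finite K"
  shows "ext_mult lt (monomial_mult lt I J) (frag_of K) = ext_mult lt (frag_of I) (monomial_mult lt J K)"
proof (cases "I \<inter> J = {} \<and> J \<inter> K = {} \<and> I \<inter> K = {}")
  case True
  let ?p = "\<lambda>I J. {(i, j). i \<in> I \<and> j \<in> J \<and> lt j i}"
  have fin: "finite (?p I J)" if "finite I" "finite J" for I J
    by (rule finite_subset[of _ "I \<times> J"]) (use that in auto)
  have 1: "card (?p (I \<union> J) K) = card (?p I K) + card (?p J K)"
    using True by (subst card_Un_disjoint[symmetric]) (auto intro!: fin assms arg_cong[of _ _ card])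
  have 2: "card (?p I (J \<union> K)) = card (?p I J) + card (?p I K)"
    using True by (subst card_Un_disjoint[symmetric]) (auto intro!: fin assms arg_cong[of _ _ card])
  have d: "(I \<union> J) \<inter> K = {}" "I \<inter> (J \<union> K) = {}" using True by auto
  show ?thesis
    unfolding monomial_mult_def using True d 1 2
    by (simp add: frag_extend_cmul frag_extend_cmulfun Int_Un_distrib Int_Un_distrib2 monomial_mult_def power_add Un_assoc mult_ac)
next
  case False
  then show ?thesis
    by (auto simp: monomial_mult_def frag_extend_cmul frag_extend_cmulfun Int_Un_distrib Int_Un_distrib2)
qed

lemma ext_mult_assoc:
  assumes x: "Poly_Mapping.keys x \<subseteq> Fpow A" and y: "Poly_Mapping.keys y \<subseteq> Fpow A" and z: "Poly_Mapping.keys z \<subseteq> Fpow A"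
  shows "ext_mult lt (ext_mult lt x y) z = ext_mult lt x (ext_mult lt y z)"
  using x
proof (induction rule: frag_induction)
  case (diff u v) then show ?case unfolding ext_mult_diff_left by simp
next
  case (one I)
  then have I: "finite I" by (auto simp: Fpow_def)
  show ?case using y
  proof (induction rule: frag_induction)
    case (diff u v) 
    then show ?case unfolding ext_mult_diff_right ext_mult_diff_left by simp
  next
    case (one J)
    then have J: "finite J" by (auto simp: Fpow_def)
    show ?case using z
    proof (induction rule: frag_induction)
      case (diff u v) 
      then show ?case unfolding ext_mult_diff_right ext_mult_diff_left by simp
    next
      case (one K)
      then have K: "finite K" by (auto simp: Fpow_def)
      show ?case using ext_mult_assoc_basis[OF I J K, of lt] by simp
    qed (simp add: frag_extend_def)
  qed (simp add: frag_extend_def)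
qed (simp add: frag_extend_def)

lemma keys_ext_mult:
  assumes x: "Poly_Mapping.keys x \<subseteq> Fpow A" and y: "Poly_Mapping.keys y \<subseteq> Fpow A"
  shows "Poly_Mapping.keys (ext_mult lt x y) \<subseteq> Fpow A"
proof -
  have m: "Poly_Mapping.keys (monomial_mult lt I J) \<subseteq> Fpow A" if "I \<in> Fpow A" "J \<in> Fpow A" for I J
    using that by (auto simp: monomial_mult_def Fpow_def keys_cmul split: if_splits)
  have "Poly_Mapping.keys (frag_extend (monomial_mult lt I) y) \<subseteq> Fpow A" if "I \<in> Fpow A" for I
    by (rule order_trans[OF keys_frag_extend]) (use m that y in blast)
  then show ?thesis
    by (intro order_trans[OF keys_frag_extend]) (use x in blast)
qed

lemma ext_mult_one_left: "ext_mult lt (frag_of {}) x = x"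
  by (simp add: monomial_mult_def[abs_def] flip: frag_expansion)

lemma ext_mult_one_right: "ext_mult lt x (frag_of {}) = x"
  by (simp add: monomial_mult_def[abs_def] flip: frag_expansion)

lemma ring_exterior_algebra: "ring (exterior_algebra lt A)"
proof (rule ringI)
  show "abelian_group (exterior_algebra lt A)"
  proof (rule abelian_groupI; simp add: exterior_algebra_def add.assoc add.commute)
    show "Poly_Mapping.keys (x+y) \<subseteq> Fpow A" if "Poly_Mapping.keys x \<subseteq> Fpow A" "Poly_Mapping.keys y \<subseteq> Fpow A" for x y :: "'a set \<Rightarrow>\<^sub>0 int"
      using that keys_add[of x y] by blast
    show "\<exists>y. Poly_Mapping.keys y \<subseteq> Fpow A \<and> x + y = 0" if "Poly_Mapping.keys x \<subseteq> Fpow A" for x :: "'a set \<Rightarrow>\<^sub>0 int"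
      by (rule exI[of _ "-x"]) (use that in simp)
  qed
  show "Group.monoid (exterior_algebra lt A)"
  proof (rule monoidI)
    show "\<one>\<^bsub>exterior_algebra lt A\<^esub> \<in> carrier (exterior_algebra lt A)"
      by (simp add: exterior_algebra_def Fpow_def)
  qed (simp_all only: exterior_algebra_def partial_object.simps monoid.simps mem_Collect_eq keys_ext_mult ext_mult_assoc[of _ A] ext_mult_one_left ext_mult_one_right)
qed (auto simp: exterior_algebra_def ext_mult_add_left ext_mult_add_right)

definition exterior_power :: "nat \<Rightarrow> 'a set \<Rightarrow> ('a set \<Rightarrow>\<^sub>0 int) set" where
  "exterior_power p A = {x. Poly_Mapping.keys x \<subseteq> {I \<in> Fpow A. card I = p}}"

definition independent :: "'a::order set \<Rightarrow> 'a set \<Rightarrow> bool" where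
  "independent K A \<longleftrightarrow> poset_rank K (\<Squnion>\<^bsub>poset_of K\<^esub> A) = card A"

definition circuit :: "'a::order set \<Rightarrow> 'a set \<Rightarrow> bool" where
  "circuit K A \<longleftrightarrow> A \<subseteq> atoms K \<and> \<not> independent K A \<and> (\<forall>B. B \<subset> A \<longrightarrow> independent K B)"

definition OS_ideal :: "('a \<Rightarrow> 'a \<Rightarrow> bool) \<Rightarrow> 'a::order set \<Rightarrow> ('a set \<Rightarrow>\<^sub>0 int) set" where
  "OS_ideal lt K =
     Idl\<^bsub>exterior_algebra lt (atoms K)\<^esub> {alternating_deletion lt I | I. circuit K I}"

definition OS_algebra :: "('a \<Rightarrow> 'a \<Rightarrow> bool) \<Rightarrow> 'a::order set \<Rightarrow> ('a set \<Rightarrow>\<^sub>0 int) set ring" where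
  "OS_algebra lt K = exterior_algebra lt (atoms K) Quot OS_ideal lt K"

abbreviation OS_class ::
    "('a \<Rightarrow> 'a \<Rightarrow> bool) \<Rightarrow> 'a::order set \<Rightarrow> ('a set \<Rightarrow>\<^sub>0 int) \<Rightarrow> ('a set \<Rightarrow>\<^sub>0 int) set" where
  "OS_class lt K x \<equiv> OS_ideal lt K +>\<^bsub>exterior_algebra lt (atoms K)\<^esub> x"

text \<open>The additive group of the degree \<open>p\<close> part.\<close>

definition OS :: "('a \<Rightarrow> 'a \<Rightarrow> bool) \<Rightarrow> nat \<Rightarrow> 'a::order set \<Rightarrow> ('a set \<Rightarrow>\<^sub>0 int) set monoid" where
  "OS lt p K =
     \<lparr>carrier = OS_class lt K ` exterior_power p (atoms K),
      monoid.mult = (\<oplus>\<^bsub>OS_algebra lt K\<^esub>), one = \<zero>\<^bsub>OS_algebra lt K\<^esub>\<rparr>"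

text \<open>The algebra homomorphism between Orlik--Solomon algebras that sends \<open>e\<^sub>a\<close> to \<open>e\<^sub>a\<close> if \<open>a\<close> is an
  atom of the target lattice \<open>K\<close> and to \<open>0\<close> otherwise. On the exterior algebra it keeps the monomials
  in the atoms of \<open>K\<close> and kills all others; it is then applied to a representative of a class.\<close>

definition OS_restriction ::
    "('a \<Rightarrow> 'a \<Rightarrow> bool) \<Rightarrow> 'a::order set \<Rightarrow> ('a set \<Rightarrow>\<^sub>0 int) set \<Rightarrow> ('a set \<Rightarrow>\<^sub>0 int) set" where
  "OS_restriction lt K c =
     the_elem ((\<lambda>x. OS_class lt K
       (frag_extend (\<lambda>I. if I \<subseteq> atoms K then frag_of I else 0) x)) ` c)"


section \<open>Sheaf homology on a finite poset\<close>

text \<open>For \<open>x \<le> y\<close> the structure map from the stalk at \<open>y\<close> to the stalk at \<open>x\<close> is \<open>res F y x\<close>.\<close>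

record ('a, 'b) sheaf =
  stalk :: "'a \<Rightarrow> 'b monoid"
  res :: "'a \<Rightarrow> 'a \<Rightarrow> 'b \<Rightarrow> 'b"

definition OS_sheaf ::
    "('a \<Rightarrow> 'a \<Rightarrow> bool) \<Rightarrow> nat \<Rightarrow> 'a::order set \<Rightarrow> ('a, ('a set \<Rightarrow>\<^sub>0 int) set) sheaf" where
  "OS_sheaf lt p L =
     \<lparr>stalk = (\<lambda>x. OS lt p (down_set L x)),
      res = (\<lambda>y x. OS_restriction lt (down_set L x))\<rparr>"

text \<open>A chain \<open>x\<^sub>n < \<dots> < x\<^sub>0\<close> is the list \<open>[x\<^sub>0, \<dots>, x\<^sub>n]\<close>.\<close>

definition poset_chains :: "'a::order set \<Rightarrow> nat \<Rightarrow> 'a list set" where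
  "poset_chains P n = {\<sigma>. sorted_wrt (>) \<sigma> \<and> set \<sigma> \<subseteq> P \<and> length \<sigma> = n + 1}"

definition delete_nth :: "nat \<Rightarrow> 'a list \<Rightarrow> 'a list" where
  "delete_nth i \<sigma> = take i \<sigma> @ drop (i + 1) \<sigma>"

definition sheaf_chain_group ::
    "'a::order set \<Rightarrow> ('a, 'b) sheaf \<Rightarrow> nat \<Rightarrow> ('a list \<Rightarrow> 'b) monoid" where
  "sheaf_chain_group P F n = sum_group (poset_chains P n) (\<lambda>\<sigma>. stalk F (\<sigma> ! 0))"

text \<open>The element \<open>s\<^sub>\<sigma>\<close>: the section \<open>s\<close> placed in the summand of the chain \<open>\<sigma>\<close>.\<close>

definition place ::
    "'a::order set \<Rightarrow> ('a, 'b) sheaf \<Rightarrow> nat \<Rightarrow> 'a list \<Rightarrow> 'b \<Rightarrow> 'a list \<Rightarrow> 'b" where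
  "place P F n \<sigma> s =
     (\<lambda>\<tau>\<in>poset_chains P n. if \<tau> = \<sigma> then s else \<one>\<^bsub>stalk F (\<tau> ! 0)\<^esub>)"

text \<open>The differential from degree \<open>n + 1\<close> to degree \<open>n\<close>.\<close>

definition sheaf_boundary ::
    "'a::order set \<Rightarrow> ('a, 'b) sheaf \<Rightarrow> nat \<Rightarrow> ('a list \<Rightarrow> 'b) \<Rightarrow> 'a list \<Rightarrow> 'b" where
  "sheaf_boundary P F n f =
     (\<Otimes>\<^bsub>sheaf_chain_group P F n\<^esub>\<sigma>\<in>poset_chains P (n + 1).
        place P F n (delete_nth 0 \<sigma>) (res F (\<sigma> ! 0) (\<sigma> ! 1) (f \<sigma>))
        \<otimes>\<^bsub>sheaf_chain_group P F n\<^esub>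
        (\<Otimes>\<^bsub>sheaf_chain_group P F n\<^esub>i\<in>{1..n + 1}.
           place P F n (delete_nth i \<sigma>) (f \<sigma>) [^]\<^bsub>sheaf_chain_group P F n\<^esub> ((-1::int) ^ i)))"

definition sheaf_cycles ::
    "'a::order set \<Rightarrow> ('a, 'b) sheaf \<Rightarrow> nat \<Rightarrow> ('a list \<Rightarrow> 'b) set" where
  "sheaf_cycles P F n =
     (case n of
        0 \<Rightarrow> carrier (sheaf_chain_group P F 0)
      | Suc m \<Rightarrow> kernel (sheaf_chain_group P F (m + 1)) (sheaf_chain_group P F m) (sheaf_boundary P F m))"

definition sheaf_homology ::
    "nat \<Rightarrow> 'a::order set \<Rightarrow> ('a, 'b) sheaf \<Rightarrow> ('a list \<Rightarrow> 'b) set monoid" where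
  "sheaf_homology n P F =
     (sheaf_chain_group P F n)\<lparr>carrier := sheaf_cycles P F n\<rparr>
     Mod (sheaf_boundary P F n ` carrier (sheaf_chain_group P F (n + 1)))"


section \<open>The objects attached to a geometric lattice\<close>

definition punctured :: "'a::order set \<Rightarrow> 'a set" where
  "punctured L = L - {\<bottom>\<^bsub>poset_of L\<^esub>}"

definition not_above :: "'a::order set \<Rightarrow> 'a \<Rightarrow> 'a set" where
  "not_above L z = {x \<in> punctured L. \<not> z \<le> x}"

definition b_number :: "'a::order set \<Rightarrow> 'a \<Rightarrow> int" where
  "b_number L z =
     (-1) ^ (lattice_rank L - 2) * (\<Sum>x\<in>up_set L z. mobius L \<bottom>\<^bsub>poset_of L\<^esub> x)"

end

theory Submission
  imports Defs
begin

text \<open>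
  Grading by flats splits \<open>OS\<^sup>p(L\<^sub>\<le>\<^sub>x)\<close> functorially into the pieces \<open>A\<^sub>z = OS\<^sup>p(L\<^sub>\<le>\<^sub>z)\<close> for the flats
  \<open>z \<le> x\<close> of rank \<open>p\<close>. Hence the sheaf is the sum over \<open>z\<close> of the sheaves with constant value \<open>A\<^sub>z\<close>
  above \<open>z\<close> and value \<open>0\<close> elsewhere, and its homology is the sum of the homologies of the pairs
  \<open>(P, Q\<^sub>z)\<close> with coefficients in \<open>A\<^sub>z\<close>. As \<open>P\<close> has a greatest element, these are shifted reduced homology
  groups of \<open>Q\<^sub>z\<close>.

  The poset \<open>Q\<^sub>z\<close> has no homology below the top degree. More generally this is true for an interval
  without its bottom and without a proper modular cut \<open>U\<close>: for an element \<open>b \<notin> U\<close> covering the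
  bottom, the elements \<open>y\<close> with \<open>y \<squnion> b \<notin> U\<close> form a contractible poset, and adding the other elements
  in decreasing order attaches cones over joins of two posets of the same kind.

  The group \<open>A\<^sub>z\<close> is free of rank \<open>\<bar>\<mu>(0, z)\<bar>\<close>: multiplication by an atom contracts the complex
  \<open>OS(L\<^sub>\<le>\<^sub>z)\<close> with differential \<open>\<partial>\<close>, whose lower terms are sums of groups \<open>A\<^sub>y\<close> with \<open>y < z\<close>, so that its top term
  \<open>A\<^sub>z\<close> embeds into a free group and its Euler characteristic gives the recursion for \<open>\<mu>\<close>. The
  remaining top homology groups are subgroups of free groups, and their ranks are Euler characteristics,
  computed with Philip Hall's theorem. The claimed isomorphism holds because both sides are free of the
  same rank.
\<close>


section \<open>Free quotients\<close>

text \<open>Every group of the theorem is a quotient E / (E \<inter> J) of a subgroup E of a free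
  abelian group. The proof works with the pair (E, J) and forms cosets only where the groups of the
  statement are met, so that freeness, exactness and rank are questions about representatives.

  The difficulty lies in the coefficients. Monomials represent elements of the pieces
  \<open>A\<^sub>z\<close> only modulo the ideal, and mere vanishing of integral homology would need
  a universal coefficient argument. An explicit contracting homotopy avoids it: a sheaf chain is
  lifted to a combination of pairs of a chain and a monomial, and the homotopy moves the chain while
  leaving the monomial alone. It depends on the flat spanned by the monomial, and it descends to the
  quotient because each flat component of an element of the ideal already lies in the ideal of that
  flat.

  The homotopies work up to one degree below the top. There they make the complex exact, and
  additivity of rank then forces the rank of the top homology, for which no basis is ever
  exhibited.\<close>

definition frags :: "'b set \<Rightarrow> ('b \<Rightarrow>\<^sub>0 int) set" where
  "frags B = {c. Poly_Mapping.keys c \<subseteq> B}"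

text \<open>Closure is stated for differences alone, in step with the difference case of
  \<open>frag_induction\<close>.\<close>

definition subgrp :: "'v::ab_group_add set \<Rightarrow> bool" where
  "subgrp S \<longleftrightarrow> 0 \<in> S \<and> (\<forall>x\<in>S. \<forall>y\<in>S. x - y \<in> S)"

definition additive_on :: "'v::ab_group_add set \<Rightarrow> ('v \<Rightarrow> 'w::ab_group_add) \<Rightarrow> bool" where
  "additive_on E f \<longleftrightarrow> (\<forall>x\<in>E. \<forall>y\<in>E. f (x - y) = f x - f y)"

text \<open>The quotient \<open>E / (E \<inter> J)\<close> is free of rank \<open>n\<close>.\<close>

definition free_rank :: "('b \<Rightarrow>\<^sub>0 int) set \<Rightarrow> ('b \<Rightarrow>\<^sub>0 int) set \<Rightarrow> nat \<Rightarrow> bool" where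
  "free_rank E J n \<longleftrightarrow> (\<exists>\<phi> :: _ \<Rightarrow> (nat \<Rightarrow>\<^sub>0 int).
     additive_on E \<phi> \<and> \<phi> ` E = frags {..<n} \<and> (\<forall>x\<in>E. \<phi> x = 0 \<longleftrightarrow> x \<in> J))"

section \<open>Subgroups and additive maps of free abelian groups\<close>

lemma subgrp_0: "subgrp S \<Longrightarrow> 0 \<in> S"
  and subgrp_diff: "subgrp S \<Longrightarrow> x \<in> S \<Longrightarrow> y \<in> S \<Longrightarrow> x - y \<in> S"
  by (auto simp: subgrp_def)

lemma subgrp_uminus: "subgrp S \<Longrightarrow> x \<in> S \<Longrightarrow> - x \<in> S"
  using subgrp_diff[of S 0 x] subgrp_0[of S] by simp

lemma subgrp_add: "subgrp S \<Longrightarrow> x \<in> S \<Longrightarrow> y \<in> S \<Longrightarrow> x + y \<in> S"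
  using subgrp_diff[of S x "- y"] subgrp_uminus[of S y] by simp

lemma subgrp_sum: "subgrp S \<Longrightarrow> (\<And>i. i \<in> I \<Longrightarrow> f i \<in> S) \<Longrightarrow> sum f I \<in> S"
  by (induction I rule: infinite_finite_induct) (auto simp: subgrp_0 subgrp_add)

lemma subgrp_cmul:
  assumes "subgrp S" "x \<in> S" shows "frag_cmul c x \<in> S"
proof -
  have *: "frag_cmul (int n) x \<in> S" for n
    by (induction n) (auto simp: assms subgrp_0 subgrp_add frag_cmul_distrib)
  show ?thesis
    using *[of "nat c"] subgrp_uminus[OF assms(1) *[of "nat (- c)"]]
    by (cases "c \<ge> 0") auto
qed

lemma subgrp_frag_extend:
  assumes "subgrp S" "\<And>i. i \<in> Poly_Mapping.keys x \<Longrightarrow> f i \<in> S"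
  shows "frag_extend f x \<in> S"
  unfolding frag_extend_def by (intro subgrp_sum assms subgrp_cmul)

lemma subgrp_frags: "subgrp (frags B)"
  using keys_diff by (fastforce simp: subgrp_def frags_def)

lemmas frags_0 = subgrp_0[OF subgrp_frags]
  and frags_add = subgrp_add[OF subgrp_frags]
  and frags_diff = subgrp_diff[OF subgrp_frags]
  and frags_uminus = subgrp_uminus[OF subgrp_frags]
  and frags_cmul = subgrp_cmul[OF subgrp_frags]
  and frags_sum = subgrp_sum[OF subgrp_frags]

lemma frag_of_frags [simp]: "frag_of x \<in> frags B \<longleftrightarrow> x \<in> B"
  by (simp add: frags_def)

lemma frag_extend_frags:
  "x \<in> frags B \<Longrightarrow> (\<And>i. i \<in> B \<Longrightarrow> f i \<in> frags C) \<Longrightarrow> frag_extend f x \<in> frags C"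
  by (rule subgrp_frag_extend[OF subgrp_frags]) (auto simp: frags_def)

lemma frags_induct [consumes 1, case_names zero one diff]:
  assumes "x \<in> frags B" "P 0" "\<And>b. b \<in> B \<Longrightarrow> P (frag_of b)" "\<And>x y. P x \<Longrightarrow> P y \<Longrightarrow> P (x - y)"
  shows "P x"
  using assms by (intro frag_induction[of x B P]) (auto simp: frags_def)

lemma frag_extend_zero [simp]: "frag_extend (\<lambda>_. 0) c = 0"
  by (simp add: frag_extend_def)

lemma frag_cmul_diff2: "frag_cmul c (a - b) = frag_cmul c a - frag_cmul c b"
  by (intro poly_mapping_eqI) (simp add: lookup_minus right_diff_distrib)

lemma frag_cmul_minus2: "frag_cmul c (- a) = - frag_cmul c a"
  by (intro poly_mapping_eqI) simp

lemma frag_extend_ident: "(\<And>b. b \<in> B \<Longrightarrow> f b = frag_of b) \<Longrightarrow> x \<in> frags B \<Longrightarrow> frag_extend f x = x"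
  using frag_extend_eq[of x f frag_of] frag_expansion[of x] by (auto simp: frags_def)

lemma additive_onD: "additive_on E f \<Longrightarrow> x \<in> E \<Longrightarrow> y \<in> E \<Longrightarrow> f (x - y) = f x - f y"
  by (auto simp: additive_on_def)

lemma additive_on_0: "additive_on E f \<Longrightarrow> subgrp E \<Longrightarrow> f 0 = 0"
  using additive_onD[of E f 0 0] by (auto simp: subgrp_def)

lemma additive_on_uminus: "additive_on E f \<Longrightarrow> subgrp E \<Longrightarrow> x \<in> E \<Longrightarrow> f (- x) = - f x"
  using additive_onD[of E f 0 x] additive_on_0[of E f] by (auto simp: subgrp_def)

lemma additive_on_add:
  "additive_on E f \<Longrightarrow> subgrp E \<Longrightarrow> x \<in> E \<Longrightarrow> y \<in> E \<Longrightarrow> f (x + y) = f x + f y"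
  using additive_onD[of E f x "- y"] additive_on_uminus[of E f y] subgrp_uminus[of E y] by auto

lemma additive_on_frag_extend [simp]: "additive_on E (frag_extend f)"
  by (simp add: additive_on_def frag_extend_diff)

lemma additive_on_subset: "additive_on E f \<Longrightarrow> S \<subseteq> E \<Longrightarrow> additive_on S f"
  by (auto simp: additive_on_def)

text \<open>A surjection onto a free group splits: pick a preimage of every basis element and extend
  linearly. Being a \<open>frag_extend\<close>, the section is additive for all arguments and not
  only on its intended domain.\<close>

lemma free_rank_section:
  fixes E :: "('b \<Rightarrow>\<^sub>0 int) set" and \<phi> :: "('b \<Rightarrow>\<^sub>0 int) \<Rightarrow> (nat \<Rightarrow>\<^sub>0 int)"
  assumes E: "subgrp E" and ph: "additive_on E \<phi>" "\<phi> ` E = frags {..<n::nat}"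
  obtains s where "\<And>c. c \<in> frags {..<n} \<Longrightarrow> s c \<in> E" "\<And>c. c \<in> frags {..<n} \<Longrightarrow> \<phi> (s c) = c"
    "\<And>x y. s (x - y) = s x - s y"
proof -
  have "\<forall>i\<in>{..<n}. \<exists>x\<in>E. \<phi> x = frag_of i"
    using ph(2) by (metis frag_of_frags image_iff)
  then obtain e where e: "\<And>i. i < n \<Longrightarrow> e i \<in> E" "\<And>i. i < n \<Longrightarrow> \<phi> (e i) = frag_of i"
    by (metis lessThan_iff)
  have 1: "frag_extend e c \<in> E" if "c \<in> frags {..<n}" for c
    by (rule subgrp_frag_extend[OF E]) (use that e in \<open>auto simp: frags_def\<close>)
  have 2: "\<phi> (frag_extend e c) = c" if "c \<in> frags {..<n}" for c
  proof -
    have "c \<in> frags {..<n} \<Longrightarrow> frag_extend e c \<in> E \<and> \<phi> (frag_extend e c) = c" for c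
    proof (induction c rule: frags_induct)
      case zero then show ?case using additive_on_0[OF ph(1) E] subgrp_0[OF E] by simp
    next
      case (one b) then show ?case using e by simp
    next
      case (diff x y) then show ?case
        by (simp add: frag_extend_diff subgrp_diff[OF E] additive_onD[OF ph(1)])
    qed
    then show ?thesis using that by blast
  qed
  show ?thesis by (rule that[of "frag_extend e"]) (use 1 2 frag_extend_diff in auto)
qed

text \<open>The sequence S/J -> E/J -> E/S splits because E/S is free; the section of
  \<open>free_rank_section\<close> supplies the isomorphism with the direct sum.\<close>

lemma free_rank_extension:
  assumes E: "subgrp E" and S: "subgrp S" and sub: "S \<subseteq> E" "J \<inter> E \<subseteq> S"
    and m: "free_rank S J m" and n: "free_rank E S n"
  shows "free_rank E J (m + n)"
proof -
  obtain f where f: "additive_on S f" "f ` S = frags {..<m}" "\<And>x. x \<in> S \<Longrightarrow> f x = 0 \<longleftrightarrow> x \<in> J"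
    using m by (auto simp: free_rank_def)
  obtain g where g: "additive_on E g" "g ` E = frags {..<n}" "\<And>x. x \<in> E \<Longrightarrow> g x = 0 \<longleftrightarrow> x \<in> S"
    using n by (auto simp: free_rank_def)
  obtain s where s: "\<And>c. c \<in> frags {..<n} \<Longrightarrow> s c \<in> E" "\<And>c. c \<in> frags {..<n} \<Longrightarrow> g (s c) = c"
    "\<And>x y. s (x - y) = s x - s y"
    using free_rank_section[OF E g(1,2)] by metis
  have gE: "g x \<in> frags {..<n}" if "x \<in> E" for x using g(2) that by auto
  have fS: "f x \<in> frags {..<m}" if "x \<in> S" for x using f(2) that by auto
  have inS: "x - s (g x) \<in> S" if "x \<in> E" for x
    using g(3)[of "x - s (g x)"] additive_onD[OF g(1) that s(1)[OF gE[OF that]]] s gE that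
    by (auto simp: subgrp_diff[OF E])
  \<comment> \<open>The first m coordinates belong to S/J, the other n to E/S: \<open>?T\<close>
    shifts into the second block, \<open>?P\<close> and \<open>?Q\<close> read off the two
    blocks.\<close>
  let ?T = "frag_extend (\<lambda>i. frag_of (m + i))"
  let ?P = "frag_extend (\<lambda>i. if i < m then frag_of i else 0)"
  let ?Q = "frag_extend (\<lambda>i. if i < m then 0 else frag_of (i - m))"
  have P: "?P c = c" "?Q c = 0" if "c \<in> frags {..<m}" for c
    using that by (induction rule: frags_induct) (auto simp: frag_extend_diff)
  have T: "?P (?T c) = 0" "?Q (?T c) = c" "?T c \<in> frags {..<m+n}" if "c \<in> frags {..<n}" for c
    using that by (induction rule: frags_induct)
      (auto simp: frag_extend_diff frags_0 frags_diff)
  have C: "?P c \<in> frags {..<m} \<and> ?Q c \<in> frags {..<n} \<and> ?P c + ?T (?Q c) = c"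
    if "c \<in> frags {..<m+n}" for c using that
  proof (induction rule: frags_induct)
    case (diff x y)
    have "?P (x - y) + ?T (?Q (x - y)) = (?P x + ?T (?Q x)) - (?P y + ?T (?Q y))"
      by (simp add: frag_extend_diff)
    then show ?case using diff by (simp add: frag_extend_diff frags_diff)
  qed (auto simp: frags_0)
  \<comment> \<open>Subtracting the section of its image moves x into S, where \<open>f\<close> may
    be applied.\<close>
  define h where "h x = f (x - s (g x)) + ?T (g x)" for x
  have 1: "additive_on E h"
    unfolding additive_on_def
  proof (intro ballI)
    fix x y assume xy: "x \<in> E" "y \<in> E"
    have "x - y - s (g (x - y)) = (x - s (g x)) - (y - s (g y))"
      by (simp add: additive_onD[OF g(1) xy] s(3))
    then have "f (x - y - s (g (x - y))) = f (x - s (g x)) - f (y - s (g y))"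
      using additive_onD[OF f(1) inS[OF xy(1)] inS[OF xy(2)]] by (simp only:)
    then show "h (x - y) = h x - h y"
      unfolding h_def by (simp only: additive_onD[OF g(1) xy] frag_extend_diff) simp
  qed
  have hE: "h x \<in> frags {..<m+n}" if "x \<in> E" for x
    unfolding h_def
    by (rule frags_add[OF _ T(3)[OF gE[OF that]]])
       (use fS[OF inS[OF that]] in \<open>auto simp: frags_def\<close>)
  have "c \<in> h ` E" if c: "c \<in> frags {..<m+n}" for c
  proof -
    have "?P c \<in> f ` S" using C[OF c] f(2) by simp
    then obtain x1 where x1: "x1 \<in> S" "f x1 = ?P c" by auto
    let ?x = "x1 + s (?Q c)"
    have E1: "x1 \<in> E" "s (?Q c) \<in> E" using x1 sub s(1) C[OF c] by auto
    have gx: "g ?x = ?Q c"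
      using additive_on_add[OF g(1) E E1] g(3)[OF E1(1)] x1 s(2) C[OF c] by auto
    then have "h ?x = c" using C[OF c] x1 by (simp add: h_def)
    then show ?thesis using subgrp_add[OF E E1] by force
  qed
  then have 2: "h ` E = frags {..<m+n}" using hE by auto
  have 3: "h x = 0 \<longleftrightarrow> x \<in> J" if x: "x \<in> E" for x
  proof
    assume h: "h x = 0"
    have "?Q (h x) = g x" "?P (h x) = f (x - s (g x))"
      using P[OF fS[OF inS[OF x]]] T[OF gE[OF x]] by (auto simp: h_def frag_extend_add)
    then have z: "g x = 0" "f (x - s (g x)) = 0" using h by auto
    then have "s (g x) = 0" using s(3)[of 0 0] by simp
    then show "x \<in> J" using f(3)[OF inS[OF x]] z by auto
  next
    assume "x \<in> J"
    then have "x \<in> S" using sub x by auto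
    then have "g x = 0" using g(3) x by auto
    moreover have "s 0 = 0" using s(3)[of 0 0] by simp
    ultimately show "h x = 0" using f(3)[OF \<open>x \<in> S\<close>] \<open>x \<in> J\<close> by (simp add: h_def)
  qed
  show ?thesis unfolding free_rank_def using 1 2 3 by blast
qed

text \<open>\<open>f\<close> induces an isomorphism of E/J with E'/J'. Surjectivity is asked only
  modulo J', so that \<open>f\<close> may map onto a set of representatives.\<close>

lemma free_rank_transfer:
  assumes "free_rank E' J' n" "additive_on E f" "\<And>x. x \<in> E \<Longrightarrow> f x \<in> E'"
    and k: "\<And>x. x \<in> E \<Longrightarrow> f x \<in> J' \<longleftrightarrow> x \<in> J" and onto: "\<And>y. y \<in> E' \<Longrightarrow> \<exists>x\<in>E. y - f x \<in> J'"
    and E': "subgrp E'"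
  shows "free_rank E J n"
proof -
  obtain g where g: "additive_on E' g" "g ` E' = frags {..<n}" "\<And>x. x \<in> E' \<Longrightarrow> g x = 0 \<longleftrightarrow> x \<in> J'"
    using assms(1) by (auto simp: free_rank_def)
  have "additive_on E (g \<circ> f)"
    using assms(2,3) g(1) by (auto simp: additive_on_def)
  moreover have "g y \<in> (g \<circ> f) ` E" if y: "y \<in> E'" for y
  proof -
    obtain x where x: "x \<in> E" "y - f x \<in> J'" using onto[OF y] by blast
    then have "g y = g (f x)"
      using g(3)[of "y - f x"] additive_onD[OF g(1) y] assms(3) y subgrp_diff[OF E'] by auto
    then show ?thesis using x by auto
  qed
  then have "g ` E' = (g \<circ> f) ` E" using assms(3) by auto
  then have "(g \<circ> f) ` E = frags {..<n}" using g(2) by simp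
  moreover have "\<forall>x\<in>E. (g \<circ> f) x = 0 \<longleftrightarrow> x \<in> J" using g(3) assms(3) k by auto
  ultimately show ?thesis unfolding free_rank_def by blast
qed

lemma free_rank_0: "subgrp E \<Longrightarrow> E \<subseteq> J \<Longrightarrow> free_rank E J 0"
  unfolding free_rank_def by (rule exI[of _ "\<lambda>_. 0"]) (auto simp: additive_on_def frags_def subgrp_def)

lemma free_rank_cong: "free_rank E J n \<Longrightarrow> (\<And>x. x \<in> E \<Longrightarrow> x \<in> J \<longleftrightarrow> x \<in> J') \<Longrightarrow> free_rank E J' n"
  unfolding free_rank_def by auto

lemma int_subgroup_generator:
  assumes S: "subgrp S" and nz: "x \<in> S" "x \<noteq> (0::int)"
  obtains d where "d \<in> S" "d > 0" "\<And>y. y \<in> S \<Longrightarrow> d dvd y"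
proof -
  have "\<bar>x\<bar> \<in> S" using subgrp_uminus[OF S nz(1)] nz by (cases "x < 0") auto
  then have ex: "\<exists>n. int n \<in> S \<and> n > 0" using nz by (intro exI[of _ "nat \<bar>x\<bar>"]) auto
  define d where "d = (LEAST n. int n \<in> S \<and> n > 0)"
  have d: "int d \<in> S" "d > 0" using LeastI_ex[OF ex] by (auto simp: d_def)
  have "int d dvd y" if y: "y \<in> S" for y
  proof (rule ccontr)
    assume nd: "\<not> int d dvd y"
    have mul: "int k * int d \<in> S" for k
      by (induction k) (auto simp: subgrp_0[OF S] distrib_right intro!: subgrp_add[OF S] d)
    have "y div int d * int d \<in> S"
      using mul[of "nat (y div int d)"] subgrp_uminus[OF S mul[of "nat (- (y div int d))"]]
      by (cases "y div int d \<ge> 0") auto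
    then have "y mod int d \<in> S" using subgrp_diff[OF S y, of "y div int d * int d"] by (simp only: minus_div_mult_eq_mod)
    moreover have "y mod int d \<ge> 0" "y mod int d < int d" using d by simp_all
    moreover have "y mod int d \<noteq> 0" using nd by presburger
    ultimately have "int (nat (y mod int d)) \<in> S \<and> nat (y mod int d) > 0" "nat (y mod int d) < d" by auto
    then show False using not_less_Least[of "nat (y mod int d)" "\<lambda>n. int n \<in> S \<and> n > 0"] by (auto simp: d_def)
  qed
  then show ?thesis using that[of "int d"] d by auto
qed

text \<open>Subgroups of a free group of finite rank are free. The induction splits off the last
  coordinate \<open>p\<close>: its kernel embeds in rank n, and its image in the integers is zero or
  infinite cyclic.\<close>

lemma free_rank_of_embedding:
  assumes "subgrp S" "additive_on S \<phi>" "\<phi> ` S \<subseteq> frags {..<n::nat}" "\<And>x. x \<in> S \<Longrightarrow> \<phi> x = 0 \<longleftrightarrow> x \<in> J"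
  shows "\<exists>m. free_rank S J m"
  using assms
proof (induction n arbitrary: S)
  case 0
  then have "\<phi> ` S = frags {..<0}" using subgrp_0[of S] additive_on_0[of S \<phi>]
    by (auto simp: frags_def image_iff)
  then show ?case using 0 unfolding free_rank_def by blast
next
  case (Suc n)
  note S = \<open>subgrp S\<close> and add = \<open>additive_on S \<phi>\<close>
  define p where "p x = Poly_Mapping.lookup (\<phi> x) n" for x
  have padd: "p (x - y) = p x - p y" if "x \<in> S" "y \<in> S" for x y
    using additive_onD[OF add that] by (simp add: p_def lookup_minus)
  define S' where "S' = {x \<in> S. p x = 0}"
  have S': "subgrp S'" using S padd additive_on_0[OF add S] by (auto simp: subgrp_def S'_def p_def)
  have "\<phi> x \<in> frags {..<n}" if "x \<in> S'" for x
  proof -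
    have "\<phi> x \<in> frags {..<Suc n}" using that Suc.prems(3) by (auto simp: S'_def)
    moreover have "n \<notin> Poly_Mapping.keys (\<phi> x)" using that by (simp add: S'_def p_def in_keys_iff)
    ultimately show ?thesis by (fastforce simp: frags_def less_Suc_eq)
  qed
  then have "\<exists>m. free_rank S' J m"
    using Suc.IH[OF S' additive_on_subset[OF add]] Suc.prems(4) by (auto simp: S'_def)
  then obtain m where m: "free_rank S' J m" by blast
  show ?case
  proof (cases "\<forall>x\<in>S. p x = 0")
    case True
    then have "S' = S" by (auto simp: S'_def)
    then show ?thesis using m by blast
  next
    case False
    then obtain x where x: "p x \<in> p ` S" "p x \<noteq> 0" by auto
    have "subgrp (p ` S)"
      unfolding subgrp_def
    proof (intro conjI ballI)
      show "0 \<in> p ` S" using subgrp_0[OF S] additive_on_0[OF add S] by (force simp: p_def)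
      fix a b assume "a \<in> p ` S" "b \<in> p ` S"
      then show "a - b \<in> p ` S" using padd subgrp_diff[OF S] by (auto simp: image_iff) metis
    qed
    then obtain d where d: "d \<in> p ` S" "d > 0" "\<And>y. y \<in> p ` S \<Longrightarrow> d dvd y"
      using int_subgroup_generator[OF _ x] by metis
    obtain s0 where s0: "s0 \<in> S" "p s0 = d" using d by auto
    have pm: "p (frag_cmul c s0) = c * d" for c
    proof -
      have "additive_on S p" using padd by (auto simp: additive_on_def)
      have *: "p (frag_cmul (int k) s0) = int k * d" for k
      proof (induction k)
        case 0 then show ?case using additive_on_0[OF \<open>additive_on S p\<close> S] by simp
      next
        case (Suc k) then show ?case
          using additive_on_add[OF \<open>additive_on S p\<close> S s0(1) subgrp_cmul[OF S s0(1)]] s0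
          by (simp add: frag_cmul_distrib distrib_right)
      qed
      show ?thesis
        using *[of "nat c"] *[of "nat (-c)"]
          additive_on_uminus[OF \<open>additive_on S p\<close> S subgrp_cmul[OF S s0(1)], of "int (nat (-c))"]
        by (cases "c \<ge> 0") (auto)
    qed
    have "free_rank S S' 1"
      unfolding free_rank_def
    proof (intro exI conjI ballI)
      \<comment> \<open>The image of \<open>p\<close> consists of the multiples of \<open>d\<close>,
        so that division by \<open>d\<close> is exact and additive on it.\<close>
      let ?f = "\<lambda>x. frag_cmul (p x div d) (frag_of (0::nat))"
      show "additive_on S ?f"
        unfolding additive_on_def
      proof (intro ballI)
        fix x y assume "x \<in> S" "y \<in> S"
        then show "?f (x - y) = ?f x - ?f y"
          using padd d(3) by (simp add: div_diff frag_cmul_diff_distrib del: single_one)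
      qed
      have "c \<in> ?f ` S" if c: "c \<in> frags {..<1}" for c
      proof -
        have "c = frag_cmul (Poly_Mapping.lookup c 0) (frag_of 0)"
          using c by (intro poly_mapping_eqI) (auto simp: frags_def lookup_single in_keys_iff when_def simp del: single_one)
        then have "c = ?f (frag_cmul (Poly_Mapping.lookup c 0) s0)" using pm d by auto
        then show ?thesis using subgrp_cmul[OF S s0(1)] by blast
      qed
      moreover have "?f x \<in> frags {..<1}" for x by (intro subgrp_cmul subgrp_frags) (simp del: single_one)
      ultimately show "?f ` S = frags {..<1}" by auto
      fix x assume "x \<in> S"
      then show "?f x = 0 \<longleftrightarrow> x \<in> S'" using d(3)[of "p x"] d(2) by (auto simp: S'_def dvd_div_eq_0_iff)
    qed
    moreover have "J \<inter> S \<subseteq> S'"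
    proof
      fix x assume "x \<in> J \<inter> S"
      then have "x \<in> S" "\<phi> x = 0" using Suc.prems(4) by auto
      then show "x \<in> S'" by (simp add: S'_def p_def)
    qed
    ultimately show ?thesis using free_rank_extension[OF S S' _ _ m] by (auto simp: S'_def)
  qed
qed

lemma free_rank_subgroup:
  assumes "free_rank E J n" "subgrp S" "S \<subseteq> E" shows "\<exists>m. free_rank S J m"
proof -
  obtain g where g: "additive_on E g" "g ` E = frags {..<n}" "\<And>x. x \<in> E \<Longrightarrow> g x = 0 \<longleftrightarrow> x \<in> J"
    using assms by (auto simp: free_rank_def)
  then show ?thesis
    using assms by (intro free_rank_of_embedding[of S g n J]) (auto intro: additive_on_subset)
qed

text \<open>The way back from pairs to actual groups: \<open>q\<close> presents G as E modulo J, and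
  \<open>g\<close> has the same kernel. The representatives chosen by \<open>SOME\<close> are
  harmless, as \<open>g\<close> depends only on the class.\<close>

lemma free_abelian_of_frk:
  assumes E: "subgrp E" and n: "free_rank E J n" and G: "group G"
    and q: "\<And>x y. x \<in> E \<Longrightarrow> y \<in> E \<Longrightarrow> q (x + y) = q x \<otimes>\<^bsub>G\<^esub> q y" "q ` E = carrier G"
      "\<And>x. x \<in> E \<Longrightarrow> q x = \<one>\<^bsub>G\<^esub> \<longleftrightarrow> x \<in> J"
  shows "free_abelian_of_rank G (int n)"
proof -
  interpret G: group G by fact
  obtain g where g: "additive_on E g" "g ` E = frags {..<n}" "\<And>x. x \<in> E \<Longrightarrow> g x = 0 \<longleftrightarrow> x \<in> J"
    using n by (auto simp: free_rank_def)
  have qE: "q x \<in> carrier G" if "x \<in> E" for x using that q(2) by auto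
  have q1: "q x = q y \<longleftrightarrow> g x = g y" if xy: "x \<in> E" "y \<in> E" for x y
  proof -
    have "q x = q (x - y) \<otimes>\<^bsub>G\<^esub> q y" using q(1)[OF subgrp_diff[OF E xy] xy(2)] by simp
    then have "q x = q y \<longleftrightarrow> q (x - y) = \<one>\<^bsub>G\<^esub>" using qE[OF subgrp_diff[OF E xy]] qE[OF xy(2)]
      by simp
    also have "\<dots> \<longleftrightarrow> g x - g y = 0"
      using q(3)[OF subgrp_diff[OF E xy]] g(3)[OF subgrp_diff[OF E xy]] additive_onD[OF g(1) xy] by simp
    finally show ?thesis by simp
  qed
  define r where "r y = (SOME x. x \<in> E \<and> q x = y)" for y
  have r: "r y \<in> E" "q (r y) = y" if "y \<in> carrier G" for y
  proof -
    have "\<exists>x. x \<in> E \<and> q x = y" using that q(2) by force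
    from someI_ex[OF this] show "r y \<in> E" "q (r y) = y" by (auto simp: r_def)
  qed
  have gr: "g (r (q x)) = g x" if "x \<in> E" for x
    using q1[OF r(1)[OF qE[OF that]] that] r(2)[OF qE[OF that]] by simp
  have "(g \<circ> r) \<in> iso G (free_Abelian_group {..<n})"
    unfolding iso_def
  proof (intro CollectI conjI homI)
    fix x assume "x \<in> carrier G"
    then show "(g \<circ> r) x \<in> carrier (free_Abelian_group {..<n})" using r g(2) by (auto simp: frags_def)
  next
    fix x y assume xy: "x \<in> carrier G" "y \<in> carrier G"
    have "x \<otimes>\<^bsub>G\<^esub> y = q (r x + r y)" using q(1) r xy by auto
    then have "g (r (x \<otimes>\<^bsub>G\<^esub> y)) = g (r x + r y)" using gr subgrp_add[OF E] r xy by auto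
    then show "(g \<circ> r) (x \<otimes>\<^bsub>G\<^esub> y) = (g \<circ> r) x \<otimes>\<^bsub>free_Abelian_group {..<n}\<^esub> (g \<circ> r) y"
      using additive_on_add[OF g(1) E] r xy by auto
  next
    show "bij_betw (g \<circ> r) (carrier G) (carrier (free_Abelian_group {..<n}))"
    proof (rule bij_betw_imageI)
      show "inj_on (g \<circ> r) (carrier G)"
      proof (rule inj_onI)
        fix x y assume xy: "x \<in> carrier G" "y \<in> carrier G" "(g \<circ> r) x = (g \<circ> r) y"
        then show "x = y" using q1[OF r(1)[OF xy(1)] r(1)[OF xy(2)]] r(2) by simp
      qed
      have "g x \<in> (g \<circ> r) ` carrier G" if "x \<in> E" for x using gr[OF that] qE[OF that] by force
      then have "(g \<circ> r) ` carrier G = g ` E" using r by auto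
      then show "(g \<circ> r) ` carrier G = carrier (free_Abelian_group {..<n})"
        using g(2) by (auto simp: frags_def)
    qed
  qed
  then have "G \<cong> free_Abelian_group {..<n}" by (auto simp: is_iso_def)
  moreover have "comm_group G"
  proof (rule G.group_comm_groupI)
    fix x y assume xy: "x \<in> carrier G" "y \<in> carrier G"
    then show "x \<otimes>\<^bsub>G\<^esub> y = y \<otimes>\<^bsub>G\<^esub> x" using q(1)[of "r x" "r y"] q(1)[of "r y" "r x"] r by (simp add: add.commute)
  qed
  ultimately show ?thesis by (auto simp: free_abelian_of_rank_def)
qed

section \<open>Rank: uniqueness, direct sums, exact complexes\<close>

lemma free_abelian_of_rank_unique:
  assumes "free_abelian_of_rank G a" "free_abelian_of_rank G b" shows "a = b"
proof -
  obtain m n where mn: "a = int m" "b = int n" "G \<cong> free_Abelian_group {..<m}" "G \<cong> free_Abelian_group {..<n}"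
    and G: "group G"
    using assms by (auto simp: free_abelian_of_rank_def comm_group_def)
  have "free_Abelian_group {..<m} \<cong> free_Abelian_group {..<n}"
    using group.iso_sym[OF G mn(3)] mn(4) iso_trans by blast
  then have "{..<m} \<approx> {..<n}" by (simp add: isomorphic_free_Abelian_groups)
  then have "card {..<m} = card {..<n}" by (intro bij_betw_same_card[of "SOME f. bij_betw f {..<m} {..<n}"]) (metis eqpoll_def someI_ex)
  then show ?thesis using mn by simp
qed

lemma free_rank_unique:
  assumes E: "subgrp E" and "free_rank E J m" "free_rank E J n" shows "m = n"
proof -
  obtain g where g: "additive_on E g" "g ` E = frags {..<n}" "\<And>x. x \<in> E \<Longrightarrow> g x = 0 \<longleftrightarrow> x \<in> J"
    using assms by (auto simp: free_rank_def)
  have "free_abelian_of_rank (free_Abelian_group {..<n}) (int k)" if "free_rank E J k" for k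
    using g by (intro free_abelian_of_frk[OF E that, of _ g]) (auto simp: additive_on_add[OF g(1) E] frags_def)
  then show ?thesis using assms free_abelian_of_rank_unique by (metis of_nat_eq_iff)
qed

text \<open>The classes of \<open>\<kappa>\<close> grade the basis, and \<open>gr\<close> makes J
  homogeneous, so that the quotient is the sum of its graded pieces. They are split off one at a
  time.\<close>

lemma free_rank_direct_sum:
  fixes \<kappa> :: "'b \<Rightarrow> 'i"
  assumes "finite I" "\<And>b. b \<in> B \<Longrightarrow> \<kappa> b \<in> I" and J: "subgrp J"
    and gr: "\<And>x i. x \<in> frags B \<Longrightarrow> x \<in> J \<Longrightarrow> frag_extend (\<lambda>b. if \<kappa> b = i then frag_of b else 0) x \<in> J"
    and n: "\<And>i. i \<in> I \<Longrightarrow> free_rank (frags {b \<in> B. \<kappa> b = i}) J (n i)"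
  shows "free_rank (frags B) J (\<Sum>i\<in>I. n i)"
  using assms
proof (induction I arbitrary: B)
  case empty
  then have "B = {}" by blast
  then have "frags B \<subseteq> {0}" by (auto simp: frags_def)
  then show ?case using free_rank_0[OF subgrp_frags, of B J] subgrp_0[OF J] by auto
next
  case (insert i I)
  let ?p = "frag_extend (\<lambda>b. if \<kappa> b = i then frag_of b else 0)"
  let ?B' = "{b \<in> B. \<kappa> b \<noteq> i}"
  \<comment> \<open>S collects the elements that agree modulo J with their part in class i: S/J is
    this summand, and the quotient by S is the sum of the others.\<close>
  define S where "S = {x \<in> frags B. x - ?p x \<in> J}"
  have S: "subgrp S"
    unfolding subgrp_def S_def
  proof (safe intro!: frags_diff)
    fix x y assume "x - ?p x \<in> J" "y - ?p y \<in> J"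
    from subgrp_diff[OF J this] show "x - y - ?p (x - y) \<in> J"
      by (simp add: frag_extend_diff algebra_simps)
  qed (auto simp: frags_0 subgrp_0[OF J])
  have pB: "?p x \<in> frags {b \<in> B. \<kappa> b = i}" "x - ?p x \<in> frags ?B'" if "x \<in> frags B" for x
    using that
  proof (induction rule: frags_induct)
    case (diff x y)
    have "x - y - ?p (x - y) = (x - ?p x) - (y - ?p y)" by (simp add: frag_extend_diff)
    then show "?p (x - y) \<in> frags {b \<in> B. \<kappa> b = i}" "x - y - ?p (x - y) \<in> frags ?B'"
      using frags_diff[OF diff(1,3)] frags_diff[OF diff(2,4)]
      by (simp_all only: \<open>x - y - ?p (x - y) = _\<close>) (simp_all only: frag_extend_diff)
  qed (auto simp: frags_0)
  have pid: "?p x = x" if "x \<in> frags {b \<in> B. \<kappa> b = i}" for x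
    using that by (intro frag_extend_ident[of "{b \<in> B. \<kappa> b = i}"]) auto
  have pz: "?p x = 0" if "x \<in> frags ?B'" for x
    using that by (induction rule: frags_induct) (auto simp: frag_extend_diff)
  have mono: "frags C \<subseteq> frags B" if "C \<subseteq> B" for C using that by (auto simp: frags_def)
  have "free_rank (frags ?B') J (\<Sum>i\<in>I. n i)"
  proof (rule insert.IH)
    fix x k assume "x \<in> frags ?B'" "x \<in> J"
    then show "frag_extend (\<lambda>b. if \<kappa> b = k then frag_of b else 0) x \<in> J"
      using insert.prems(3) mono[of ?B'] by auto
  next
    fix k assume k: "k \<in> I"
    then have "{b \<in> ?B'. \<kappa> b = k} = {b \<in> B. \<kappa> b = k}" using insert.hyps by auto
    then show "free_rank (frags {b \<in> ?B'. \<kappa> b = k}) J (n k)" using insert.prems(4) k by auto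
  qed (use insert.prems J in auto)
  then have 1: "free_rank (frags B) S (\<Sum>i\<in>I. n i)"
  proof (rule free_rank_transfer[where f = "\<lambda>x. x - ?p x"])
    fix y assume y: "y \<in> frags ?B'"
    then show "\<exists>x\<in>frags B. y - (x - ?p x) \<in> J"
      using pz[OF y] mono[of ?B'] by (intro bexI[of _ y]) (auto simp: subgrp_0[OF J])
  qed (auto simp: additive_on_def frag_extend_diff pB S_def subgrp_frags)
  have Jp: "?p x \<in> J" if "x \<in> frags B" "x \<in> J" for x using insert.prems(3) that by auto
  have 2: "free_rank S J (n i)"
  proof (rule free_rank_transfer[where f = ?p, OF insert.prems(4)])
    fix x assume x: "x \<in> S"
    show "?p x \<in> J \<longleftrightarrow> x \<in> J"
      using x Jp[of x] subgrp_add[OF J, of "x - ?p x" "?p x"] by (auto simp: S_def)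
  next
    fix y assume y: "y \<in> frags {b \<in> B. \<kappa> b = i}"
    then show "\<exists>x\<in>S. y - ?p x \<in> J"
      using mono[of "{b \<in> B. \<kappa> b = i}"]
      by (intro bexI[of _ y]) (auto simp: pid[OF y] subgrp_0[OF J] S_def)
  qed (auto simp: S_def pB subgrp_frags)
  have "free_rank (frags B) J (n i + (\<Sum>i\<in>I. n i))"
    by (rule free_rank_extension[OF subgrp_frags S _ _ 2 1])
       (auto simp: S_def intro!: subgrp_diff[OF J] Jp)
  then show ?case using insert.hyps by simp
qed

lemma free_rank_frags: "finite B \<Longrightarrow> free_rank (frags B) {0} (card B)"
proof -
  assume B: "finite B"
  have "free_rank (frags {b \<in> B. b = i}) {0} 1" if "i \<in> B" for i
  proof -
    have eq: "{b \<in> B. b = i} = {i}" using that by auto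
    have "free_rank (frags {i}) {0} 1"
      unfolding free_rank_def
    proof (intro exI[of _ "frag_extend (\<lambda>_. frag_of 0)"] conjI ballI)
      have *: "frag_extend (\<lambda>_. frag_of i) (frag_extend (\<lambda>_. frag_of (0::nat)) x) = x" if "x \<in> frags {i}" for x
        using that by (induction rule: frags_induct) (auto simp: frag_extend_diff simp del: single_one)
      have **: "frag_extend (\<lambda>_. frag_of (0::nat)) (frag_extend (\<lambda>_. frag_of i) x) = x" if "x \<in> frags {..<1}" for x
        using that by (induction rule: frags_induct) (auto simp: frag_extend_diff simp del: single_one)
      show "frag_extend (\<lambda>_. frag_of (0::nat)) ` frags {i} = frags {..<1}"
      proof (intro equalityI subsetI)
        fix x :: "nat \<Rightarrow>\<^sub>0 int" assume "x \<in> frags {..<1}"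
        then show "x \<in> frag_extend (\<lambda>_. frag_of 0) ` frags {i}"
          by (intro image_eqI[of _ _ "frag_extend (\<lambda>_. frag_of i) x"]) (auto simp: ** intro: frag_extend_frags simp del: single_one)
      qed (auto intro: frag_extend_frags simp del: single_one)
      show "(frag_extend (\<lambda>_. frag_of (0::nat)) x = 0) = (x \<in> {0})" if "x \<in> frags {i}" for x
        using *[OF that] by auto
    qed simp
    then show ?thesis by (simp add: eq)
  qed
  then show ?thesis
    using free_rank_direct_sum[of B B "\<lambda>b. b" "{0}" "\<lambda>_. 1"] B by (auto simp: subgrp_def)
qed

text \<open>Exactness makes \<open>d\<close> an isomorphism of E (n + 1)/Z (n + 1) with Z n/J n for
  n < N, so the rank of the cycles in degree n + 1 is c (n + 1) minus the one in degree n. That the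
  cycles have a rank at all comes from \<open>free_rank_subgroup\<close>. The disjunct
  \<open>n = 0\<close> overrides the truncated \<open>n - 1\<close>: in degree 0 everything is a
  cycle.\<close>

lemma free_rank_exact_complex:
  fixes E J :: "nat \<Rightarrow> ('b \<Rightarrow>\<^sub>0 int) set" and N :: nat
  assumes E: "\<And>n. subgrp (E n)" and J: "\<And>n. subgrp (J n)" "\<And>n. J n \<subseteq> E n"
    and d: "\<And>x y. d (x - y) = d x - d y" "\<And>n x. x \<in> E (Suc n) \<Longrightarrow> d x \<in> E n"
      "\<And>n x. x \<in> J (Suc n) \<Longrightarrow> d x \<in> J n"
      "\<And>n x. x \<in> E (Suc (Suc n)) \<Longrightarrow> d (d x) \<in> J n"
    and c: "\<And>n. n \<le> N \<Longrightarrow> free_rank (E n) (J n) (c n)"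
    and ex: "\<And>n x. n < N \<Longrightarrow> x \<in> E n \<Longrightarrow> n = 0 \<or> d x \<in> J (n - 1) \<Longrightarrow> \<exists>y\<in>E (Suc n). x - d y \<in> J n"
    and Z: "\<And>n. Z n = {x \<in> E n. n = 0 \<or> d x \<in> J (n - 1)}"
  shows "\<exists>r. free_rank (Z N) (J N) r \<and> int r = (\<Sum>n\<le>N. (-1) ^ (N - n) * int (c n))"
proof -
  have add: "additive_on S d" for S using d(1) by (auto simp: additive_on_def)
  have Zsub: "subgrp (Z n)" for n
    using E[of n] J(1)[of "n - 1"] d(1) additive_on_0[OF add[of UNIV]]
    unfolding Z by (auto simp: subgrp_def)
  have "\<exists>r. free_rank (Z n) (J n) r \<and> int r = (\<Sum>k\<le>n. (-1) ^ (n - k) * int (c k))" if "n \<le> N" for n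
    using that
  proof (induction n)
    case 0
    have "Z 0 = E 0" by (auto simp: Z)
    then show ?case using c[of 0] by auto
  next
    case (Suc n)
    then obtain r where r: "free_rank (Z n) (J n) r" "int r = (\<Sum>k\<le>n. (-1) ^ (n - k) * int (c k))" by auto
    obtain m where m: "free_rank (Z (Suc n)) (J (Suc n)) m"
      using free_rank_subgroup[OF c[OF Suc.prems] Zsub[of "Suc n"]] Z by auto
    have "free_rank (E (Suc n)) (Z (Suc n)) r"
    proof (rule free_rank_transfer[OF r(1) add, OF _ _ _ Zsub])
      fix x assume x: "x \<in> E (Suc n)"
      show "d x \<in> Z n" using x d(2,4) by (cases n) (auto simp: Z)
      show "(d x \<in> J n) = (x \<in> Z (Suc n))" using x by (auto simp: Z)
    next
      fix y assume "y \<in> Z n"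
      then show "\<exists>x\<in>E (Suc n). y - d x \<in> J n" using ex[of n y] Suc.prems by (auto simp: Z)
    qed
    then have "free_rank (E (Suc n)) (J (Suc n)) (m + r)"
      by (intro free_rank_extension[OF E Zsub _ _ m]) (use d(3) in \<open>auto simp: Z\<close>)
    then have "c (Suc n) = m + r" using free_rank_unique[OF E] c[OF Suc.prems] by blast
    moreover have "(\<Sum>k\<le>n. (-1) ^ (Suc n - k) * int (c k)) = - (\<Sum>k\<le>n. (-1) ^ (n - k) * int (c k))"
      unfolding sum_negf[symmetric] by (intro sum.cong) (auto simp: Suc_diff_le)
    ultimately have "int m = (\<Sum>k\<le>Suc n. (-1) ^ (Suc n - k) * int (c k))" using r(2) by simp
    then show ?case using m by blast
  qed
  then show ?thesis by blast
qed


section \<open>Order complexes\<close>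

declare minus_frag_cmul [simp del] minus_frag_cmul [symmetric, simp] frag_cmul_minus2 [simp]

text \<open>Concatenation turns the free abelian group on lists into the free associative ring on
  the letters. Joins of chains become products, and homotopies on joins can be computed with a
  Leibniz rule.\<close>

definition conc :: "('a list \<Rightarrow>\<^sub>0 int) \<Rightarrow> ('a list \<Rightarrow>\<^sub>0 int) \<Rightarrow> 'a list \<Rightarrow>\<^sub>0 int" (infixr "\<star>" 70) where
  "c \<star> d = frag_extend (\<lambda>u. frag_extend (\<lambda>v. frag_of (u @ v)) d) c"

lemma conc_simps [simp]:
  "(c + c') \<star> d = c \<star> d + c' \<star> d" "(c - c') \<star> d = c \<star> d - c' \<star> d" "(- c) \<star> d = - (c \<star> d)"
  "c \<star> (d + d') = c \<star> d + c \<star> d'" "c \<star> (d - d') = c \<star> d - c \<star> d'" "c \<star> (- d) = - (c \<star> d)"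
  "0 \<star> d = 0" "c \<star> 0 = 0"
  "frag_of u \<star> frag_of v = frag_of (u @ v)"
  "frag_cmul k c \<star> d = frag_cmul k (c \<star> d)" "c \<star> frag_cmul k d = frag_cmul k (c \<star> d)"
proof -
  have add: "c \<star> (d + d') = c \<star> d + c \<star> d'" for d d' by (simp add: conc_def frag_extend_add frag_extend_addfun)
  show "c \<star> (d + d') = c \<star> d + c \<star> d'" by (rule add)
  show "c \<star> (- d) = - (c \<star> d)"
    using add[of d "- d"] by (simp add: conc_def frag_extend_def eq_neg_iff_add_eq_0 add.commute)
  show "c \<star> (d - d') = c \<star> d - c \<star> d'"
    using add[of "d - d'" d'] by simp
qed (simp_all add: conc_def frag_extend_add frag_extend_diff frag_extend_minus frag_extend_cmul frag_extend_cmulfun)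

lemma frag_all_induct [case_names zero one diff]:
  assumes "P 0" "\<And>b. P (frag_of b)" "\<And>x y. P x \<Longrightarrow> P y \<Longrightarrow> P (x - y)"
  shows "P (x :: 'b \<Rightarrow>\<^sub>0 int)"
  using assms by (intro frag_induction[of x UNIV P]) auto

lemma conc_assoc: "(a \<star> b) \<star> c = a \<star> b \<star> c"
proof (induction a rule: frag_all_induct)
  case (one u)
  show ?case
  proof (induction b rule: frag_all_induct)
    case (one v) show ?case by (induction c rule: frag_all_induct) (auto simp del: append_assoc, simp)
  qed auto
qed auto

lemma conc_frags:
  assumes "c \<in> frags B" "d \<in> frags C" "\<And>u v. u \<in> B \<Longrightarrow> v \<in> C \<Longrightarrow> u @ v \<in> D"
  shows "c \<star> d \<in> frags D"
  unfolding conc_def by (intro frag_extend_frags[OF assms(1)] frag_extend_frags[OF assms(2)]) (simp add: assms)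

text \<open>The signed derivation of the concatenation ring that sends every letter to the unit,
  which is the empty list. One-element lists go to the empty list and not to 0, so the complex is
  augmented, as reduced homology requires.\<close>

primrec bd :: "'a list \<Rightarrow> 'a list \<Rightarrow>\<^sub>0 int" where
  "bd [] = 0"
| "bd (x # s) = frag_of s - frag_of [x] \<star> bd s"

abbreviation Bd :: "('a list \<Rightarrow>\<^sub>0 int) \<Rightarrow> 'a list \<Rightarrow>\<^sub>0 int" where
  "Bd \<equiv> frag_extend bd"

lemma conc_Nil [simp]: "frag_of [] \<star> c = c"
  by (induction c rule: frag_all_induct) auto

lemma bd_append: "bd (u @ v) = bd u \<star> frag_of v + frag_cmul ((-1) ^ length u) (frag_of u \<star> bd v)"
proof (induction u)
  case Nil
  show ?case by simp
next
  case (Cons x u)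
  have "frag_of (x # u) = frag_of [x] \<star> frag_of u" by simp
  then show ?case using Cons conc_assoc[of "frag_of [x]" "frag_of u" "bd v"]
    by (simp add: conc_assoc frag_cmul_minus2)
qed

text \<open>The sign records the length of the left factor, hence only this factor is
  homogeneous.\<close>

lemma Bd_conc:
  assumes "c \<in> frags {u. length u = m}"
  shows "Bd (c \<star> d) = Bd c \<star> d + frag_cmul ((-1) ^ m) (c \<star> Bd d)"
  using assms
proof (induction c rule: frags_induct)
  case (one u)
  then show ?case
    by (induction d rule: frag_all_induct) (auto simp: bd_append frag_extend_diff frag_cmul_diff2)
qed (auto simp: frag_extend_diff frag_cmul_diff2)

lemma Bd_bd [simp]: "Bd (bd s) = 0"
proof (induction s)
  case (Cons x s)
  have "Bd (frag_of [x] \<star> bd s) = bd s"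
    using Cons Bd_conc[of "frag_of [x]" 1 "bd s"] by simp
  then show ?case by (simp add: frag_extend_diff)
qed auto

lemma Bd_Bd [simp]: "Bd (Bd c) = 0"
  by (induction c rule: frag_all_induct) (auto simp: frag_extend_diff)

section \<open>Decreasing lists as chains of a poset\<close>

definition chains :: "'a::order set \<Rightarrow> nat \<Rightarrow> 'a list set" where
  "chains Q n = {s. sorted_wrt (>) s \<and> set s \<subseteq> Q \<and> length s = n}"

lemma chains_mono: "Q \<subseteq> R \<Longrightarrow> s \<in> chains Q n \<Longrightarrow> s \<in> chains R n"
  by (auto simp: chains_def)

lemma bd_chains_self: "sorted_wrt (>) s \<Longrightarrow> bd s \<in> frags (chains (set s) (length s - 1))"
proof (induction s)
  case (Cons x s)
  have "frag_of [x] \<star> bd s \<in> frags (chains (insert x (set s)) (length s))"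
  proof (cases s)
    case (Cons y t)
    then show ?thesis using Cons.IH Cons.prems
      by (intro conc_frags[of _ "{[x]}" _ "chains (set s) (length s - 1)"]) (auto simp: chains_def)
  qed (simp add: frags_0)
  then show ?case using Cons.prems by (auto simp: chains_def intro!: frags_diff)
qed (simp add: frags_0)

lemma frags_mono: "B \<subseteq> C \<Longrightarrow> c \<in> frags B \<Longrightarrow> c \<in> frags C"
  by (auto simp: frags_def)

lemma bd_chains: "s \<in> chains Q n \<Longrightarrow> bd s \<in> frags (chains Q (n - 1))"
  by (rule frags_mono[OF _ bd_chains_self]) (auto simp: chains_def)

lemma Bd_chains: "c \<in> frags (chains Q n) \<Longrightarrow> Bd c \<in> frags (chains Q (n - 1))"
  by (rule frag_extend_frags[OF _ bd_chains])

text \<open>A chain with \<open>n\<close> elements is a decreasing list of length \<open>n\<close> and has degree \<open>n - 1\<close>, so that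
  \<open>acyclic_below Q k\<close> makes the reduced homology of the order complex of \<open>Q\<close> vanish below degree \<open>k - 1\<close>. Keeping a
  contracting homotopy rather than the vanishing itself makes joins and coefficients unproblematic.\<close>

definition contracts :: "('a::order) set \<Rightarrow> (nat \<Rightarrow> 'a list set) \<Rightarrow> nat \<Rightarrow> ('a list \<Rightarrow> 'a list \<Rightarrow>\<^sub>0 int) \<Rightarrow> bool" where
  "contracts Q S k h \<longleftrightarrow>
     (\<forall>n. \<forall>s\<in>chains Q n. h s \<in> frags (chains Q (Suc n))) \<and>
     (\<forall>n<k. \<forall>s\<in>S n. Bd (h s) + frag_extend h (bd s) = frag_of s)"

definition acyclic_below :: "('a::order) set \<Rightarrow> nat \<Rightarrow> bool" where
  "acyclic_below Q k \<longleftrightarrow> (\<exists>h. contracts Q (chains Q) k h)"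

text \<open>Contraction in two stages. Any degree-raising H makes \<open>\<pi>\<close>, the identity
  minus Bd H + H Bd, a chain map. If \<open>\<pi>\<close> carries the chains in S into the smaller
  family S', on which K already contracts, then H + K \<pi> contracts on S. The second conclusion
  keeps track of chains that H has finished: there the new contraction is H itself.\<close>

lemma contracts_perturb:
  assumes K: "contracts Q S' k K" and S: "\<And>n. S n \<subseteq> chains Q n"
    and H: "\<And>n s. s \<in> chains Q n \<Longrightarrow> H s \<in> frags (chains Q (Suc n))"
    and pi: "\<And>n s. n < k \<Longrightarrow> s \<in> S n \<Longrightarrow> frag_of s - Bd (H s) - frag_extend H (bd s) \<in> frags (S' n)"
  obtains G where "contracts Q S k G"
    "\<And>s. frag_of s - Bd (H s) - frag_extend H (bd s) = 0 \<Longrightarrow> G s = H s"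
proof -
  define \<pi> where "\<pi> s = frag_of s - Bd (H s) - frag_extend H (bd s)" for s
  define G where "G s = H s + frag_extend K (\<pi> s)" for s
  have pif: "frag_extend \<pi> c = c - Bd (frag_extend H c) - frag_extend H (Bd c)" for c
    by (induction c rule: frag_all_induct) (auto simp: frag_extend_diff \<pi>_def)
  have Gf: "frag_extend G c = frag_extend H c + frag_extend K (frag_extend \<pi> c)" for c
    by (induction c rule: frag_all_induct) (auto simp: frag_extend_diff G_def)
  have comm: "frag_extend \<pi> (bd s) = Bd (\<pi> s)" for s
    by (simp add: pif) (simp add: \<pi>_def frag_extend_diff)
  have piC: "\<pi> s \<in> frags (chains Q n)" if s: "s \<in> chains Q n" for s n
  proof -
    have "frag_extend H (bd s) \<in> frags (chains Q n)"
    proof (cases n)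
      case 0 then show ?thesis using s by (simp add: chains_def frags_0)
    next
      case (Suc m)
      then show ?thesis using frag_extend_frags[OF bd_chains[OF s]] H[of _ m] by auto
    qed
    moreover have "Bd (H s) \<in> frags (chains Q n)" using Bd_chains[OF H[OF s]] by simp
    ultimately show ?thesis using s unfolding \<pi>_def by (intro frags_diff) auto
  qed
  have Kf: "Bd (frag_extend K c) + frag_extend K (Bd c) = c" if "n < k" "c \<in> frags (S' n)" for n c
    using that(2)
  proof (induction c rule: frags_induct)
    case (diff x y)
    have "Bd (frag_extend K (x - y)) + frag_extend K (Bd (x - y))
      = (Bd (frag_extend K x) + frag_extend K (Bd x)) - (Bd (frag_extend K y) + frag_extend K (Bd y))"
      by (simp add: frag_extend_diff)
    then show ?case using diff by simp
  qed (use K that in \<open>auto simp: contracts_def\<close>)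
  have 1: "G s \<in> frags (chains Q (Suc n))" if s: "s \<in> chains Q n" for s n
    unfolding G_def
    by (intro frags_add H s frag_extend_frags[OF piC[OF s]]) (use K in \<open>auto simp: contracts_def\<close>)
  have 2: "Bd (G s) + frag_extend G (bd s) = frag_of s" if s: "s \<in> S n" "n < k" for s n
  proof -
    have "Bd (G s) + frag_extend G (bd s) = Bd (H s) + frag_extend H (bd s) +
       (Bd (frag_extend K (\<pi> s)) + frag_extend K (Bd (\<pi> s)))"
      by (simp add: G_def Gf comm frag_extend_add)
    also have "\<dots> = Bd (H s) + frag_extend H (bd s) + \<pi> s"
      using Kf[OF s(2), of "\<pi> s"] pi[OF s(2,1)] by (simp add: \<pi>_def)
    finally show ?thesis by (simp add: \<pi>_def)
  qed
  show ?thesis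
    by (rule that[of G]) (use 1 2 in \<open>auto simp: contracts_def G_def \<pi>_def\<close>)
qed

section \<open>Contractions of cones and of posets with points added\<close>

lemma acyclic_below_0: "acyclic_below Q 0"
  unfolding acyclic_below_def contracts_def by (rule exI[of _ "\<lambda>_. 0"]) (simp add: frags_0)

text \<open>The faces of a chain of Y stay in Y, so the value 0 on all other chains does not disturb
  the identity on chains of Y.\<close>

lemma contracts_extend_zero:
  assumes h: "contracts Y (chains Y) k h" and Q: "Y \<subseteq> Q"
  shows "contracts Q (chains Y) k (\<lambda>s. if set s \<subseteq> Y then h s else 0)"
  unfolding contracts_def
proof (intro conjI allI ballI impI)
  fix n s assume "s \<in> chains Q n"
  then show "(if set s \<subseteq> Y then h s else 0) \<in> frags (chains Q (Suc n))"
    using h frags_mono[of "chains Y (Suc n)" "chains Q (Suc n)"] chains_mono[OF Q]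
    by (auto simp: frags_0 contracts_def chains_def)
next
  fix n s assume n: "n < k" and s: "s \<in> chains Y n"
  have "frag_extend (\<lambda>s. if set s \<subseteq> Y then h s else 0) (bd s) = frag_extend h (bd s)"
    using bd_chains[OF s] by (intro frag_extend_eq) (auto simp: frags_def chains_def)
  then show "Bd (if set s \<subseteq> Y then h s else 0) + frag_extend (\<lambda>s. if set s \<subseteq> Y then h s else 0) (bd s) = frag_of s"
    using h n s by (auto simp: contracts_def chains_def)
qed

lemma chains_insert_cases:
  assumes "s \<in> chains (insert x Y) n" "x \<notin> Y"
  obtains "s \<in> chains Y n" | u v where "s = u @ x # v" "u \<in> chains {y \<in> Y. x < y} (length u)"
    "v \<in> chains {y \<in> Y. y < x} (length v)" "n = Suc (length u + length v)"
proof (cases "x \<in> set s")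
  case True
  then obtain u v where s: "s = u @ x # v" by (meson split_list)
  then show ?thesis using assms that(2)[of u v] by (auto simp: chains_def sorted_wrt_append)
next
  case False
  then show ?thesis using assms that(1) by (auto simp: chains_def)
qed

lemma chains_join:
  "u \<in> chains {y \<in> Y. x < y} m \<Longrightarrow> v \<in> chains {y \<in> Y. y < x} n \<Longrightarrow> u @ x # v \<in> chains (insert x Y) (Suc (m + n))"
  "u \<in> chains {y \<in> Y. x < y} m \<Longrightarrow> v \<in> chains {y \<in> Y. y < x} n \<Longrightarrow> u @ v \<in> chains Y (m + n)"
  unfolding chains_def sorted_wrt_append subset_iff
  by (auto simp: sorted_wrt_append intro: less_trans)

lemma frags_length: "c \<in> frags (chains Q n) \<Longrightarrow> c \<in> frags {u. length u = n}"
  by (auto simp: frags_def chains_def)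

text \<open>A map on chains through x, given in terms of the part u above x and the part v below x;
  filtering recovers both, since x lies in the chain. The value 0 elsewhere silences the face in
  which x is deleted.\<close>

definition split_at :: "'a::order \<Rightarrow> ('a list \<Rightarrow> 'a list \<Rightarrow> 'a list \<Rightarrow>\<^sub>0 int) \<Rightarrow> 'a list \<Rightarrow> 'a list \<Rightarrow>\<^sub>0 int" where
  "split_at x f s = (if x \<in> set s then f (filter ((<) x) s) (filter (\<lambda>y. y < x) s) else 0)"

lemma split_at_simps:
  assumes "u \<in> chains {y \<in> Y. x < y} m" "v \<in> chains {y \<in> Y. y < x} n"
  shows "split_at x f (u @ x # v) = f u v"
proof -
  have "filter ((<) x) u = u" "filter ((<) x) v = []" "filter (\<lambda>y. y < x) v = v" "filter (\<lambda>y. y < x) u = []"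
    using assms by (auto simp: chains_def filter_id_conv filter_empty_conv)
  then show ?thesis by (simp add: split_at_def)
qed

text \<open>The face without x is killed. The faces of v carry the sign of u and one more minus for
  passing x.\<close>

lemma split_at_extend:
  assumes x: "x \<notin> Y" and u: "u \<in> chains {y \<in> Y. x < y} m" and v: "v \<in> chains {y \<in> Y. y < x} n"
  shows "frag_extend (split_at x f) (bd (u @ x # v)) =
    frag_extend (\<lambda>u. f u v) (bd u) - frag_cmul ((-1) ^ m) (frag_extend (f u) (bd v))"
proof -
  have 1: "frag_extend (split_at x f) (c \<star> frag_of (x # v)) = frag_extend (\<lambda>u. f u v) c"
    if "c \<in> frags (chains {y \<in> Y. x < y} k)" for c k
    using that
  proof (induction c rule: frags_induct)
    case (one b) then show ?case using split_at_simps[OF one v, of f] by simp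
  qed (auto simp: frag_extend_diff)
  have 2: "frag_extend (split_at x f) (frag_of u \<star> frag_of [x] \<star> c) = frag_extend (f u) c"
    if "c \<in> frags (chains {y \<in> Y. y < x} k)" for c k
    using that
  proof (induction c rule: frags_induct)
    case (one b) then show ?case using split_at_simps[OF u one, of f] by simp
  qed (auto simp: frag_extend_diff)
  have 3: "split_at x f (u @ v) = 0" using assms by (auto simp: split_at_def chains_def)
  have "m = length u" using u by (auto simp: chains_def)
  then have "bd (u @ x # v) = bd u \<star> frag_of (x # v) +
      frag_cmul ((-1) ^ m) (frag_of (u @ v) - frag_of u \<star> frag_of [x] \<star> bd v)"
    by (simp add: bd_append)
  then show ?thesis
    by (simp only: frag_extend_add frag_extend_diff frag_extend_cmul frag_extend_of
         1[OF bd_chains[OF u]] 2[OF bd_chains[OF v]] 3) (simp add: frag_cmul_diff2)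
qed

lemma split_at_notin:
  assumes "s \<in> chains Y n" "x \<notin> Y"
  shows "split_at x f s = 0" "frag_extend (split_at x f) (bd s) = 0"
proof -
  show "split_at x f s = 0" using assms by (auto simp: split_at_def chains_def)
  have "frag_extend (split_at x f) (bd s) = frag_extend (\<lambda>_. 0) (bd s)"
    using bd_chains[OF assms(1)] assms(2) by (intro frag_extend_eq) (auto simp: frags_def chains_def split_at_def)
  then show "frag_extend (split_at x f) (bd s) = 0" by (simp add: frag_extend_def)
qed

text \<open>The complex of \<open>insert x Y\<close> is contracted in three steps: first along the part of the
  link of \<open>x\<close> below \<open>x\<close>, then along the part above \<open>x\<close>, and finally inside \<open>Y\<close>.\<close>

lemma acyclic_below_insert:
  fixes x :: "'a::order"
  assumes x: "x \<notin> Y" and Y: "acyclic_below Y k" and lo: "acyclic_below {y \<in> Y. y < x} i" and up: "acyclic_below {y \<in> Y. x < y} j"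
    and k: "k \<le> i + j + 1"
  shows "acyclic_below (insert x Y) k"
proof -
  let ?A = "{y \<in> Y. y < x}" and ?B = "{y \<in> Y. x < y}" and ?Q = "insert x Y"
  obtain h where h: "contracts ?A (chains ?A) i h" using lo by (auto simp: acyclic_below_def)
  obtain g where g: "contracts ?B (chains ?B) j g" using up by (auto simp: acyclic_below_def)
  obtain f where f: "contracts Y (chains Y) k f" using Y by (auto simp: acyclic_below_def)
  \<comment> \<open>The intermediate family: chains of Y, and those chains through x whose lower
    part has at least i elements and so lies beyond the range of \<open>h\<close>.\<close>
  define S where "S n = chains Y n \<union> {u @ x # v | u v. u \<in> chains ?B (length u) \<and> v \<in> chains ?A (length v) \<and>
      i \<le> length v \<and> n = Suc (length u + length v)}" for n
  have hf: "h v \<in> frags (chains ?A (Suc n))" if "v \<in> chains ?A n" for v n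
    using h that by (auto simp: contracts_def)
  have gf: "g v \<in> frags (chains ?B (Suc n))" if "v \<in> chains ?B n" for v n
    using g that by (auto simp: contracts_def)
  have mem: "c \<star> frag_of [x] \<star> d \<in> frags (chains ?Q (Suc (m + n)))" "c \<star> d \<in> frags (chains Y (m + n))"
    if "c \<in> frags (chains ?B m)" "d \<in> frags (chains ?A n)" for c d m n
  proof -
    have 1: "frag_of [x] \<star> d \<in> frags ((#) x ` chains ?A n)"
      by (rule conc_frags[of _ "{[x]}" _ "chains ?A n"]) (use that in auto)
    show "c \<star> frag_of [x] \<star> d \<in> frags (chains ?Q (Suc (m + n)))"
      by (rule conc_frags[OF that(1) 1]) (use chains_join(1) in auto)
    show "c \<star> d \<in> frags (chains Y (m + n))"
      by (rule conc_frags[OF that]) (rule chains_join(2)[of _ Y x])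
  qed
  have Ssub: "S n \<subseteq> chains ?Q n" for n
    using chains_join(1) chains_mono[of Y ?Q] by (fastforce simp: S_def)
  have g2: "contracts ?Q (chains Y) k (\<lambda>s. if set s \<subseteq> Y then f s else 0)"
    by (rule contracts_extend_zero[OF f]) auto
  define G where "G = split_at x (\<lambda>u v. g u \<star> frag_of (x # v))"
  obtain g1 where g1: "contracts ?Q S k g1"
  proof (rule contracts_perturb[OF g2 Ssub, of G])
    fix n s assume s: "s \<in> chains ?Q n"
    then show "G s \<in> frags (chains ?Q (Suc n))"
    proof (cases rule: chains_insert_cases[OF s x])
      case 1
      then have "s \<in> chains Y n" by simp
      from split_at_notin[OF this x] show ?thesis by (simp add: G_def frags_0)
    next
      case (2 u v)
      have "G s = g u \<star> frag_of [x] \<star> frag_of v" using 2 by (simp add: G_def split_at_simps[OF 2(2,3)])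
      then show ?thesis using mem(1)[OF gf[OF 2(2)], of "frag_of v"] 2 by simp
    qed
  next
    fix n s assume n: "n < k" and s: "s \<in> S n"
    show "frag_of s - Bd (G s) - frag_extend G (bd s) \<in> frags (chains Y n)"
    proof (cases "s \<in> chains Y n")
      case True
      then show ?thesis by (simp add: G_def split_at_notin[OF True x])
    next
      case False
      then obtain u v where uv: "s = u @ x # v" "u \<in> chains ?B (length u)" "v \<in> chains ?A (length v)"
        "i \<le> length v" "n = Suc (length u + length v)" using s by (auto simp: S_def)
      \<comment> \<open>Here the bound on k enters: 1 + |u| + |v| < k \<le> i + j + 1 and i \<le>
        |v| leave |u| < j, so that \<open>g\<close> contracts u.\<close>
      have lt: "length u < j" using n k uv by simp
      have Gs: "G s = g u \<star> frag_of (x # v)" using uv by (simp add: G_def split_at_simps[OF uv(2,3)])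
      have BG: "Bd (G s) = Bd (g u) \<star> frag_of (x # v) +
          frag_cmul ((-1) ^ Suc (length u)) (g u \<star> (frag_of v - frag_of [x] \<star> bd v))"
        unfolding Gs by (subst Bd_conc[OF frags_length[OF gf[OF uv(2)]]]) simp
      have HG: "frag_extend G (bd s) = frag_extend g (bd u) \<star> frag_of (x # v)
          - frag_cmul ((-1) ^ length u) (g u \<star> frag_of [x] \<star> bd v)"
      proof -
        have "frag_extend (\<lambda>u. g u \<star> frag_of (x # v)) c = frag_extend g c \<star> frag_of (x # v)" for c
          by (induction c rule: frag_all_induct) (auto simp: frag_extend_diff)
        moreover have "frag_extend (\<lambda>v. g u \<star> frag_of (x # v)) c = g u \<star> frag_of [x] \<star> c" for c
          by (induction c rule: frag_all_induct) (auto simp: frag_extend_diff)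
        ultimately show ?thesis unfolding G_def uv(1) split_at_extend[OF x uv(2,3)] by simp
      qed
      have "Bd (g u) + frag_extend g (bd u) = frag_of u"
        using g uv(2) lt by (auto simp: contracts_def)
      then have gs: "Bd (g u) \<star> frag_of (x # v) + frag_extend g (bd u) \<star> frag_of (x # v) = frag_of s"
        using uv(1) by (simp flip: conc_simps(1))
      \<comment> \<open>All terms through x cancel. What remains comes from deleting x in
        \<open>G s\<close> and lies in Y.\<close>
      have "frag_of s - Bd (G s) - frag_extend G (bd s) = frag_cmul ((-1) ^ length u) (g u \<star> frag_of v)"
        unfolding BG HG gs[symmetric] by (simp add: frag_cmul_diff2 algebra_simps)
      then show ?thesis using mem(2)[OF gf[OF uv(2)], of "frag_of v"] uv by (simp add: frags_cmul)
    qed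
  qed
  \<comment> \<open>The sign is the price for letting \<open>h\<close> act behind u and x.\<close>
  define H where "H = split_at x (\<lambda>u v. frag_cmul ((-1) ^ Suc (length u)) (frag_of u \<star> frag_of [x] \<star> h v))"
  show ?thesis
  proof (rule contracts_perturb[OF g1, of "chains ?Q" H])
    fix n s assume s: "s \<in> chains ?Q n"
    then show "H s \<in> frags (chains ?Q (Suc n))"
    proof (cases rule: chains_insert_cases[OF s x])
      case 1
      then have "s \<in> chains Y n" by simp
      from split_at_notin[OF this x] show ?thesis by (simp add: H_def frags_0)
    next
      case (2 u v)
      then show ?thesis using mem(1)[of "frag_of u", OF _ hf[OF 2(3)]]
        by (simp add: H_def split_at_simps[OF 2(2,3)] frags_uminus frags_cmul)
    qed
  next
    fix n s assume n: "n < k" and s: "s \<in> chains ?Q n"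
    show "frag_of s - Bd (H s) - frag_extend H (bd s) \<in> frags (S n)"
    proof (cases rule: chains_insert_cases[OF s x])
      case 1
      then have "s \<in> chains Y n" by simp
      from split_at_notin[OF this x] this show ?thesis by (simp add: H_def S_def)
    next
      case (2 u v)
      define e :: "('a list \<Rightarrow>\<^sub>0 int) \<Rightarrow> 'a list \<Rightarrow>\<^sub>0 int" where "e = frag_cmul ((-1) ^ length u)"
      have e: "e (a - b) = e a - e b" "e (a + b) = e a + e b" "e (- a) = - e a" "e (e a) = a" for a b
        by (simp_all add: e_def frag_cmul_diff2 frag_cmul_distrib2 flip: power_mult_distrib)
      have lu: "frag_of u \<in> frags {w. length w = length u}" by simp
      have Hs: "H s = - e (frag_of u \<star> frag_of [x] \<star> h v)"
        using 2 by (simp add: H_def split_at_simps[OF 2(2,3)] e_def)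
      have bdx: "Bd (frag_of [x] \<star> c) = c - frag_of [x] \<star> Bd c" for c
        by (induction c rule: frag_all_induct) (auto simp: frag_extend_diff)
      have "Bd (H s) = - e (bd u \<star> frag_of [x] \<star> h v) - frag_of u \<star> (h v - frag_of [x] \<star> Bd (h v))"
        unfolding Hs e_def frag_extend_minus frag_extend_cmul Bd_conc[OF lu] bdx
        unfolding e_def[symmetric] by (simp add: e)
      moreover have "frag_extend H (bd s) = e (bd u \<star> frag_of [x] \<star> h v) + frag_of u \<star> frag_of [x] \<star> frag_extend h (bd v)"
      proof -
        have 1: "frag_extend (\<lambda>u. frag_cmul ((-1) ^ Suc (length u)) (frag_of u \<star> frag_of [x] \<star> h v)) c
            = e (c \<star> frag_of [x] \<star> h v)" if "c \<in> frags (chains ?B (length u - 1))" "u \<noteq> []" for c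
          using that(1)
        proof (induction c rule: frags_induct)
          case (one b)
          then have "Suc (length b) = length u" using that(2) by (cases u) (auto simp: chains_def)
          then show ?case by (simp only: frag_extend_of e_def)
        qed (auto simp: frag_extend_diff e, simp add: e_def)
        have 2: "frag_extend (\<lambda>v. frag_cmul ((-1) ^ Suc (length u)) (frag_of u \<star> frag_of [x] \<star> h v)) c
            = - e (frag_of u \<star> frag_of [x] \<star> frag_extend h c)" for c
          by (induction c rule: frag_all_induct) (auto simp: frag_extend_diff e, simp_all add: e_def)
        have 3: "frag_extend (\<lambda>u. frag_cmul ((-1) ^ Suc (length u)) (frag_of u \<star> frag_of [x] \<star> h v)) (bd u)
            = e (bd u \<star> frag_of [x] \<star> h v)"
          using 1[OF bd_chains[OF \<open>u \<in> _\<close>]] by (cases "u = []") (auto simp: e_def)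
        show ?thesis
          unfolding H_def \<open>s = _\<close> split_at_extend[OF x \<open>u \<in> _\<close> \<open>v \<in> _\<close>] 3 2
          unfolding e_def[symmetric] by (simp add: e)
      qed
      ultimately have pi: "frag_of s - Bd (H s) - frag_extend H (bd s) = frag_of s + frag_of u \<star> h v
          - frag_of u \<star> frag_of [x] \<star> (Bd (h v) + frag_extend h (bd v))"
        by (simp add: algebra_simps)
      have uh: "frag_of u \<star> h v \<in> frags (S n)"
        using mem(2)[of "frag_of u", OF _ hf[OF 2(3)]] 2
        by (auto intro: frags_mono[of "chains Y n"] simp: S_def)
      show ?thesis
      \<comment> \<open>For a short lower part \<open>h\<close> contracts v, and only the term
        without x is left. Otherwise the terms through x keep a lower part as long as v, hence of
        length at least i as \<open>S\<close> demands.\<close>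
      proof (cases "length v < i")
        case True
        then have "Bd (h v) + frag_extend h (bd v) = frag_of v" using h 2 by (auto simp: contracts_def)
        then have "frag_of s - Bd (H s) - frag_extend H (bd s) = frag_of u \<star> h v"
          unfolding pi using 2(1) by simp
        then show ?thesis using uh by simp
      next
        case False
        have "Bd (h v) \<in> frags (chains ?A (length v))" using Bd_chains[OF hf[OF 2(3)]] by simp
        moreover have "frag_extend h (bd v) \<in> frags (chains ?A (length v))"
        proof (cases v)
          case (Cons a w)
          show ?thesis by (rule frag_extend_frags[OF bd_chains[OF 2(3)]]) (use hf[of _ "length v - 1"] Cons in auto)
        qed (simp add: frags_0)
        ultimately have hv: "Bd (h v) + frag_extend h (bd v) \<in> frags (chains ?A (length v))"
          by (rule frags_add)
        have 1: "frag_of [x] \<star> (Bd (h v) + frag_extend h (bd v)) \<in> frags ((#) x ` chains ?A (length v))"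
          by (rule conc_frags[of _ "{[x]}" _ "chains ?A (length v)"]) (use hv in auto)
        have "frag_of u \<star> frag_of [x] \<star> (Bd (h v) + frag_extend h (bd v)) \<in> frags (S n)"
        proof (rule conc_frags[OF _ 1, of _ "{u}"])
          fix a b assume "a \<in> {u}" "b \<in> (#) x ` chains ?A (length v)"
          then obtain w where w: "a = u" "b = x # w" "w \<in> chains ?A (length v)" by auto
          have "length w = length v" using w(3) by (simp add: chains_def)
          then have "u @ x # w = u @ x # w \<and> u \<in> chains ?B (length u) \<and> w \<in> chains ?A (length w) \<and>
              i \<le> length w \<and> n = Suc (length u + length w)"
            using w(3) 2(2,4) False by auto
          then show "a @ b \<in> S n" unfolding S_def w(1,2) by blast
        qed auto
        moreover have "s = u @ x # v \<and> u \<in> chains ?B (length u) \<and> v \<in> chains ?A (length v) \<and>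
              i \<le> length v \<and> n = Suc (length u + length v)"
          using 2 False by auto
        then have "frag_of s \<in> frags (S n)" unfolding S_def frag_of_frags by blast
        ultimately show ?thesis using uh unfolding pi by (intro frags_diff frags_add)
      qed
    qed
  qed (auto simp: acyclic_below_def)
qed

text \<open>The contraction appends the least element b, and vanishes on chains containing b. The
  sign appears because the new letter stands at the end of the list.\<close>

lemma acyclic_below_cone:
  fixes b :: "'a::order"
  assumes b: "b \<in> Y" "\<And>y. y \<in> Y \<Longrightarrow> b \<le> y"
  shows "acyclic_below Y k"
proof -
  define h where "h s = (if b \<in> set s then 0 else frag_cmul ((-1) ^ length s) (frag_of s \<star> frag_of [b]))" for s :: "'a list"
  have h0: "frag_extend h (c \<star> frag_of [b]) = 0" for c
    by (induction c rule: frag_all_induct) (auto simp: frag_extend_diff h_def)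
  have "contracts Y (chains Y) k h"
    unfolding contracts_def
  proof (intro conjI allI ballI impI)
    fix n s assume s: "s \<in> chains Y n"
    then show "h s \<in> frags (chains Y (Suc n))"
      using b by (auto simp: h_def frags_0 chains_def sorted_wrt_append order_less_le
          intro!: frags_cmul) fastforce+
  next
    fix n s assume s: "s \<in> chains Y n"
    show "Bd (h s) + frag_extend h (bd s) = frag_of s"
    proof (cases "b \<in> set s")
      case True
      then obtain u v where uv: "s = u @ b # v" by (meson split_list)
      have "v = []"
      proof (cases v)
        case (Cons a w)
        then have "a < b" "b \<le> a" using s uv b(2) by (auto simp: chains_def sorted_wrt_append)
        then show ?thesis by simp
      qed simp
      have nb: "b \<notin> set u" using s uv by (auto simp: chains_def sorted_wrt_append)
      have "frag_extend h (bd s) = frag_of s"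
        using nb by (simp add: uv \<open>v = []\<close> bd_append frag_extend_add h0 frag_extend_cmul)
          (simp add: h_def flip: power_mult_distrib)
      then show ?thesis using True by (simp add: h_def)
    next
      case False
      have len: "length s = n" using s by (simp add: chains_def)
      have *: "frag_extend h c = - frag_cmul ((-1) ^ n) (c \<star> frag_of [b])"
        if "c \<in> frags (chains (set s) (n - 1))" "n > 0" for c
        using that(1)
      proof (induction c rule: frags_induct)
        case (one t)
        then have "length t = n - 1" "b \<notin> set t" using False by (auto simp: chains_def)
        moreover have "(-1) ^ n = - ((-1::int) ^ (n - 1))" using that(2) by (cases n) auto
        ultimately show ?case by (simp add: h_def)
      qed (auto simp: frag_extend_diff frag_cmul_diff2)
      have "frag_extend h (bd s) = - frag_cmul ((-1) ^ n) (bd s \<star> frag_of [b])"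
        using *[of "bd s"] bd_chains_self[of s] s by (cases s) (auto simp: chains_def)
      moreover have "h s = frag_cmul ((-1) ^ n) (frag_of (s @ [b]))" using False len by (simp add: h_def)
      ultimately show ?thesis
        by (simp add: frag_extend_cmul bd_append len frag_cmul_distrib2 flip: power_mult_distrib)
    qed
  qed
  then show ?thesis by (auto simp: acyclic_below_def)
qed

text \<open>The induction removes a minimal element, so that in building up the union larger
  elements come first. When x arrives, no element of S below it is present and all those above it
  are; hence the lower link is taken in Y and the upper link in \<open>Y \<union> S\<close>.\<close>

lemma acyclic_below_Un_decreasing:
  fixes Y :: "'a::order set"
  assumes "finite S" "acyclic_below Y k" "Y \<inter> S = {}"
    "\<And>x. x \<in> S \<Longrightarrow> \<exists>i j. acyclic_below {y \<in> Y. y < x} i \<and> acyclic_below {y \<in> Y \<union> S. x < y} j \<and> k \<le> i + j + 1"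
  shows "acyclic_below (Y \<union> S) k"
  using assms
proof (induction "card S" arbitrary: S)
  case 0 then show ?case by simp
next
  case (Suc n)
  then obtain x where x: "x \<in> S" "\<And>y. y \<in> S \<Longrightarrow> \<not> y < x"
    using finite_has_minimal[of S] by (metis card.empty nat.distinct(1) order_less_le)
  have "acyclic_below (Y \<union> (S - {x})) k"
  proof (rule Suc.hyps)
    fix z assume z: "z \<in> S - {x}"
    have "{y \<in> Y \<union> (S - {x}). z < y} = {y \<in> Y \<union> S. z < y}" using x z by auto
    then show "\<exists>i j. acyclic_below {y \<in> Y. y < z} i \<and> acyclic_below {y \<in> Y \<union> (S - {x}). z < y} j \<and> k \<le> i + j + 1"
      using Suc.prems(4)[of z] z by auto
  qed (use Suc x in auto)
  moreover obtain i j where ij: "acyclic_below {y \<in> Y. y < x} i" "acyclic_below {y \<in> Y \<union> S. x < y} j" "k \<le> i + j + 1"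
    using Suc.prems(4)[OF x(1)] by blast
  moreover have "{y \<in> Y \<union> (S - {x}). y < x} = {y \<in> Y. y < x}" "{y \<in> Y \<union> (S - {x}). x < y} = {y \<in> Y \<union> S. x < y}"
    using x by auto
  ultimately have "acyclic_below (insert x (Y \<union> (S - {x}))) k"
    using Suc.prems(3) x(1) by (intro acyclic_below_insert) auto
  moreover have "insert x (Y \<union> (S - {x})) = Y \<union> S" using x(1) by auto
  ultimately show ?case by simp
qed

text \<open>Now a maximal element is removed, so that its upper link lies in Y. A join is as acyclic
  as one of its factors: the lower link enters with i = 0.\<close>

lemma acyclic_below_Un_increasing:
  fixes Y :: "'a::order set"
  assumes "finite S" "acyclic_below Y k" "Y \<inter> S = {}"
    "\<And>x. x \<in> S \<Longrightarrow> acyclic_below {y \<in> Y. x < y} k"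
  shows "acyclic_below (Y \<union> S) k"
  using assms
proof (induction "card S" arbitrary: S)
  case 0 then show ?case by simp
next
  case (Suc n)
  then obtain x where x: "x \<in> S" "\<And>y. y \<in> S \<Longrightarrow> \<not> x < y"
    using finite_has_maximal[of S] by (metis card.empty nat.distinct(1) order_less_le)
  have "acyclic_below (Y \<union> (S - {x})) k"
    by (rule Suc.hyps) (use Suc x in auto)
  moreover have "{y \<in> Y \<union> (S - {x}). x < y} = {y \<in> Y. x < y}"
    using x by auto
  ultimately have "acyclic_below (insert x (Y \<union> (S - {x}))) k"
    using Suc.prems(3,4) x(1) by (intro acyclic_below_insert[where i = 0 and j = k]) (auto simp: acyclic_below_0)
  moreover have "insert x (Y \<union> (S - {x})) = Y \<union> S" using x(1) by auto
  ultimately show ?case by simp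
qed

text \<open>Relative chains of a pair (P, Q) are represented by combinations of chains not contained
  in Q, and this projection replaces the passage to the quotient. The empty chain lies in every Q
  and is killed, so relative chains carry no augmentation.\<close>

definition rel_proj :: "'a::order set \<Rightarrow> ('a list \<Rightarrow>\<^sub>0 int) \<Rightarrow> 'a list \<Rightarrow>\<^sub>0 int" where
  "rel_proj Q = frag_extend (\<lambda>s. if set s \<subseteq> Q then 0 else frag_of s)"

text \<open>The cone with apex t contracts P in every degree but does not respect Q. Perturbed along
  the contraction of Q, it maps chains of Q with fewer than k elements into Q, and therefore
  descends to relative chains.\<close>

lemma relative_acycliclic:
  fixes t :: "'a::order"
  assumes t: "t \<in> P" "\<And>x. x \<in> P \<Longrightarrow> x \<le> t" and Q: "Q \<subseteq> P" and k: "acyclic_below Q k"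
  shows "\<exists>K. \<forall>n. \<forall>s\<in>chains P n. K s \<in> frags {u \<in> chains P (Suc n). \<not> set u \<subseteq> Q} \<and>
    (n \<le> k \<longrightarrow> \<not> set s \<subseteq> Q \<longrightarrow>
       rel_proj Q (Bd (K s)) + frag_extend K (rel_proj Q (bd s)) = frag_of s)"
proof -
  obtain f where f: "contracts Q (chains Q) k f" using k by (auto simp: acyclic_below_def)
  define c where "c s = (if t \<in> set s then 0 else frag_of (t # s))" for s :: "'a list"
  have c0: "frag_extend c (frag_of [t] \<star> d) = 0" for d
    by (induction d rule: frag_all_induct) (auto simp: frag_extend_diff c_def)
  have c: "contracts P (chains P) (Suc k) c"
    unfolding contracts_def
  proof (intro conjI allI ballI impI)
    fix n s assume s: "s \<in> chains P n"
    then show "c s \<in> frags (chains P (Suc n))"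
      using t by (auto simp: c_def frags_0 chains_def order_less_le)
  next
    fix n s assume s: "s \<in> chains P n"
    show "Bd (c s) + frag_extend c (bd s) = frag_of s"
    proof (cases "t \<in> set s")
      case True
      then obtain u v where uv: "s = u @ t # v" by (meson split_list)
      have "u = []"
      proof (cases u)
        case (Cons a w)
        then have "t < a" "a \<le> t" using s uv t(2) by (auto simp: chains_def sorted_wrt_append)
        then show ?thesis by simp
      qed simp
      then show ?thesis using s uv by (auto simp: chains_def c_def frag_extend_diff c0)
    next
      case False
      have "frag_extend c d = frag_of [t] \<star> d" if "d \<in> frags (chains (set s) m)" for d m
        using that by (induction d rule: frags_induct) (use False in \<open>auto simp: frag_extend_diff c_def chains_def\<close>)
      then have "frag_extend c (bd s) = frag_of [t] \<star> bd s"
        using bd_chains_self[of s] s by (auto simp: chains_def)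
      then show ?thesis using False by (simp add: c_def)
    qed
  qed
  define H where "H s = (if set s \<subseteq> Q then f s else 0)" for s
  have H: "contracts P (chains Q) k H" unfolding H_def by (rule contracts_extend_zero[OF f Q])
  have HP: "H s \<in> frags (chains P (Suc n))" if "s \<in> chains P n" for s n
    using H that by (auto simp: contracts_def)
  have piP: "frag_of s - Bd (H s) - frag_extend H (bd s) \<in> frags (chains P n)" if s: "s \<in> chains P n" for s n
  proof -
    have "frag_extend H (bd s) \<in> frags (chains P n)"
    proof (cases n)
      case 0 then show ?thesis using s by (simp add: chains_def frags_0)
    next
      case (Suc m)
      then show ?thesis using frag_extend_frags[OF bd_chains[OF s]] HP[of _ m] by auto
    qed
    then show ?thesis using s Bd_chains[OF HP[OF s]] by (intro frags_diff) auto
  qed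
  obtain G where G: "contracts P (chains P) (Suc k) G"
    "\<And>s. frag_of s - Bd (H s) - frag_extend H (bd s) = 0 \<Longrightarrow> G s = H s"
    using contracts_perturb[OF c, of "chains P" H] HP piP by blast
  have GQ: "G s \<in> frags (chains Q (Suc n))" if s: "s \<in> chains Q n" "n < k" for s n
  proof -
    have "Bd (H s) + frag_extend H (bd s) = frag_of s" using H s by (auto simp: contracts_def)
    then have "G s = H s" by (intro G(2)) (simp add: diff_diff_eq)
    then show ?thesis using f s by (auto simp: H_def contracts_def chains_def)
  qed
  define K where "K s = rel_proj Q (G s)" for s
  have pr_Q: "rel_proj Q d = 0" if "d \<in> frags (chains Q m)" for d m
    using that by (induction d rule: frags_induct) (auto simp: rel_proj_def frag_extend_diff chains_def)
  have sub_Q: "d - rel_proj Q d \<in> frags (chains Q m)" if "d \<in> frags (chains P m)" for d m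
    using that
  proof (induction d rule: frags_induct)
    case (diff x y)
    have "x - y - rel_proj Q (x - y) = (x - rel_proj Q x) - (y - rel_proj Q y)"
      by (simp add: rel_proj_def frag_extend_diff)
    then show ?case using diff by (simp only: frags_diff)
  qed (auto simp: rel_proj_def frags_0 chains_def)
  have pr_diff: "rel_proj Q (x - y) = rel_proj Q x - rel_proj Q y" for x y
    by (simp add: rel_proj_def frag_extend_diff)
  have Kf: "frag_extend K d = rel_proj Q (frag_extend G d)" for d
    by (induction d rule: frag_all_induct) (auto simp: K_def frag_extend_diff pr_diff, simp add: rel_proj_def)
  show ?thesis
  proof (intro exI allI ballI conjI impI)
    fix n s assume s: "s \<in> chains P n"
    then have Gs: "G s \<in> frags (chains P (Suc n))" using G(1) by (auto simp: contracts_def)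
    show "K s \<in> frags {u \<in> chains P (Suc n). \<not> set u \<subseteq> Q}"
      unfolding K_def rel_proj_def by (rule frag_extend_frags[OF Gs]) (auto simp: frags_0)
    assume n: "n \<le> k" and nQ: "\<not> set s \<subseteq> Q"
    then obtain m where m: "n = Suc m" using s by (cases n) (auto simp: chains_def)
    have GK: "Bd (G s - K s) \<in> frags (chains Q n)" using Bd_chains[OF sub_Q[OF Gs]] by (simp add: K_def)
    then have 1: "rel_proj Q (Bd (G s)) = rel_proj Q (Bd (K s))"
      using pr_Q[OF GK] by (simp add: frag_extend_diff pr_diff)
    \<comment> \<open>The faces of s have n - 1 < k elements, so \<open>G\<close> respects Q on
      them. This extends the range from n < k to n \<le> k, the usual shift between a pair and its
      subspace.\<close>
    have "bd s \<in> frags (chains P m)" using bd_chains[OF s] m by simp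
    from sub_Q[OF this] have "frag_extend G (bd s - rel_proj Q (bd s)) \<in> frags (chains Q n)"
      by (rule frag_extend_frags) (use GQ m n in auto)
    from pr_Q[OF this] have 2: "frag_extend K (bd s) = frag_extend K (rel_proj Q (bd s))"
      by (simp add: Kf frag_extend_diff pr_diff)
    have "Bd (G s) + frag_extend G (bd s) = frag_of s"
      using G(1) s n unfolding contracts_def by (meson le_imp_less_Suc)
    then have "rel_proj Q (Bd (G s) + frag_extend G (bd s)) = rel_proj Q (frag_of s)" by (simp only:)
    then have "rel_proj Q (Bd (G s)) + frag_extend K (bd s) = frag_of s"
      using nQ by (simp add: Kf) (simp add: rel_proj_def frag_extend_add)
    then show "rel_proj Q (Bd (K s)) + frag_extend K (rel_proj Q (bd s)) = frag_of s"
      using 1 2 by simp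
  qed
qed


section \<open>Geometric lattices\<close>

lemma poset_bottom_eqI:
  assumes "b \<in> K" "\<And>x. x \<in> K \<Longrightarrow> b \<le> x"
  shows "\<bottom>\<^bsub>poset_of K\<^esub> = b"
  unfolding bottom_def by (rule some_equality) (use assms in \<open>auto simp: least_def intro: antisym\<close>)

lemma poset_sup_eqI:
  assumes "s \<in> K" "A \<subseteq> K" "\<And>x. x \<in> A \<Longrightarrow> x \<le> s" "\<And>u. u \<in> K \<Longrightarrow> (\<And>x. x \<in> A \<Longrightarrow> x \<le> u) \<Longrightarrow> s \<le> u"
  shows "\<Squnion>\<^bsub>poset_of K\<^esub> A = s"
  unfolding sup_def
proof (rule some_equality)
  show "least (poset_of K) s (Upper (poset_of K) A)"
    using assms(1-3) by (auto simp: least_def Upper_def intro!: assms(4))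
  fix t assume "least (poset_of K) t (Upper (poset_of K) A)"
  then have "t \<in> K" "\<And>x. x \<in> A \<Longrightarrow> x \<le> t" "t \<le> s"
    using assms by (auto simp: least_def Upper_def)
  then show "t = s" using assms(4)[of t] by (auto intro: antisym)
qed

locale geom =
  fixes L :: "'a::order set"
  assumes geom: "geometric_lattice L"
begin

definition bt where "bt = \<bottom>\<^bsub>poset_of L\<^esub>"
definition tp where "tp = \<top>\<^bsub>poset_of L\<^esub>"
definition r where "r = poset_rank L"
definition jn where "jn x y = x \<squnion>\<^bsub>poset_of L\<^esub> y"
definition mt where "mt x y = x \<sqinter>\<^bsub>poset_of L\<^esub> y"
definition js where "js A = \<Squnion>\<^bsub>poset_of L\<^esub> A"

lemma finite_L: "finite L" and ne: "L \<noteq> {}" and lat: "lattice (poset_of L)" and rk: "ranked L"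
  using geom by (auto simp: geometric_lattice_def)

sublocale lat: lattice "poset_of L" by (rule lat)

lemma jn_props: "x \<in> L \<Longrightarrow> y \<in> L \<Longrightarrow> jn x y \<in> L" "x \<in> L \<Longrightarrow> y \<in> L \<Longrightarrow> x \<le> jn x y"
  "x \<in> L \<Longrightarrow> y \<in> L \<Longrightarrow> y \<le> jn x y"
  "x \<in> L \<Longrightarrow> y \<in> L \<Longrightarrow> z \<in> L \<Longrightarrow> x \<le> z \<Longrightarrow> y \<le> z \<Longrightarrow> jn x y \<le> z"
  using lat.join_closed[of x y] lat.join_left[of x y] lat.join_right[of x y] lat.join_le[of x z y]
  by (auto simp: jn_def)

lemma mt_props: "x \<in> L \<Longrightarrow> y \<in> L \<Longrightarrow> mt x y \<in> L" "x \<in> L \<Longrightarrow> y \<in> L \<Longrightarrow> mt x y \<le> x"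
  "x \<in> L \<Longrightarrow> y \<in> L \<Longrightarrow> mt x y \<le> y"
  "x \<in> L \<Longrightarrow> y \<in> L \<Longrightarrow> z \<in> L \<Longrightarrow> z \<le> x \<Longrightarrow> z \<le> y \<Longrightarrow> z \<le> mt x y"
  using lat.meet_closed[of x y] lat.meet_left[of x y] lat.meet_right[of x y] lat.meet_le[of z x y]
  by (auto simp: mt_def)

lemma jn_le_iff: "x \<in> L \<Longrightarrow> y \<in> L \<Longrightarrow> z \<in> L \<Longrightarrow> jn x y \<le> z \<longleftrightarrow> x \<le> z \<and> y \<le> z"
  using jn_props(2,3)[of x y] jn_props(4)[of x y z] by (auto dest: order_trans)

lemma bt_least: "bt \<in> L" "x \<in> L \<Longrightarrow> bt \<le> x"
proof -
  let ?b = "\<Sqinter>\<^bsub>poset_of L\<^esub> L"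
  have "greatest (poset_of L) ?b (Lower (poset_of L) L)"
    using lat.finite_inf_greatest[of L] finite_L ne by auto
  then have b: "?b \<in> L" "\<And>x. x \<in> L \<Longrightarrow> ?b \<le> x" by (auto simp: greatest_def Lower_def)
  then have "bt = ?b" unfolding bt_def by (rule poset_bottom_eqI)
  then show "bt \<in> L" "x \<in> L \<Longrightarrow> bt \<le> x" using b by auto
qed

lemma tp_greatest: "tp \<in> L" "x \<in> L \<Longrightarrow> x \<le> tp"
proof -
  let ?b = "\<Squnion>\<^bsub>poset_of L\<^esub> L"
  have "least (poset_of L) ?b (Upper (poset_of L) L)"
    using lat.finite_sup_least[of L] finite_L ne by auto
  then have b: "?b \<in> L" "\<And>x. x \<in> L \<Longrightarrow> x \<le> ?b" by (auto simp: least_def Upper_def)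
  then have "tp = ?b" unfolding tp_def top_def
    by (intro some_equality) (auto simp: greatest_def intro: antisym)
  then show "tp \<in> L" "x \<in> L \<Longrightarrow> x \<le> tp" using b by auto
qed

lemma js_props:
  assumes "A \<subseteq> L"
  shows "js A \<in> L" "x \<in> A \<Longrightarrow> x \<le> js A" "u \<in> L \<Longrightarrow> (\<And>x. x \<in> A \<Longrightarrow> x \<le> u) \<Longrightarrow> js A \<le> u"
proof -
  have "js A \<in> L \<and> (\<forall>x\<in>A. x \<le> js A) \<and> (\<forall>u\<in>L. (\<forall>x\<in>A. x \<le> u) \<longrightarrow> js A \<le> u)"
  proof (cases "A = {}")
    case True
    have "js A = bt" unfolding js_def by (rule poset_sup_eqI) (use True bt_least in auto)
    then show ?thesis using True bt_least by auto
  next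
    case False
    have "least (poset_of L) (js A) (Upper (poset_of L) A)"
      unfolding js_def using False assms finite_subset[OF assms finite_L] by (intro lat.finite_sup_least) auto
    then show ?thesis using assms by (auto simp: least_def Upper_def)
  qed
  then show "js A \<in> L" "x \<in> A \<Longrightarrow> x \<le> js A" "u \<in> L \<Longrightarrow> (\<And>x. x \<in> A \<Longrightarrow> x \<le> u) \<Longrightarrow> js A \<le> u" by auto
qed

lemma js_empty: "js {} = bt" unfolding js_def by (rule poset_sup_eqI) (use bt_least in auto)

lemma js_mono: "A \<subseteq> B \<Longrightarrow> B \<subseteq> L \<Longrightarrow> js A \<le> js B"
  by (rule js_props(3)) (use js_props in auto)

lemma js_le_iff: "A \<subseteq> L \<Longrightarrow> u \<in> L \<Longrightarrow> js A \<le> u \<longleftrightarrow> (\<forall>x\<in>A. x \<le> u)"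
  using js_props(2)[of A] js_props(3)[of A u] by (auto dest: order_trans)

lemma js_insert: "a \<in> L \<Longrightarrow> A \<subseteq> L \<Longrightarrow> js (insert a A) = jn a (js A)"
proof (rule antisym)
  assume a: "a \<in> L" and A: "A \<subseteq> L"
  then have aA: "insert a A \<subseteq> L" by simp
  show "jn a (js A) \<le> js (insert a A)"
    using js_props(2)[OF aA, of a] js_mono[OF _ aA, of A] a js_props(1)[OF aA] js_props(1)[OF A] by (auto simp: jn_le_iff)
  have "x \<le> jn a (js A)" if "x \<in> A" for x
    using order_trans[OF js_props(2)[OF A that] jn_props(3)[OF a js_props(1)[OF A]]] .
  then show "js (insert a A) \<le> jn a (js A)"
    using js_le_iff[OF aA jn_props(1)[OF a js_props(1)[OF A]]] jn_props(2)[OF a js_props(1)[OF A]] by auto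
qed

lemma js_down: "x \<in> L \<Longrightarrow> A \<subseteq> down_set L x \<Longrightarrow> \<Squnion>\<^bsub>poset_of (down_set L x)\<^esub> A = js A"
proof (rule poset_sup_eqI)
  assume "x \<in> L" "A \<subseteq> down_set L x"
  moreover from this have "A \<subseteq> L" by (auto simp: down_set_def)
  ultimately show "js A \<in> down_set L x" "\<And>y. y \<in> A \<Longrightarrow> y \<le> js A"
    "\<And>u. u \<in> down_set L x \<Longrightarrow> (\<And>x. x \<in> A \<Longrightarrow> x \<le> u) \<Longrightarrow> js A \<le> u"
    by (auto simp: down_set_def js_props intro: js_props(3))
qed

lemma bt_down: "x \<in> L \<Longrightarrow> \<bottom>\<^bsub>poset_of (down_set L x)\<^esub> = bt"
  by (rule poset_bottom_eqI) (use bt_least in \<open>auto simp: down_set_def\<close>)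

lemma finite_chains_below: "finite {C. C \<subseteq> {y \<in> L. y < x} \<and> Complete_Partial_Order.chain (\<le>) C}"
  by (rule finite_subset[of _ "Pow L"]) (use finite_L in auto)

lemma r_less:
  assumes "x \<in> L" "y \<in> L" "x < y" shows "r x < r y"
proof -
  let ?S = "\<lambda>x. {C. C \<subseteq> {y \<in> L. y < x} \<and> Complete_Partial_Order.chain (\<le>) C}"
  have "{} \<in> ?S x" by (auto simp: chain_def)
  then have "r x \<in> card ` ?S x"
    unfolding r_def poset_rank_def by (intro Max_in finite_imageI finite_chains_below) blast
  then obtain C where C: "C \<in> ?S x" "r x = card C" by auto
  then have Cx: "\<And>c. c \<in> C \<Longrightarrow> c \<in> L \<and> c < x" by auto
  then have "insert x C \<in> ?S y" using C(1) assms by (auto simp: chain_def dest!: Cx)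
  then have "card (insert x C) \<le> r y"
    unfolding r_def poset_rank_def by (intro Max_ge finite_imageI finite_chains_below imageI)
  moreover have "x \<notin> C" "finite C" using C finite_subset[OF _ finite_L, of C] by auto
  ultimately show ?thesis using C by simp
qed

lemma r_le: "x \<in> L \<Longrightarrow> y \<in> L \<Longrightarrow> x \<le> y \<Longrightarrow> r x \<le> r y"
  using r_less[of x y] by (cases "x = y") (auto simp: order_less_le)

lemma r_eq: "x \<in> L \<Longrightarrow> y \<in> L \<Longrightarrow> x \<le> y \<Longrightarrow> r y \<le> r x \<Longrightarrow> x = y"
  using r_less[of x y] by (cases "x = y") (auto simp: order_less_le)

lemma r_bt: "r bt = 0"
proof -
  have "{y \<in> L. y < bt} = {}" using bt_least by (auto simp: less_le_not_le)
  then have "{C. C \<subseteq> {y \<in> L. y < bt} \<and> Complete_Partial_Order.chain (\<le>) C} = {{}}" by (auto simp: chain_def)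
  then show ?thesis by (simp add: r_def poset_rank_def)
qed

lemma semimod: "x \<in> L \<Longrightarrow> y \<in> L \<Longrightarrow> r (mt x y) + r (jn x y) \<le> r x + r y"
  using geom by (auto simp: geometric_lattice_def r_def jn_def mt_def)

lemma r_down: "x \<in> L \<Longrightarrow> y \<in> down_set L x \<Longrightarrow> poset_rank (down_set L x) y = r y"
proof -
  assume "x \<in> L" "y \<in> down_set L x"
  then have "{z \<in> down_set L x. z < y} = {z \<in> L. z < y}" by (auto simp: down_set_def)
  then show ?thesis by (simp add: r_def poset_rank_def)
qed

section \<open>Atoms, independence and circuits\<close>

abbreviation at where "at \<equiv> atoms L"

lemma atL: "a \<in> at \<Longrightarrow> a \<in> L" by (auto simp: atoms_def covers_def)

lemma at_iff: "a \<in> at \<longleftrightarrow> a \<in> L \<and> bt < a \<and> (\<forall>w\<in>L. \<not> (bt < w \<and> w < a))"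
  using bt_least by (auto simp: atoms_def covers_def bt_def[symmetric])

lemma r_at: "a \<in> at \<Longrightarrow> r a = 1"
  using rk r_bt by (auto simp: atoms_def ranked_def bt_def r_def)

lemma finite_at: "finite at" using finite_subset[OF _ finite_L] atL by auto

lemma atoms_down: "x \<in> L \<Longrightarrow> atoms (down_set L x) = {a \<in> at. a \<le> x}"
proof -
  assume x: "x \<in> L"
  have "w \<le> x" if "w < a" "a \<le> x" for w a using that by (meson less_imp_le order_trans)
  then show ?thesis
    unfolding atoms_def covers_def bt_down[OF x] bt_def[symmetric]
    using bt_least x by (auto simp: down_set_def)
qed

lemma ex_atom:
  assumes "x \<in> L" "y \<in> L" "\<not> x \<le> y" obtains a where "a \<in> at" "a \<le> x" "\<not> a \<le> y"
proof -
  obtain A where A: "A \<subseteq> at" "x = js A"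
    using geom assms(1) unfolding geometric_lattice_def js_def by blast
  then have AL: "A \<subseteq> L" using atL by auto
  then have "\<exists>a\<in>A. \<not> a \<le> y" using js_props(3)[OF AL assms(2)] assms(3) A(2) by auto
  then show ?thesis using that A js_props(2)[OF AL] by auto
qed

lemma r_jn_atom:
  assumes "a \<in> at" "x \<in> L" "\<not> a \<le> x" shows "r (jn a x) = r x + 1"
proof -
  have aL: "a \<in> L" using assms(1) atL by auto
  have "r (jn a x) \<le> r x + 1" using semimod[OF aL assms(2)] r_at[OF assms(1)] by simp
  moreover have "x < jn a x" using jn_props[OF aL assms(2)] assms(3) by (auto simp: order_less_le)
  then have "r x < r (jn a x)" using r_less[OF assms(2) jn_props(1)[OF aL assms(2)]] by simp
  ultimately show ?thesis by simp
qed

lemma r_js_le: "A \<subseteq> at \<Longrightarrow> r (js A) \<le> card A"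
proof -
  assume A: "A \<subseteq> at"
  then have "finite A" using finite_at finite_subset by auto
  then show ?thesis using A
  proof (induction A)
    case empty then show ?case by (simp add: js_empty r_bt)
  next
    case (insert a A)
    then have aA: "a \<in> L" "A \<subseteq> L" using atL by auto
    have "r (js (insert a A)) \<le> r a + r (js A)"
      using semimod[OF aA(1) js_props(1)[OF aA(2)]] by (simp add: js_insert[OF aA])
    then show ?case using insert r_at by auto
  qed
qed

lemma independent_iff: "x \<in> L \<Longrightarrow> A \<subseteq> atoms (down_set L x) \<Longrightarrow> independent (down_set L x) A \<longleftrightarrow> r (js A) = card A"
proof -
  assume x: "x \<in> L" "A \<subseteq> atoms (down_set L x)"
  then have "A \<subseteq> {a \<in> at. a \<le> x}" by (simp only: atoms_down)
  then have A: "A \<subseteq> down_set L x" "A \<subseteq> L" by (auto simp: down_set_def atL)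
  have "js A \<in> down_set L x" using js_props(1,3)[OF A(2)] x A by (auto simp: down_set_def)
  then show ?thesis using x A by (simp add: independent_def js_down r_down)
qed

text \<open>Joins and ranks of a lower interval are those of L, so this one notion of circuit serves
  all stalks: in \<open>circuit_down\<close> only the condition that the atoms lie below x is
  added.\<close>

definition circ where "circ C \<longleftrightarrow> C \<subseteq> at \<and> r (js C) \<noteq> card C \<and> (\<forall>B. B \<subset> C \<longrightarrow> r (js B) = card B)"

lemma circuit_down: "x \<in> L \<Longrightarrow> circuit (down_set L x) C \<longleftrightarrow> circ C \<and> (\<forall>a\<in>C. a \<le> x)"
proof -
  assume x: "x \<in> L"
  have *: "independent (down_set L x) B \<longleftrightarrow> r (js B) = card B" if "B \<subseteq> C" "C \<subseteq> atoms (down_set L x)" for B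
    using independent_iff[OF x, of B] that by auto
  show ?thesis
    unfolding circuit_def circ_def using * by (auto simp: atoms_down[OF x])
qed

text \<open>C without c is independent of rank |C| - 1, and the rank of C cannot be larger since C
  is dependent. This makes all terms of the relation of a circuit span the same flat, the source of
  the grading by flats.\<close>

lemma circ_js: "circ C \<Longrightarrow> c \<in> C \<Longrightarrow> js (C - {c}) = js C"
proof -
  assume C: "circ C" "c \<in> C"
  then have CL: "C \<subseteq> L" "C \<subseteq> at" "finite C" using atL finite_at finite_subset by (auto simp: circ_def)
  have 1: "r (js (C - {c})) = card C - 1"
  proof -
    have "C - {c} \<subset> C" using C by auto
    then have "r (js (C - {c})) = card (C - {c})" using C unfolding circ_def by blast
    then show ?thesis using C CL by simp
  qed
  have "r (js C) \<le> card C - 1" using r_js_le[OF CL(2)] C by (auto simp: circ_def)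
  then show ?thesis using 1 CL by (intro r_eq js_props js_mono) auto
qed

lemma ex_circ:
  assumes "A \<subseteq> at" "r (js A) \<noteq> card A"
  obtains C where "C \<subseteq> A" "circ C" "C \<noteq> {}"
proof -
  define P where "P B \<longleftrightarrow> B \<subseteq> A \<and> r (js B) \<noteq> card B" for B
  obtain C where C: "P C" "\<And>B. P B \<Longrightarrow> card C \<le> card B"
    using assms ex_has_least_nat[of P A card] by (auto simp: P_def)
  have fA: "finite A" using assms finite_at finite_subset by auto
  have "r (js B) = card B" if "B \<subset> C" for B
  proof (rule ccontr)
    assume "r (js B) \<noteq> card B"
    then have "card C \<le> card B" using C that by (auto simp: P_def)
    moreover have "finite C" using C(1) fA finite_subset by (auto simp: P_def)
    ultimately show False using psubset_card_mono[of C B] that by auto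
  qed
  then have "circ C" using C(1) assms by (auto simp: P_def circ_def)
  moreover have "C \<noteq> {}" using C(1) js_empty r_bt by (auto simp: P_def)
  ultimately show ?thesis using that C(1) by (auto simp: P_def)
qed

text \<open>The hypotheses on \<open>U\<close> say that it is a proper modular cut of the interval \<open>[u, v]\<close>. Principal
  filters would not do: for a cover \<open>b\<close> of \<open>u\<close> the set \<open>{y \<in> [u, x]. y \<squnion> b \<in> U}\<close> met in the induction is a modular
  cut again, but need not be principal if \<open>U\<close> is.\<close>

lemma acyclic_below_modular_cut:
  assumes "u \<in> L" "v \<in> L" "u \<le> v" "v \<in> U" "u \<notin> U" "U \<subseteq> {y \<in> L. u \<le> y \<and> y \<le> v}"
    and up: "\<And>y y'. y \<in> U \<Longrightarrow> y' \<in> L \<Longrightarrow> y \<le> y' \<Longrightarrow> y' \<le> v \<Longrightarrow> y' \<in> U"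
    and modular: "\<And>y y'. y \<in> U \<Longrightarrow> y' \<in> U \<Longrightarrow> r y + r y' = r (mt y y') + r (jn y y') \<Longrightarrow> mt y y' \<in> U"
  shows "acyclic_below {y \<in> L. u < y \<and> y \<le> v \<and> y \<notin> U} (r v - r u - 1)"
  using assms
proof (induction "r v - r u" arbitrary: u v U rule: less_induct)
  case less
  let ?k = "r v - r u - 1"
  have uv: "u < v" using less.prems(3-5) by (auto simp: order_less_le)
  show ?case
  proof (cases "r v = r u + 1")
    case True then show ?thesis by (simp add: acyclic_below_0)
  next
    case False
    then have rv: "r v \<ge> r u + 2" using r_less[OF less.prems(1,2) uv] by simp
    have cover: "jn a u \<in> L \<and> u < jn a u \<and> jn a u \<le> v \<and> r (jn a u) = r u + 1"
      if "a \<in> at" "a \<le> v" "\<not> a \<le> u" for a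
      using that less.prems(1-3) jn_props[of a u] r_jn_atom[of a u] atL[of a] by (auto simp: order_less_le)
    \<comment> \<open>Two distinct covers of u form a modular pair with meet u. If both belonged to
      U, so would u; hence one of them is outside.\<close>
    obtain b where b: "b \<in> L" "u < b" "b \<le> v" "r b = r u + 1" "b \<notin> U"
    proof -
      obtain a where a: "a \<in> at" "a \<le> v" "\<not> a \<le> u" 
        using ex_atom[OF less.prems(2,1)] uv by (auto simp: less_le_not_le)
      let ?b = "jn a u"
      note B = cover[OF a]
      have "\<not> v \<le> ?b" using B rv less.prems r_le[of v ?b] by auto
      then obtain c where c: "c \<in> at" "c \<le> v" "\<not> c \<le> ?b" 
        using ex_atom[OF less.prems(2), of ?b] B by auto
      have "\<not> c \<le> u" using c B by auto
      let ?c = "jn c u"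
      note C = cover[OF c(1,2) \<open>\<not> c \<le> u\<close>]
      show ?thesis
      proof (cases "?b \<in> U \<and> ?c \<in> U")
        case True
        have cb: "\<not> ?c \<le> ?b" using c B C jn_le_iff[of c u ?b] atL less.prems(1) by auto
        have m: "mt ?b ?c \<in> L" "mt ?b ?c \<le> ?b" "mt ?b ?c \<le> ?c" "u \<le> mt ?b ?c"
          using mt_props[of ?b ?c] B C less.prems(1) by auto
        have "mt ?b ?c \<noteq> ?b" using m cb B C r_eq[of ?b ?c] by auto
        then have "r (mt ?b ?c) < r ?b" using r_less[of "mt ?b ?c" ?b] m B by auto
        then have mu: "mt ?b ?c = u" using r_eq[of u "mt ?b ?c"] m B less.prems(1) by auto
        have j: "jn ?b ?c \<in> L" "?b \<le> jn ?b ?c" "?c \<le> jn ?b ?c" using jn_props B C by auto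
        then have "?b < jn ?b ?c" using cb by (auto simp: order_less_le)
        then have "r ?b < r (jn ?b ?c)" using r_less[of ?b "jn ?b ?c"] j(1) B by blast
        moreover have "r (mt ?b ?c) + r (jn ?b ?c) \<le> r ?b + r ?c" using semimod[of ?b ?c] B C by blast
        ultimately have "r ?b + r ?c = r (mt ?b ?c) + r (jn ?b ?c)" using mu B C by auto
        then have "mt ?b ?c \<in> U" using less.prems(8)[of ?b ?c] True by blast
        then show ?thesis using mu less.prems(5) by simp
      next
        case False
        then show ?thesis using B C that[of ?b] that[of ?c] by blast
      qed
    qed
    have bj: "jn b y \<in> L" "jn b y \<le> v" "b \<le> jn b y" "y \<le> jn b y" if "y \<in> L" "y \<le> v" for y
      using jn_props[of b y] that b less.prems(2) by auto
    have rbj: "r (jn b y) = r y + 1" if y: "y \<in> L" "u \<le> y" "\<not> b \<le> y" for y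
    proof -
      have "u \<le> mt b y" "mt b y \<in> L" using mt_props[of b y] b y less.prems(1) by auto
      then have "r u \<le> r (mt b y)" using r_le less.prems(1) by auto
      then have "r (jn b y) \<le> r y + 1" using semimod[of b y] b y by auto
      moreover have "y < jn b y" using jn_props[of b y] b y by (auto simp: order_less_le)
      then have "r y < r (jn b y)" using r_less[of y "jn b y"] jn_props(1)[of b y] b y by simp
      ultimately show ?thesis by simp
    qed
    let ?Q = "{y \<in> L. u < y \<and> y \<le> v \<and> y \<notin> U}"
    let ?C = "{y \<in> ?Q. jn b y \<notin> U}"
    let ?Y0 = "{y \<in> ?C. b \<le> y}"
    have jb: "jn b y = y" if "y \<in> L" "b \<le> y" for y using jn_props[of b y] b that by (auto intro: antisym)
    have Y0: "acyclic_below ?Y0 k" for k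
      by (rule acyclic_below_cone[of b]) (use b jb[of b] in auto)
    have C: "acyclic_below ?C ?k"
    proof -
      \<comment> \<open>For x not above b, the elements of \<open>?Y0\<close> above x have the least
        element \<open>jn b x\<close>, so that each new upper link is a cone.\<close>
      have "acyclic_below (?Y0 \<union> {y \<in> ?C. \<not> b \<le> y}) ?k"
      proof (rule acyclic_below_Un_increasing)
        fix x assume x: "x \<in> {y \<in> ?C. \<not> b \<le> y}"
        show "acyclic_below {y \<in> ?Y0. x < y} ?k"
        proof (rule acyclic_below_cone)
          show "jn b x \<in> {y \<in> ?Y0. x < y}"
            using bj[of x] jb[of "jn b x"] x b by (auto simp: order_less_le)
          fix y assume "y \<in> {y \<in> ?Y0. x < y}"
          then show "jn b x \<le> y" using x b jn_props(4)[of b x y] by auto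
        qed
      qed (use finite_L Y0 in auto)
      moreover have "?Y0 \<union> {y \<in> ?C. \<not> b \<le> y} = ?C" by auto
      ultimately show ?thesis by simp
    qed
    have "acyclic_below (?C \<union> {y \<in> ?Q. jn b y \<in> U}) ?k"
    proof (rule acyclic_below_Un_decreasing[OF _ C])
      fix x assume "x \<in> {y \<in> ?Q. jn b y \<in> U}"
      then have x: "x \<in> L" "u < x" "x \<le> v" "x \<notin> U" "jn b x \<in> U" by auto
      have bx: "\<not> b \<le> x" using x jb by auto
      have xv: "x < v" using x less.prems(4) by (auto simp: order_less_le)
      have rux: "r u < r x" "r x < r v" using r_less less.prems(1,2) x xv by auto
      \<comment> \<open>The cut that turns the lower link of x into a poset of the same kind. It
        contains x, and it misses u because joining b to u gives b, which is not in U.\<close>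
      let ?U1 = "{y \<in> L. u \<le> y \<and> y \<le> x \<and> jn b y \<in> U}"
      have lo: "acyclic_below {y \<in> L. u < y \<and> y \<le> x \<and> y \<notin> ?U1} (r x - r u - 1)"
      proof (rule less.hyps)
        show "u \<notin> ?U1"
        proof
          assume "u \<in> ?U1"
          then have "jn b u \<in> U" by auto
          moreover have "jn b u = b" using jn_props[of b u] b less.prems(1) by (auto intro: antisym)
          ultimately show False using b by simp
        qed
        fix y y' assume y: "y \<in> ?U1" "y' \<in> L" "y \<le> y'" "y' \<le> x"
        then have "jn b y \<le> jn b y'" using b jn_props[of b y'] jn_props(4)[of b y "jn b y'"] by (auto intro: order_trans)
        then show "y' \<in> ?U1" using y less.prems(7)[of "jn b y" "jn b y'"] bj[of y'] x by auto
      next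
        fix y y' assume y: "y \<in> ?U1" "y' \<in> ?U1" and m: "r y + r y' = r (mt y y') + r (jn y y')"
        let ?t = "mt (jn b y) (jn b y')"
        have mL: "mt y y' \<in> L" "mt y y' \<le> y" "mt y y' \<le> y'" "u \<le> mt y y'" using mt_props[of y y'] y less.prems(1) by auto
        have jL: "jn y y' \<in> L" "y \<le> jn y y'" "y' \<le> jn y y'" "jn y y' \<le> x" "u \<le> jn y y'"
          using jn_props[of y y'] y x(1) by (auto intro: order_trans)
        have B: "jn b y \<in> L" "jn b y' \<in> L" using y b jn_props by auto
        have nb: "\<not> b \<le> y" "\<not> b \<le> y'" "\<not> b \<le> mt y y'" "\<not> b \<le> jn y y'" using bx y mL jL by auto
        have tL: "?t \<in> L" using mt_props B by auto
        have le: "jn b (mt y y') \<le> ?t"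
          using mL y b B tL jn_props[of b y] jn_props[of b y'] by (auto simp: jn_le_iff intro!: mt_props(4) intro: order_trans)
        have jj: "jn b (jn y y') \<le> jn (jn b y) (jn b y')"
          using jL y b B jn_props[of b y] jn_props[of b y'] jn_props[of "jn b y" "jn b y'"]
          by (auto simp: jn_le_iff intro: order_trans)
        \<comment> \<open>No element below x is above b, so joining b raises all four ranks by one.
          Modular pairs thus stay modular, and the meet of the two joins with b is the join of b
          with the meet.\<close>
        have restr: "r (jn b y) = r y + 1" "r (jn b y') = r y' + 1" "r (jn b (mt y y')) = r (mt y y') + 1"
          "r (jn b (jn y y')) = r (jn y y') + 1"
          using rbj nb y mL jL by auto
        have "r (jn b (jn y y')) \<le> r (jn (jn b y) (jn b y'))" using jj r_le jn_props B jL b by auto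
        then have "r ?t \<le> r (jn b (mt y y'))" using semimod[OF B] restr m by simp
        then have t: "jn b (mt y y') = ?t" using r_eq[OF _ tL le] jn_props mL b by auto
        have "r ?t + r (jn (jn b y) (jn b y')) \<ge> r (jn b y) + r (jn b y')"
          using \<open>r (jn b (jn y y')) \<le> _\<close> restr m t by simp
        then have "r (jn b y) + r (jn b y') = r ?t + r (jn (jn b y) (jn b y'))" using semimod[OF B] by simp
        then have "?t \<in> U" using less.prems(8)[of "jn b y" "jn b y'"] y by auto
        then show "mt y y' \<in> ?U1" using t mL y by auto
      qed (use x less.prems rux in auto)
      have lo_eq: "{y \<in> L. u < y \<and> y \<le> x \<and> y \<notin> ?U1} = {y \<in> ?C. y < x}"
      proof -
        have "y \<notin> U" if "y \<in> L" "y \<le> x" "jn b y \<notin> U" for y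
          using that less.prems(7)[of y "jn b y"] bj[of y] x by auto
        then show ?thesis using x by (auto simp: order_less_le)
      qed
      have hi: "acyclic_below {y \<in> L. x < y \<and> y \<le> v \<and> y \<notin> {y \<in> U. x \<le> y}} (r v - r x - 1)"
      proof (rule less.hyps)
        fix y y' assume y: "y \<in> {y \<in> U. x \<le> y}" "y' \<in> {y \<in> U. x \<le> y}" "r y + r y' = r (mt y y') + r (jn y y')"
        then show "mt y y' \<in> {y \<in> U. x \<le> y}"
          using less.prems(8)[of y y'] less.prems(6) x mt_props(4)[of y y' x] by auto
      next
        fix y y' assume "y \<in> {y \<in> U. x \<le> y}" "y' \<in> L" "y \<le> y'" "y' \<le> v"
        then show "y' \<in> {y \<in> U. x \<le> y}" using less.prems(7) by auto
      qed (use x less.prems rux in auto)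
      have hi_eq: "{y \<in> L. x < y \<and> y \<le> v \<and> y \<notin> {y \<in> U. x \<le> y}} = {y \<in> ?C \<union> {y \<in> ?Q. jn b y \<in> U}. x < y}"
        using x by auto
      show "\<exists>i j. acyclic_below {y \<in> ?C. y < x} i \<and> acyclic_below {y \<in> ?C \<union> {y \<in> ?Q. jn b y \<in> U}. x < y} j \<and> ?k \<le> i + j + 1"
      proof (intro exI conjI)
        show "acyclic_below {y \<in> ?C. y < x} (r x - r u - 1)" using lo unfolding lo_eq .
        show "acyclic_below {y \<in> ?C \<union> {y \<in> ?Q. jn b y \<in> U}. x < y} (r v - r x - 1)" using hi unfolding hi_eq .
        \<comment> \<open>The ranges of both links and the extra 1 for x add up to exactly r v - r u
          - 1.\<close>
        show "?k \<le> (r x - r u - 1) + (r v - r x - 1) + 1" using rux by linarith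
      qed
    qed (use finite_L in auto)
    moreover have "?C \<union> {y \<in> ?Q. jn b y \<in> U} = ?Q" by auto
    ultimately show ?thesis by simp
  qed
qed

text \<open>Meets of elements above z are above z, so the principal filter of z is a modular cut; it
  misses the bottom because z is not the bottom.\<close>

lemma acyclic_below_not_above:
  assumes "z \<in> L" "z \<noteq> bt"
  shows "acyclic_below (not_above L z) (r tp - 1)"
proof -
  have "acyclic_below {y \<in> L. bt < y \<and> y \<le> tp \<and> y \<notin> {y \<in> L. z \<le> y}} (r tp - r bt - 1)"
  proof (rule acyclic_below_modular_cut)
    show "bt \<notin> {y \<in> L. z \<le> y}" using assms bt_least by (auto intro: antisym)
  qed (use bt_least tp_greatest assms mt_props in auto)
  moreover have "{y \<in> L. bt < y \<and> y \<le> tp \<and> y \<notin> {y \<in> L. z \<le> y}} = not_above L z"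
    using bt_least tp_greatest by (auto simp: not_above_def punctured_def bt_def[symmetric] order_less_le)
  ultimately show ?thesis by (simp add: r_bt)
qed

end

section \<open>The Moebius function and Philip Hall's theorem\<close>

lemma mobius_self: "finite K \<Longrightarrow> x \<in> K \<Longrightarrow> mobius K x x = 1"
  by (subst mobius.simps) simp

lemma mobius_less:
  assumes "finite K" "x \<in> K" "y \<in> K" "x < y"
  shows "mobius K x y = - (\<Sum>w\<in>{w \<in> K. x \<le> w \<and> w < y}. mobius K x w)"
proof -
  have "finite K \<and> x \<in> K \<and> y \<in> K \<and> x \<le> y" "x \<noteq> y" using assms by auto
  then show ?thesis using mobius.simps[of K x y] by (simp only: if_True if_False simp_thms)
qed

lemma mobius_sum:
  assumes "finite K" "x \<in> K" "y \<in> K" "x < y"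
  shows "(\<Sum>w\<in>{w \<in> K. x \<le> w \<and> w \<le> y}. mobius K x w) = 0"
proof -
  have "{w \<in> K. x \<le> w \<and> w \<le> y} = insert y {w \<in> K. x \<le> w \<and> w < y}" using assms by auto
  then show ?thesis using assms mobius_less[OF assms] by simp
qed

lemma finite_chains: "finite Q \<Longrightarrow> finite (chains Q n)"
  by (rule finite_subset[of _ "{xs. set xs \<subseteq> Q \<and> length xs = n}"]) (auto simp: chains_def finite_lists_length_eq)

lemma chains_distinct: "s \<in> chains Q n \<Longrightarrow> distinct s"
  by (induction s arbitrary: n) (auto simp: chains_def)

lemma chains_empty_large: "finite Q \<Longrightarrow> n > card Q \<Longrightarrow> chains Q n = {}"
proof (rule ccontr)
  assume Q: "finite Q" "n > card Q" "chains Q n \<noteq> {}"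
  then obtain s where s: "s \<in> chains Q n" by auto
  then have "card (set s) = n" using chains_distinct[OF s] distinct_card[of s] by (simp add: chains_def)
  moreover have "card (set s) \<le> card Q" using s Q by (intro card_mono) (auto simp: chains_def)
  ultimately show False using Q by simp
qed

text \<open>The empty list is included; in \<open>euler_not_above\<close> it contributes the 1 of
  the reduced Euler characteristic.\<close>

definition all_chains :: "'a::order set \<Rightarrow> 'a list set" where
  "all_chains Q = {s. sorted_wrt (>) s \<and> set s \<subseteq> Q}"

lemma finite_all_chains: "finite Q \<Longrightarrow> finite (all_chains Q)"
proof -
  assume Q: "finite Q"
  have "all_chains Q \<subseteq> (\<Union>n\<le>card Q. chains Q n)"
  proof
    fix s assume "s \<in> all_chains Q"
    then have "s \<in> chains Q (length s)" by (auto simp: all_chains_def chains_def)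
    moreover from this have "length s \<le> card Q" using chains_empty_large[OF Q, of "length s"] by force
    ultimately show "s \<in> (\<Union>n\<le>card Q. chains Q n)" by auto
  qed
  then show ?thesis by (rule finite_subset) (use finite_chains[OF Q] in auto)
qed

text \<open>Philip Hall's theorem: the list \<open>[x, \<dots>, y]\<close> stands for the chain \<open>b < y < \<dots> < x\<close>, whose
  length is the length of the list.\<close>

lemma hall:
  assumes K: "finite K" "b \<in> K" "\<And>x. x \<in> K \<Longrightarrow> b \<le> x" and x: "x \<in> K" "x \<noteq> b"
  shows "(\<Sum>s\<in>{s \<in> all_chains (K - {b}). s \<noteq> [] \<and> hd s = x}. (-1) ^ length s) = mobius K b x"
  using x
proof (induction "card {w \<in> K. w < x}" arbitrary: x rule: less_induct)
  case less
  let ?A = "all_chains (K - {b})"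
  let ?S = "\<lambda>x. {s \<in> ?A. s \<noteq> [] \<and> hd s = x}"
  have finS: "finite (?S y)" for y using finite_all_chains[of "K - {b}"] K(1) by auto
  \<comment> \<open>Removing the top x leaves the empty list or a chain with a smaller top. This
    reproduces the recursion for \<open>mobius\<close>, with the empty list in the role of the term
    at b.\<close>
  have eq: "?S x = (#) x ` insert [] (\<Union>y\<in>{w \<in> K. b < w \<and> w < x}. ?S y)"
  proof (intro equalityI subsetI)
    fix s assume "s \<in> ?S x"
    then obtain t where s: "s = x # t" "s \<in> ?A" by (cases s) auto
    show "s \<in> (#) x ` insert [] (\<Union>y\<in>{w \<in> K. b < w \<and> w < x}. ?S y)"
    proof (cases t)
      case (Cons y t')
      then have "y \<in> {w \<in> K. b < w \<and> w < x}" "t \<in> ?S y" using s K(3) by (auto simp: all_chains_def order_less_le)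
      then show ?thesis using s by blast
    qed (use s in auto)
  next
    fix s assume "s \<in> (#) x ` insert [] (\<Union>y\<in>{w \<in> K. b < w \<and> w < x}. ?S y)"
    then obtain t where t: "s = x # t" "t = [] \<or> (\<exists>y\<in>{w \<in> K. b < w \<and> w < x}. t \<in> ?S y)" by auto
    show "s \<in> ?S x"
    proof (cases t)
      case (Cons y t')
      then have y: "y < x" "t \<in> ?A" using t by auto
      then have "\<forall>w\<in>set t. w < x" using Cons by (auto simp: all_chains_def)
      then show ?thesis using t(1) y less.prems by (auto simp: all_chains_def)
    qed (use t less.prems in \<open>auto simp: all_chains_def\<close>)
  qed
  have "(\<Sum>s\<in>?S x. (-1::int) ^ length s) = - (\<Sum>s\<in>insert [] (\<Union>y\<in>{w \<in> K. b < w \<and> w < x}. ?S y). (-1) ^ length s)"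
    unfolding eq by (subst sum.reindex) (auto simp: sum_negf)
  also have "(\<Sum>s\<in>insert [] (\<Union>y\<in>{w \<in> K. b < w \<and> w < x}. ?S y). (-1::int) ^ length s)
     = 1 + (\<Sum>s\<in>(\<Union>y\<in>{w \<in> K. b < w \<and> w < x}. ?S y). (-1) ^ length s)"
    using K finS by (subst sum.insert) auto
  also have "(\<Sum>s\<in>(\<Union>y\<in>{w \<in> K. b < w \<and> w < x}. ?S y). (-1::int) ^ length s)
     = (\<Sum>y\<in>{w \<in> K. b < w \<and> w < x}. \<Sum>s\<in>?S y. (-1) ^ length s)"
    using K finS by (intro sum.UNION_disjoint) auto
  also have "\<dots> = (\<Sum>y\<in>{w \<in> K. b < w \<and> w < x}. mobius K b y)"
  proof (intro sum.cong refl less.hyps)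
    fix y assume y: "y \<in> {w \<in> K. b < w \<and> w < x}"
    then have "{w \<in> K. w < y} \<subset> {w \<in> K. w < x}" by auto
    then show "card {w \<in> K. w < y} < card {w \<in> K. w < x}" using K by (intro psubset_card_mono) auto
  qed auto
  also have "- (1 + \<dots>) = mobius K b x"
  proof -
    have bx: "b < x" using less.prems K by (simp add: order_less_le)
    then have eq': "{w \<in> K. b \<le> w \<and> w < x} = insert b {w \<in> K. b < w \<and> w < x}" using K(2,3) by (auto simp: order_le_less)
    have "mobius K b x = - (\<Sum>w\<in>{w \<in> K. b \<le> w \<and> w < x}. mobius K b w)"
      by (rule mobius_less[OF K(1,2) less.prems(1) bx])
    then show ?thesis unfolding eq' using K(1) mobius_self[OF K(1,2)] by simp
  qed
  finally show ?case .
qed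

lemma hall_sum:
  assumes K: "finite K" "b \<in> K" "\<And>x. x \<in> K \<Longrightarrow> b \<le> x" and X: "X \<subseteq> K - {b}"
  shows "(\<Sum>s\<in>{s \<in> all_chains (K - {b}). s \<noteq> [] \<and> hd s \<in> X}. (-1) ^ length s) = (\<Sum>x\<in>X. mobius K b x)"
proof -
  let ?S = "\<lambda>x. {s \<in> all_chains (K - {b}). s \<noteq> [] \<and> hd s = x}"
  have "{s \<in> all_chains (K - {b}). s \<noteq> [] \<and> hd s \<in> X} = (\<Union>x\<in>X. ?S x)" by auto
  also have "(\<Sum>s\<in>\<dots>. (-1::int) ^ length s) = (\<Sum>x\<in>X. \<Sum>s\<in>?S x. (-1) ^ length s)"
    using K X finite_all_chains[of "K - {b}"] finite_subset[of X K] by (intro sum.UNION_disjoint) auto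
  also have "\<dots> = (\<Sum>x\<in>X. mobius K b x)" using hall[OF K] X by (intro sum.cong) auto
  finally show ?thesis .
qed


section \<open>The Orlik--Solomon ideal\<close>

lemma frags_linear_eq:
  assumes "x \<in> frags B" "\<And>b. b \<in> B \<Longrightarrow> f (frag_of b) = g (frag_of b)"
    "\<And>x y. f (x - y) = f x - f y" "\<And>x y. g (x - y) = g x - g y"
  shows "f x = (g x :: 'v::ab_group_add)"
proof -
  have 0: "f 0 = 0" "g 0 = 0" using assms(3)[of 0 0] assms(4)[of 0 0] by simp_all
  from assms(1) show ?thesis by (induction rule: frags_induct) (auto simp: assms(2-4) 0)
qed

locale orlik_solomon = geom L for L :: "'a::order set" +
  fixes lt :: "'a \<Rightarrow> 'a \<Rightarrow> bool"
  assumes lt: "transp_on (atoms L) lt" "asymp_on (atoms L) lt" "totalp_on (atoms L) lt"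
begin

section \<open>The exterior algebra and its derivation\<close>

lemma lt_irrefl: "a \<in> at \<Longrightarrow> \<not> lt a a"
  using lt(2) by (auto simp: asymp_on_def)

lemma lt_total: "a \<in> at \<Longrightarrow> b \<in> at \<Longrightarrow> a \<noteq> b \<Longrightarrow> lt a b \<longleftrightarrow> \<not> lt b a"
  using lt(2,3) by (auto simp: asymp_on_def totalp_on_def)

abbreviation del :: "('a set \<Rightarrow>\<^sub>0 int) \<Rightarrow> 'a set \<Rightarrow>\<^sub>0 int" where
  "del \<equiv> frag_extend (alternating_deletion lt)"

abbreviation M :: "'a \<Rightarrow> ('a set \<Rightarrow>\<^sub>0 int) \<Rightarrow> 'a set \<Rightarrow>\<^sub>0 int" where
  "M a \<equiv> frag_extend (monomial_mult lt {a})"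

definition pos where "pos I v = card {w \<in> I. lt w v}"

lemma alternating_deletion_eq: "alternating_deletion lt I = (\<Sum>v\<in>I. frag_cmul ((-1) ^ pos I v) (frag_of (I - {v})))"
  by (simp add: alternating_deletion_def pos_def)

lemma monomial_mult_atom: "monomial_mult lt {a} I = (if a \<in> I then 0 else frag_cmul ((-1) ^ pos I a) (frag_of (insert a I)))"
proof -
  have "card {(i, j). i \<in> {a} \<and> j \<in> I \<and> lt j i} = pos I a"
    unfolding pos_def by (rule bij_betw_same_card[of snd]) (auto simp: bij_betw_def inj_on_def image_iff)
  then show ?thesis by (simp add: monomial_mult_def)
qed

lemma finite_atom_set: "I \<subseteq> at \<Longrightarrow> finite I" using finite_at finite_subset by auto

text \<open>Multiplication by an atom is a contracting homotopy for \<open>del\<close>. If a occurs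
  in I, the first term vanishes and in the second only the summand deleting a survives; otherwise
  all summands cancel in pairs except the one that deletes the new atom.\<close>

lemma leibniz_basis:
  assumes I: "I \<subseteq> at" and a: "a \<in> at"
  shows "del (monomial_mult lt {a} I) + M a (alternating_deletion lt I) = frag_of I"
proof -
  have fI: "finite I" using finite_atom_set[OF I] .
  have MA: "M a (alternating_deletion lt I) =
      (\<Sum>v\<in>I. frag_cmul ((-1) ^ pos I v) (monomial_mult lt {a} (I - {v})))"
    unfolding alternating_deletion_eq using fI by (simp add: frag_extend_sum frag_extend_cmul o_def)
  show ?thesis
  proof (cases "a \<in> I")
    case True
    have "M a (alternating_deletion lt I) =
      frag_cmul ((-1) ^ pos I a) (monomial_mult lt {a} (I - {a})) +
      (\<Sum>v\<in>I-{a}. frag_cmul ((-1) ^ pos I v) (monomial_mult lt {a} (I - {v})))"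
      unfolding MA using fI True by (rule sum.remove)
    also have "(\<Sum>v\<in>I-{a}. frag_cmul ((-1) ^ pos I v) (monomial_mult lt {a} (I - {v}))) = 0"
      using True by (intro sum.neutral) (auto simp: monomial_mult_atom)
    also have "pos (I - {a}) a = pos I a"
      unfolding pos_def using lt_irrefl[OF a] by (intro arg_cong[of _ _ card]) auto
    then have "frag_cmul ((-1) ^ pos I a) (monomial_mult lt {a} (I - {a})) = frag_of I"
      using True by (simp add: monomial_mult_atom insert_absorb flip: power_mult_distrib)
    finally have "M a (alternating_deletion lt I) = frag_of I" by simp
    moreover have "monomial_mult lt {a} I = 0" using True by (simp add: monomial_mult_atom)
    ultimately show ?thesis by simp
  next
    case False
    have pa: "pos (insert a I) a = pos I a"
      unfolding pos_def using lt_irrefl[OF a] by (intro arg_cong[of _ _ card]) auto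
    have "del (monomial_mult lt {a} I) =
       frag_cmul ((-1) ^ pos I a) (\<Sum>v\<in>insert a I. frag_cmul ((-1) ^ pos (insert a I) v) (frag_of (insert a I - {v})))"
      using False by (simp add: monomial_mult_atom frag_extend_cmul alternating_deletion_eq)
    also have "\<dots> = frag_of I + (\<Sum>v\<in>I. frag_cmul ((-1) ^ pos I a * (-1) ^ pos (insert a I) v) (frag_of (insert a I - {v})))"
      using fI False by (simp add: pa frag_cmul_distrib2 frag_cmul_sum flip: power_mult_distrib)
    also have "(\<Sum>v\<in>I. frag_cmul ((-1) ^ pos I a * (-1) ^ pos (insert a I) v) (frag_of (insert a I - {v})))
        = (\<Sum>v\<in>I. - frag_cmul ((-1) ^ pos I v) (monomial_mult lt {a} (I - {v})))"
    proof (rule sum.cong[OF refl])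
      fix v assume v: "v \<in> I"
      then have va: "v \<noteq> a" "v \<in> at" using False I by auto
      have "{w \<in> insert a I. lt w v} = (if lt a v then insert a {w \<in> I. lt w v} else {w \<in> I. lt w v})" by auto
      then have 1: "pos (insert a I) v = pos I v + (if lt a v then 1 else 0)"
        using fI False by (simp add: pos_def)
      have "{w \<in> I. lt w a} = (if lt v a then insert v {w \<in> I - {v}. lt w a} else {w \<in> I - {v}. lt w a})"
        using v by auto
      then have 2: "pos I a = pos (I - {v}) a + (if lt v a then 1 else 0)"
        using fI by (simp add: pos_def)
      \<comment> \<open>Exactly one of \<open>lt a v\<close> and \<open>lt v a\<close> holds, so
        exactly one of the two positions shifts by one: this is the minus sign.\<close>
      have "(-1::int) ^ pos I a * (-1) ^ pos (insert a I) v = - ((-1) ^ pos I v * (-1) ^ pos (I - {v}) a)"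
        using lt_total[OF a va(2)] va by (cases "lt a v") (simp_all add: 1 2)
      moreover have "insert a I - {v} = insert a (I - {v})" using va by auto
      ultimately show "frag_cmul ((-1) ^ pos I a * (-1) ^ pos (insert a I) v) (frag_of (insert a I - {v}))
          = - frag_cmul ((-1) ^ pos I v) (monomial_mult lt {a} (I - {v}))"
        using False by (simp add: monomial_mult_atom)
    qed
    finally show ?thesis unfolding MA by (simp add: sum_negf)
  qed
qed

lemma M_frags:
  assumes "x \<in> frags (Pow A)" "a \<in> A" shows "M a x \<in> frags (Pow A)"
  by (rule frag_extend_frags[OF assms(1)])
     (use assms(2) in \<open>auto simp: monomial_mult_atom frags_0 intro!: frags_cmul\<close>)

lemma del_frags:
  assumes "x \<in> frags (Pow A)" shows "del x \<in> frags (Pow A)"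
  by (rule frag_extend_frags[OF assms])
     (auto simp: alternating_deletion_eq intro!: frags_sum frags_cmul)

lemma M_card:
  assumes "x \<in> frags {I. I \<subseteq> A \<and> card I = n}" "a \<in> A" "A \<subseteq> at" shows "M a x \<in> frags {I. I \<subseteq> A \<and> card I = Suc n}"
  by (rule frag_extend_frags[OF assms(1)])
     (use assms(2) finite_atom_set[OF order_trans[OF _ assms(3)]] in
       \<open>auto simp: monomial_mult_atom frags_0 intro!: frags_cmul\<close>)

lemma del_card:
  assumes "x \<in> frags {I. I \<subseteq> A \<and> card I = Suc n}" "A \<subseteq> at" shows "del x \<in> frags {I. I \<subseteq> A \<and> card I = n}"
  by (rule frag_extend_frags[OF assms(1)])
     (use finite_atom_set[OF order_trans[OF _ assms(2)]] in
       \<open>auto simp: alternating_deletion_eq intro!: frags_sum frags_cmul\<close>)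

lemma leibniz: "x \<in> frags (Pow at) \<Longrightarrow> a \<in> at \<Longrightarrow> del (M a x) + M a (del x) = x"
proof (rule frags_linear_eq[of x "Pow at" "\<lambda>x. del (M a x) + M a (del x)" "\<lambda>x. x"])
  fix I assume "a \<in> at" "I \<in> Pow at"
  then show "del (M a (frag_of I)) + M a (del (frag_of I)) = frag_of I" using leibniz_basis by simp
qed (auto simp: frag_extend_diff)

lemma frag_of_insert: "a \<notin> I \<Longrightarrow> frag_of (insert a I) = frag_cmul ((-1) ^ pos I a) (M a (frag_of I))"
  by (simp add: monomial_mult_atom flip: power_mult_distrib)

text \<open>Inserting atoms one by one and applying the Leibniz rule twice avoids the double sum
  over pairs of deleted atoms.\<close>

lemma del_del_basis: "I \<subseteq> at \<Longrightarrow> del (alternating_deletion lt I) = 0"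
proof -
  assume I: "I \<subseteq> at"
  show ?thesis using finite_atom_set[OF I] I
  proof (induction I)
    case (insert a I)
    then have a: "a \<in> at" and x: "frag_of I \<in> frags (Pow at)" by auto
    have "del (M a (frag_of I)) = frag_of I - M a (del (frag_of I))" using leibniz[OF x a] by (simp add: eq_diff_eq)
    then have "del (del (M a (frag_of I))) = del (frag_of I) - del (M a (del (frag_of I)))" by (simp add: frag_extend_diff)
    also have "del (M a (del (frag_of I))) = del (frag_of I) - M a (del (del (frag_of I)))"
      using leibniz[OF del_frags[OF x] a] by (simp add: eq_diff_eq)
    finally have "del (del (M a (frag_of I))) = 0" using insert by simp
    then have "del (del (frag_of (insert a I))) = 0"
      unfolding frag_of_insert[OF insert.hyps(2)] by (simp only: frag_extend_cmul) simp
    then show ?case by simp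
  qed (simp add: alternating_deletion_eq)
qed

lemma del_del: "x \<in> frags (Pow at) \<Longrightarrow> del (del x) = 0"
  by (induction rule: frags_induct) (auto simp: frag_extend_diff del_del_basis)

abbreviation ats where "ats x \<equiv> {a \<in> at. a \<le> x}"

text \<open>The Orlik--Solomon ideal of \<open>down_set L x\<close> (see \<open>OS_ideal_eq\<close>); in this form properties of the ideal
  follow by induction.\<close>

inductive_set J :: "'a \<Rightarrow> ('a set \<Rightarrow>\<^sub>0 int) set" for x where
  zero: "0 \<in> J x"
| diff: "y \<in> J x \<Longrightarrow> z \<in> J x \<Longrightarrow> y - z \<in> J x"
| gen: "circ C \<Longrightarrow> C \<subseteq> ats x \<Longrightarrow> alternating_deletion lt C \<in> J x"
| mul: "a \<in> ats x \<Longrightarrow> y \<in> J x \<Longrightarrow> M a y \<in> J x"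

lemma subgrp_J: "subgrp (J x)" by (auto simp: subgrp_def J.zero J.diff)

lemma J_frags: "y \<in> J x \<Longrightarrow> y \<in> frags (Pow (ats x))"
proof (induction rule: J.induct)
  case (gen C)
  then show ?case using del_frags[of "frag_of C" "ats x"] by simp
next
  case (mul a y)
  then show ?case by (intro M_frags) auto
qed (auto simp: frags_0 frags_diff)

lemma frags_ats: "y \<in> frags (Pow (ats x)) \<Longrightarrow> y \<in> frags (Pow at)"
  by (rule frags_mono[rotated]) auto

lemma J_mono: "y \<in> J x \<Longrightarrow> x \<le> x' \<Longrightarrow> y \<in> J x'"
  by (induction rule: J.induct) (auto intro!: J.intros intro: order_trans)

text \<open>On generators \<open>del\<close> vanishes, being applied twice, and the Leibniz rule
  passes multiplication by atoms. Thus \<open>del\<close> acts on the Orlik-Solomon algebra.\<close>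

lemma J_del: "y \<in> J x \<Longrightarrow> del y \<in> J x"
proof (induction rule: J.induct)
  case (diff y z) then show ?case by (simp add: frag_extend_diff J.diff)
next
  case (gen C)
  then have "C \<subseteq> at" by auto
  then show ?case by (simp add: del_del_basis J.zero)
next
  case (mul a y)
  then have "del (M a y) = y - M a (del y)"
    using leibniz[OF frags_ats[OF J_frags[OF mul(2)]], of a] by (simp add: eq_diff_eq)
  then show ?case using mul by (auto intro!: J.diff J.mul)
qed (simp add: J.zero)

text \<open>A single atom is independent, so no circuit has a relation with a constant term. This
  keeps the degree 0 piece from collapsing, the start of the induction on rank.\<close>

lemma J_empty_coeff: "y \<in> J x \<Longrightarrow> Poly_Mapping.lookup y {} = 0"
proof (induction rule: J.induct)
  case (gen C)
  have "C - {v} \<noteq> {}" if "v \<in> C" for v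
  proof
    assume "C - {v} = {}"
    then have C: "C = {v}" using that by auto
    then have v: "v \<in> at" using gen by auto
    have "js {v} = jn v bt" using js_insert[of v "{}"] v atL by (simp add: js_empty)
    then have "r (js {v}) = 1"
      using r_jn_atom[OF v bt_least(1)] r_bt at_iff[of v] v by (auto simp: less_le_not_le)
    then show False using gen(1) C by (auto simp: circ_def)
  qed
  then have "alternating_deletion lt C \<in> frags (UNIV - {{}})"
    unfolding alternating_deletion_eq by (intro frags_sum frags_cmul) auto
  then show ?case by (auto simp: frags_def in_keys_iff)
next
  case (mul a y)
  have "M a y \<in> frags (UNIV - {{}})"
    by (rule frag_extend_frags[of _ UNIV])
      (auto simp: frags_def monomial_mult_atom)
  then show ?case by (auto simp: frags_def in_keys_iff)
qed (auto simp: lookup_minus)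

text \<open>For a circuit C and c in C the product of the two monomials is 0, so the Leibniz rule
  presents the monomial of C as \<open>M c\<close> applied to its relation. The remaining atoms are
  multiplied in.\<close>

lemma J_dependent:
  assumes I: "I \<subseteq> ats x" "r (js I) \<noteq> card I" shows "frag_of I \<in> J x"
proof -
  have Iat: "I \<subseteq> at" using I by auto
  then obtain C where C: "C \<subseteq> I" "circ C" "C \<noteq> {}" using ex_circ I(2) by blast
  then obtain c where c: "c \<in> C" by auto
  have m0: "monomial_mult lt {c} C = 0" using c by (simp add: monomial_mult_atom)
  have "C \<subseteq> at" "c \<in> at" using C c Iat by auto
  from leibniz_basis[OF this] have "frag_of C = M c (alternating_deletion lt C)" by (simp only: m0) simp
  moreover have "alternating_deletion lt C \<in> J x" using C I by (intro J.gen) auto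
  ultimately have "frag_of C \<in> J x" using J.mul[of c x] C c I by auto
  moreover have "finite D \<Longrightarrow> C \<inter> D = {} \<Longrightarrow> D \<subseteq> ats x \<Longrightarrow> frag_of (C \<union> D) \<in> J x" for D
  proof (induction D rule: finite_induct)
    case (insert a D)
    then have "a \<notin> C \<union> D" by auto
    from frag_of_insert[OF this] insert show ?case
      by (auto intro!: subgrp_cmul[OF subgrp_J] J.mul simp del: frag_extend_of)
  qed (use \<open>frag_of C \<in> J x\<close> in simp)
  from this[of "I - C"] have "frag_of (C \<union> (I - C)) \<in> J x" using I finite_atom_set[OF Iat] by auto
  then show ?thesis using C by (simp add: Un_absorb1)
qed

section \<open>The grading by flats\<close>

definition pr where "pr X = frag_extend (\<lambda>I. if js I = X then frag_of I else 0)"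

lemma pr_diff: "pr X (x - y) = pr X x - pr X y" by (simp add: pr_def frag_extend_diff)

text \<open>Generators are homogeneous by \<open>circ_js\<close>. The component at X lies even in
  the ideal generated by atoms below X, and not merely in that of x; this sharper form makes
  restriction maps and homotopies compatible with the relations.\<close>

lemma J_flat: "y \<in> J x \<Longrightarrow> X \<in> L \<Longrightarrow> pr X y \<in> J X"
proof (induction arbitrary: X rule: J.induct)
  case zero then show ?case by (simp add: pr_def J.zero)
next
  case (diff y z) then show ?case by (simp add: pr_diff J.diff)
next
  case (gen C)
  have Cat: "C \<subseteq> at" using gen by auto
  have CL: "C \<subseteq> L" using Cat atL by auto
  have "pr X (alternating_deletion lt C) = (if js C = X then alternating_deletion lt C else 0)"
    unfolding alternating_deletion_eq pr_def using finite_atom_set[OF Cat] circ_js[OF gen(1)]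
    by (simp add: frag_extend_sum frag_extend_cmul o_def)
  moreover have "alternating_deletion lt C \<in> J X" if "js C = X"
    using gen(1) Cat js_props(2)[OF CL] that by (intro J.gen) auto
  ultimately show ?case by (simp add: J.zero)
next
  case (mul a y)
  then have a: "a \<in> at" "a \<in> L" by (auto simp: atL)
  let ?S = "{Y \<in> L. jn a Y = X}"
  have fS: "finite ?S" using finite_L by simp
  have y: "y \<in> frags (Pow at)" using frags_ats[OF J_frags[OF mul(2)]] .
  \<comment> \<open>Multiplying by a sends the component of Y to that of its join with a, so several
    Y may contribute to X.\<close>
  have "pr X (M a y) = (\<Sum>Y\<in>?S. M a (pr Y y))"
  proof (rule frags_linear_eq[OF y, where f = "\<lambda>y. pr X (M a y)" and g = "\<lambda>y. \<Sum>Y\<in>?S. M a (pr Y y)"])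
    fix I assume "I \<in> Pow at"
    then have I: "I \<subseteq> L" using atL by auto
    have "pr X (M a (frag_of I)) = (if jn a (js I) = X then M a (frag_of I) else 0)"
      using js_insert[OF a(2) I] by (auto simp: pr_def monomial_mult_atom frag_extend_cmul)
    moreover have "(\<Sum>Y\<in>?S. M a (pr Y (frag_of I))) = (\<Sum>Y\<in>?S. if Y = js I then M a (frag_of I) else 0)"
      by (intro sum.cong) (auto simp: pr_def)
    moreover have "js I \<in> L" using js_props(1)[OF I] .
    ultimately show "pr X (M a (frag_of I)) = (\<Sum>Y\<in>?S. M a (pr Y (frag_of I)))" using fS by (simp add: sum.delta)
  qed (auto simp: frag_extend_diff pr_diff sum_subtractf)
  moreover have "M a (pr Y y) \<in> J X" if "Y \<in> ?S" for Y
  proof -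
    have "a \<in> at \<and> a \<le> X" using that jn_props(2)[of a Y] a by auto
    moreover have "pr Y y \<in> J X" using mul.IH[of Y] J_mono[of _ Y X] that jn_props(3)[of a Y] a by auto
    ultimately show ?thesis by (rule J.mul)
  qed
  ultimately show ?case using subgrp_sum[OF subgrp_J, of ?S "\<lambda>Y. M a (pr Y y)" X] by simp
qed

lemma pr_zero:
  assumes "y \<in> frags (Pow (ats x))" "\<not> (X \<in> L \<and> X \<le> x)" "x \<in> L" shows "pr X y = 0"
proof -
  have "js I \<in> L \<and> js I \<le> x" if "I \<subseteq> ats x" for I
  proof -
    have "I \<subseteq> L" using that atL by auto
    then show ?thesis using js_props(1,3)[of I] that assms by auto
  qed
  then have "pr X y = frag_extend (\<lambda>_. 0) y"
    unfolding pr_def using assms by (intro frag_extend_eq) (auto simp: frags_def)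
  then show ?thesis by simp
qed

definition restr where "restr x = frag_extend (\<lambda>I. if I \<subseteq> ats x then frag_of I else 0)"

text \<open>A set of atoms lies below x exactly if its span does, so restriction keeps whole flat
  components. With \<open>J_flat\<close> the structure maps become well defined.\<close>

lemma restr_eq_sum:
  assumes y: "y \<in> frags (Pow at)" and x: "x \<in> L"
  shows "restr x y = (\<Sum>X\<in>{X \<in> L. X \<le> x}. pr X y)"
  using y
proof (rule frags_linear_eq)
  fix I assume I: "I \<in> Pow at"
  then have IL: "I \<subseteq> L" using atL by auto
  have "I \<subseteq> ats x \<longleftrightarrow> js I \<le> x" using I js_le_iff[OF IL x] by auto
  moreover have "(\<Sum>X\<in>{X \<in> L. X \<le> x}. pr X (frag_of I)) = (\<Sum>X\<in>{X \<in> L. X \<le> x}. if X = js I then frag_of I else 0)"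
    by (intro sum.cong) (auto simp: pr_def)
  moreover have "finite {X \<in> L. X \<le> x}" using finite_L by simp
  ultimately show "restr x (frag_of I) = (\<Sum>X\<in>{X \<in> L. X \<le> x}. pr X (frag_of I))"
    using js_props(1)[OF IL] by (simp add: restr_def sum.delta)
qed (auto simp: restr_def frag_extend_diff pr_diff sum_subtractf)

lemma J_restr: "y \<in> J x \<Longrightarrow> x' \<in> L \<Longrightarrow> restr x' y \<in> J x'"
  by (subst restr_eq_sum[OF frags_ats[OF J_frags]])
     (auto intro!: subgrp_sum[OF subgrp_J] J_mono[OF J_flat])

definition fiber where "fiber X = {I. I \<subseteq> at \<and> js I = X \<and> card I = r X}"
text \<open>The absolute Whitney number of the first kind of the interval below X;
  \<open>free_rank_fiber\<close> shows that \<open>nat\<close> does not truncate.\<close>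

definition whitney where "whitney X = nat ((-1) ^ r X * mobius L bt X)"

lemma fiber_ats: "X \<in> L \<Longrightarrow> I \<in> fiber X \<Longrightarrow> I \<subseteq> ats X"
proof -
  assume "X \<in> L" "I \<in> fiber X"
  then show ?thesis using js_props(2)[of I] atL by (auto simp: fiber_def)
qed

text \<open>The piece of the algebra at the flat X is the same in every interval containing
  X.\<close>

lemma J_local:
  assumes "y \<in> frags {I. js I = X}" "X \<in> L" "X \<le> x" shows "y \<in> J x \<longleftrightarrow> y \<in> J X"
proof -
  have "pr X y = y" unfolding pr_def by (rule frag_extend_ident[OF _ assms(1)]) auto
  then show ?thesis using J_flat[of y x X] J_mono[of y X x] assms by auto
qed

text \<open>A set of n atoms spanning a flat of rank other than n is dependent, so in degree n only
  flats of rank n contribute.\<close>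

lemma free_rank_level:
  assumes x: "x \<in> L" and fr: "\<And>X. X \<in> L \<Longrightarrow> X \<le> x \<Longrightarrow> r X = n \<Longrightarrow> free_rank (frags (fiber X)) (J X) (whitney X)"
  shows "free_rank (frags {I. I \<subseteq> ats x \<and> card I = n}) (J x) (\<Sum>X\<in>{X \<in> L. X \<le> x}. if r X = n then whitney X else 0)"
proof (rule free_rank_direct_sum[where \<kappa> = "js"])
  show "finite {X \<in> L. X \<le> x}" using finite_L by simp
  fix I assume "I \<in> {I. I \<subseteq> ats x \<and> card I = n}"
  then have I: "I \<subseteq> ats x" "I \<subseteq> L" using atL by auto
  then show "js I \<in> {X \<in> L. X \<le> x}" using js_props(1,3)[OF I(2)] x by auto
next
  fix y X assume y: "y \<in> frags {I. I \<subseteq> ats x \<and> card I = n}" "y \<in> J x"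
  show "frag_extend (\<lambda>b. if js b = X then frag_of b else 0) y \<in> J x"
    using J_flat[OF y(2), of X] J_mono[of _ X x] pr_zero[OF J_frags[OF y(2)] _ x, of X]
    by (cases "X \<in> L \<and> X \<le> x") (auto simp: pr_def J.zero)
next
  fix X assume X: "X \<in> {X \<in> L. X \<le> x}"
  let ?F = "{b \<in> {I. I \<subseteq> ats x \<and> card I = n}. js b = X}"
  show "free_rank (frags ?F) (J x) (if r X = n then whitney X else 0)"
  proof (cases "r X = n")
    case True
    have "ats X \<subseteq> ats x" using X by (auto intro: order_trans)
    then have "I \<subseteq> ats x" if "I \<in> fiber X" for I
    proof -
      have "I \<subseteq> ats X" using fiber_ats[of X I] that X by simp
      then show ?thesis using \<open>ats X \<subseteq> ats x\<close> by (rule subset_trans)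
    qed
    then have "?F = fiber X" using True by (auto simp: fiber_def)
    moreover have "free_rank (frags (fiber X)) (J x) (whitney X)"
    proof (rule free_rank_cong[OF fr])
      fix y assume "y \<in> frags (fiber X)"
      then have "y \<in> frags {I. js I = X}" by (rule frags_mono[rotated]) (auto simp: fiber_def)
      then show "(y \<in> J X) = (y \<in> J x)" using J_local[of y X x] X by auto
    qed (use X True in auto)
    ultimately show ?thesis using True by simp
  next
    case False
    have "frags ?F \<subseteq> J x"
    proof
      fix y assume "y \<in> frags ?F"
      then show "y \<in> J x"
        by (induction rule: frags_induct) (use False in \<open>auto intro: J.zero J.diff intro!: J_dependent\<close>)
    qed
    then show ?thesis using False free_rank_0[OF subgrp_frags] by auto
  qed
qed (rule subgrp_J)

lemma free_rank_bot: "free_rank (frags (fiber bt)) (J bt) 1"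
proof -
  have e: "fiber bt = {{}}"
  proof -
    have "I = {}" if "I \<in> fiber bt" for I
      using that r_bt finite_atom_set[of I] by (auto simp: fiber_def)
    moreover have "{} \<in> fiber bt" by (auto simp: fiber_def r_bt js_empty)
    ultimately show ?thesis by blast
  qed
  have "y \<in> {0} \<longleftrightarrow> y \<in> J bt" if "y \<in> frags {{}}" for y
  proof -
    have "y = 0" if "y \<in> J bt"
      using J_empty_coeff[OF that] \<open>y \<in> frags {{}}\<close>
      by (intro poly_mapping_eqI) (metis (no_types, lifting) frags_def in_keys_iff lookup_zero mem_Collect_eq singletonD subset_iff)
    then show ?thesis by (auto simp: J.zero)
  qed
  then show ?thesis using free_rank_cong[OF free_rank_frags[of "{{}}"], of "J bt"] unfolding e by simp
qed

lemma whitney_bot: "whitney bt = 1"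
  using mobius_self[OF finite_L bt_least(1)] by (simp add: whitney_def r_bt)

text \<open>The sign of the Moebius value is proved together with the freeness: it is the sign of a
  rank, and the next step of the induction needs it to read \<open>whitney\<close> as an
  integer.\<close>

lemma free_rank_fiber:
  "X \<in> L \<Longrightarrow> free_rank (frags (fiber X)) (J X) (whitney X) \<and> (-1) ^ r X * mobius L bt X \<ge> 0"
proof (induction "r X" arbitrary: X rule: less_induct)
  case less
  show ?case
  proof (cases "X = bt")
    case True
    then show ?thesis using free_rank_bot whitney_bot mobius_self[OF finite_L bt_least(1)] by (simp add: r_bt)
  next
    case False
    note X = less.prems
    have bX: "bt < X" using False bt_least(2)[OF X] by (simp add: order_less_le)
    define N where "N = r X - 1"
    have rX: "r X = Suc N" using r_less[OF bt_least(1) X bX] by (simp add: N_def)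
    obtain a where a: "a \<in> at" "a \<le> X" using ex_atom[OF X bt_least(1)] bX by (auto simp: less_le_not_le)
    define E where "E n = frags {I. I \<subseteq> ats X \<and> card I = n}" for n
    define Z where "Z n = {x \<in> E n. n = 0 \<or> del x \<in> J X \<inter> E (n - 1)}" for n
    define c where "c n = (\<Sum>Y\<in>{Y \<in> L. Y \<le> X}. if r Y = n then whitney Y else 0)" for n
    have Eat: "x \<in> frags (Pow (ats X))" if "x \<in> E n" for x n
      using that unfolding E_def by (rule frags_mono[rotated]) auto
    have ME: "M a x \<in> E (Suc n)" if "x \<in> E n" for x n
      using that a unfolding E_def by (intro M_card) auto
    have DE: "del x \<in> E n" if "x \<in> E (Suc n)" for x n
      using that unfolding E_def by (intro del_card) auto
    have D0: "del x = 0" if "x \<in> E 0" for x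
    proof -
      have "x \<in> frags {{}}" using that unfolding E_def
        by (rule frags_mono[rotated]) (use finite_atom_set in \<open>auto simp: subset_iff\<close>)
      then show ?thesis by (induction rule: frags_induct) (auto simp: frag_extend_diff alternating_deletion_eq)
    qed
    have MJ: "M a x \<in> J X" if "x \<in> J X" for x using that a by (intro J.mul) auto
    have L: "x = M a (del x) + del (M a x)" if "x \<in> E n" for x n
      using leibniz[OF frags_ats[OF Eat[OF that]] a(1)] by (simp add: add.commute)
    \<comment> \<open>By the Leibniz rule the difference is \<open>M a (del x)\<close>, which
      belongs to the ideal as soon as \<open>del x\<close> does.\<close>
    have ex: "x - del (M a x) \<in> J X \<inter> E n" if x: "x \<in> E n" "n = 0 \<or> del x \<in> J X \<inter> E (n - 1)" for x n
    proof -
      have "x - del (M a x) = M a (del x)" using L[OF x(1)] by (simp add: diff_eq_eq)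
      moreover have "M a (del x) \<in> J X" using x D0 MJ J.zero by (cases "n = 0") auto
      moreover have "x - del (M a x) \<in> E n"
        using x(1) DE[OF ME[OF x(1)]] unfolding E_def by (rule frags_diff)
      ultimately show ?thesis by simp
    qed
    have JE: "subgrp (J X \<inter> E n)" for n
      unfolding E_def using subgrp_J[of X] subgrp_frags by (auto simp: subgrp_def)
    have "\<exists>k. free_rank (Z N) (J X \<inter> E N) k \<and> int k = (\<Sum>n\<le>N. (-1) ^ (N - n) * int (c n))"
    proof (rule free_rank_exact_complex[where E = E and J = "\<lambda>n. J X \<inter> E n" and d = del])
      fix n assume n: "n \<le> N"
      have "free_rank (E n) (J X) (c n)"
        unfolding E_def c_def
        by (rule free_rank_level[OF X]) (use less.hyps n rX in auto)
      then show "free_rank (E n) (J X \<inter> E n) (c n)" by (rule free_rank_cong) auto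
    next
      fix n x assume "n < N" "x \<in> E n" "n = 0 \<or> del x \<in> J X \<inter> E (n - 1)"
      then show "\<exists>y\<in>E (Suc n). x - del y \<in> J X \<inter> E n" using ex ME by blast
    next
      show "subgrp (E n)" for n unfolding E_def by (rule subgrp_frags)
      show "del (del x) \<in> J X \<inter> E n" if "x \<in> E (Suc (Suc n))" for n x
        using del_del[OF frags_ats[OF Eat[OF that]]] by (simp add: J.zero E_def frags_0)
    qed (auto simp: frag_extend_diff DE J_del JE Z_def)
    then obtain k where k: "free_rank (Z N) (J X \<inter> E N) k" "int k = (\<Sum>n\<le>N. (-1) ^ (N - n) * int (c n))" by blast
    \<comment> \<open>\<open>del\<close> identifies degree N + 1 with the cycles of degree N. For
      injectivity \<open>M a x\<close> has to be in the ideal: N + 2 atoms below a flat of rank N +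
      1 are dependent.\<close>
    have top: "free_rank (E (Suc N)) (J X) k"
    proof (rule free_rank_transfer[OF k(1), of _ del])
      fix x assume x: "x \<in> E (Suc N)"
      show "del x \<in> Z N"
        using DE[OF x] del_del[OF frags_ats[OF Eat[OF x]]]
        by (auto simp: Z_def J.zero E_def frags_0)
      have "M a x \<in> J X"
      proof -
        have "y \<in> J X" if "y \<in> frags {I. I \<subseteq> ats X \<and> card I = Suc (Suc N)}" for y
          using that
        proof (induction rule: frags_induct)
          case (one I)
          then have I: "I \<subseteq> L" "I \<subseteq> ats X" "card I = Suc (Suc N)" using atL by auto
          have "r (js I) \<le> r X" using js_props[OF I(1)] I(2) X by (intro r_le) auto
          then show ?case using I rX by (intro J_dependent) auto
        qed (auto intro: J.intros)
        then show ?thesis using ME[OF x] by (simp add: E_def)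
      qed
      then have "M a (del x) + del (M a x) \<in> J X" if "del x \<in> J X"
        using subgrp_add[OF subgrp_J MJ[OF that] J_del[of "M a x" X]] by blast
      then have "del x \<in> J X \<Longrightarrow> x \<in> J X" using L[OF x] by simp
      then show "(del x \<in> J X \<inter> E N) = (x \<in> J X)" using J_del[of x X] DE[OF x] by auto
    next
      fix y assume "y \<in> Z N"
      then have "y \<in> E N" "y - del (M a y) \<in> J X \<inter> E N" using ex[of y N] by (auto simp: Z_def)
      then show "\<exists>x\<in>E (Suc N). y - del x \<in> J X \<inter> E N" using ME by blast
    next
      show "subgrp (Z N)"
        unfolding subgrp_def Z_def using frags_0 frags_diff JE[of "N - 1"]
        by (auto simp: E_def frag_extend_diff J.zero J.diff)
    qed auto
    \<comment> \<open>Monomials of degree N + 1 with a smaller span are dependent, so modulo the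
      ideal \<open>fiber X\<close> is all that is left of the top degree.\<close>
    have "free_rank (frags (fiber X)) (J X) k"
    proof (rule free_rank_transfer[OF top, of _ "\<lambda>x. x"])
      have sub: "fiber X \<subseteq> {I. I \<subseteq> ats X \<and> card I = Suc N}"
        using fiber_ats[OF X] rX by (auto simp: fiber_def)
      show "x \<in> E (Suc N)" if "x \<in> frags (fiber X)" for x
        using that sub unfolding E_def by (auto intro: frags_mono)
      fix y assume "y \<in> E (Suc N)"
      then have "pr X y \<in> frags (fiber X) \<and> y - pr X y \<in> J X" unfolding E_def
      proof (induction rule: frags_induct)
        case (one I)
        then have I: "I \<subseteq> L" "I \<subseteq> at" "I \<subseteq> ats X" "card I = Suc N" using atL by auto
        show ?case
        proof (cases "js I = X")
          case True
          then show ?thesis using I rX by (auto simp: pr_def fiber_def J.zero)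
        next
          case False
          have "js I \<le> X" unfolding js_le_iff[OF I(1) X] using I(3) by auto
          with False have "r (js I) \<noteq> card I"
            using r_eq[of "js I" X] js_props(1)[OF I(1)] I(4) X rX by auto
          then show ?thesis using False I(3) by (auto simp: pr_def frags_0 intro!: J_dependent)
        qed
      next
        case (diff x y)
        have "x - y - pr X (x - y) = (x - pr X x) - (y - pr X y)" by (simp add: pr_diff)
        then have "x - y - pr X (x - y) \<in> J X" using diff by (simp only:) (auto intro: J.diff)
        moreover have "pr X (x - y) \<in> frags (fiber X)"
          unfolding pr_diff using diff by (auto intro: frags_diff)
        ultimately show ?case by blast
      qed (auto simp: pr_def J.zero frags_0)
      then show "\<exists>x\<in>frags (fiber X). y - x \<in> J X" by blast
    qed (auto simp: additive_on_def E_def subgrp_frags)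
    \<comment> \<open>The sign (-1)^(N - n) of the Euler characteristic and the sign (-1)^n of the
      Whitney numbers combine to (-1)^N. What remains is the sum of Moebius values below X, the
      negative of the value at X.\<close>
    moreover have ik: "int k = (-1) ^ r X * mobius L bt X"
    proof -
      let ?D = "{Y \<in> L. Y \<le> X}"
      let ?f = "\<lambda>Y. (-1) ^ N * mobius L bt Y"
      have fD: "finite ?D" using finite_L by simp
      have w: "int (whitney Y) = (-1) ^ r Y * mobius L bt Y" if "Y \<in> L" "Y \<le> X" "r Y \<le> N" for Y
        using less.hyps[of Y] that rX by (simp add: whitney_def)
      have "int k = (\<Sum>n\<le>N. \<Sum>Y\<in>?D. if r Y = n then ?f Y else 0)"
        unfolding k(2)
      proof (rule sum.cong[OF refl])
        fix n assume n: "n \<in> {..N}"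
        have "(-1) ^ (N - n) * int (c n) = (\<Sum>Y\<in>?D. (-1) ^ (N - n) * (if r Y = n then int (whitney Y) else 0))"
          by (simp add: c_def sum_distrib_left if_distrib cong: if_cong)
        also have "\<dots> = (\<Sum>Y\<in>?D. if r Y = n then ?f Y else 0)"
        proof (rule sum.cong[OF refl])
          fix Y assume Y: "Y \<in> ?D"
          have "(-1::int) ^ (N - n) * (-1) ^ n = (-1) ^ N" using n by (simp flip: power_add)
          then show "(-1) ^ (N - n) * (if r Y = n then int (whitney Y) else 0) = (if r Y = n then ?f Y else 0)"
            using w[of Y] Y n by (auto simp flip: mult.assoc)
        qed
        finally show "(-1) ^ (N - n) * int (c n) = (\<Sum>Y\<in>?D. if r Y = n then ?f Y else 0)" .
      qed
      also have "\<dots> = (\<Sum>Y\<in>?D. \<Sum>n\<le>N. if r Y = n then ?f Y else 0)" by (rule sum.swap)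
      also have "\<dots> = (\<Sum>Y\<in>?D. if r Y \<le> N then ?f Y else 0)"
        by (intro sum.cong refl) (simp add: sum.delta)
      also have "\<dots> = (\<Sum>Y\<in>{Y \<in> L. bt \<le> Y \<and> Y < X}. ?f Y)"
      proof (rule sum.mono_neutral_cong_right[OF fD])
        show "\<forall>Y\<in>?D - {Y \<in> L. bt \<le> Y \<and> Y < X}. (if r Y \<le> N then ?f Y else 0) = 0"
        proof
          fix Y assume "Y \<in> ?D - {Y \<in> L. bt \<le> Y \<and> Y < X}"
          then have "Y = X" using bt_least(2)[of Y] by (cases "Y = X") (auto simp: order_le_less)
          then show "(if r Y \<le> N then ?f Y else 0) = 0" using rX by simp
        qed
        fix Y assume "Y \<in> {Y \<in> L. bt \<le> Y \<and> Y < X}"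
        then show "(if r Y \<le> N then ?f Y else 0) = ?f Y" using r_less[of Y X] X rX by simp
      qed (simp add: subset_iff order_less_imp_le)
      also have "\<dots> = (-1) ^ N * (- mobius L bt X)"
        using mobius_less[OF finite_L bt_least(1) X bX] by (simp add: sum_distrib_left)
      finally show ?thesis by (simp add: rX)
    qed
    then have "whitney X = k" "(-1) ^ r X * mobius L bt X \<ge> 0" by (simp_all add: whitney_def flip: ik)
    ultimately show ?thesis by simp
  qed
qed

end


section \<open>Orlik--Solomon groups\<close>

lemma comm_group_image:
  assumes E: "subgrp E" and c: "carrier G = q ` E" and o: "\<one>\<^bsub>G\<^esub> = q 0"
    and m: "\<And>x y. x \<in> E \<Longrightarrow> y \<in> E \<Longrightarrow> q x \<otimes>\<^bsub>G\<^esub> q y = q (x + y)"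
  shows "comm_group G"
proof (rule comm_groupI)
  fix x y assume "x \<in> carrier G" "y \<in> carrier G"
  then obtain a b where ab: "a \<in> E" "b \<in> E" "x = q a" "y = q b" using c by auto
  then show "x \<otimes>\<^bsub>G\<^esub> y \<in> carrier G" using m c subgrp_add[OF E] by auto
  show "x \<otimes>\<^bsub>G\<^esub> y = y \<otimes>\<^bsub>G\<^esub> x" using ab m by (simp add: add.commute)
  fix z assume "z \<in> carrier G"
  then obtain d where "d \<in> E" "z = q d" using c by auto
  then show "x \<otimes>\<^bsub>G\<^esub> y \<otimes>\<^bsub>G\<^esub> z = x \<otimes>\<^bsub>G\<^esub> (y \<otimes>\<^bsub>G\<^esub> z)"
    using ab by (simp add: m subgrp_add[OF E] add.assoc)
next
  fix x assume "x \<in> carrier G"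
  then obtain a where a: "a \<in> E" "x = q a" using c by auto
  then show "\<one>\<^bsub>G\<^esub> \<otimes>\<^bsub>G\<^esub> x = x" using o m subgrp_0[OF E] by simp
  have "q (- a) \<otimes>\<^bsub>G\<^esub> x = \<one>\<^bsub>G\<^esub>" using a m subgrp_uminus[OF E] o by simp
  then show "\<exists>y\<in>carrier G. y \<otimes>\<^bsub>G\<^esub> x = \<one>\<^bsub>G\<^esub>" using a subgrp_uminus[OF E] c by blast
qed (use c o subgrp_0[OF E] in auto)

text \<open>\<open>q\<close> presents the subgroup Z by E, and J is the preimage of N, so E modulo J
  is Z modulo N. Z is a subgroup because it is an image.\<close>

lemma quotient_free_abelian:
  assumes G: "comm_group G" and E: "subgrp E" and Z: "q ` E = Z" "Z \<subseteq> carrier G"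
    and q: "\<And>x y. x \<in> E \<Longrightarrow> y \<in> E \<Longrightarrow> q (x + y) = q x \<otimes>\<^bsub>G\<^esub> q y"
    and N: "subgroup N G" "N \<subseteq> Z" "\<And>x. x \<in> E \<Longrightarrow> q x \<in> N \<longleftrightarrow> x \<in> J"
    and n: "free_rank E J n"
  shows "free_abelian_of_rank (G\<lparr>carrier := Z\<rparr> Mod N) (int n)"
proof -
  interpret G: comm_group G by fact
  have qG: "q x \<in> carrier G" if "x \<in> E" for x using Z that by auto
  have "q 0 \<otimes>\<^bsub>G\<^esub> q 0 = q 0" using q[of 0 0] subgrp_0[OF E] by simp
  then have q0: "q 0 = \<one>\<^bsub>G\<^esub>" using G.l_cancel_one'[of "q 0" "q 0"] qG[OF subgrp_0[OF E]] by simp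
  let ?G = "G\<lparr>carrier := Z\<rparr>"
  have cg: "comm_group ?G"
    by (rule comm_group_image[OF E, of _ q]) (use Z q q0 in auto)
  then interpret G': comm_group ?G .
  have "subgroup Z G" by (rule G.group_incl_imp_subgroup[OF Z(2)]) (rule G'.is_group)
  then have "subgroup N ?G" using N by (intro G.subgroup_incl)
  then have nN: "N \<lhd> ?G" by (simp add: G'.normal_iff_subgroup)
  then interpret N: normal N ?G .
  show ?thesis
  proof (rule free_abelian_of_frk[OF E n N.factorgroup_is_group, of "\<lambda>x. N #>\<^bsub>?G\<^esub> q x"])
    fix x y assume xy: "x \<in> E" "y \<in> E"
    then have "q x \<in> carrier ?G" "q y \<in> carrier ?G" using Z by auto
    then show "N #>\<^bsub>?G\<^esub> q (x + y) = (N #>\<^bsub>?G\<^esub> q x) \<otimes>\<^bsub>?G Mod N\<^esub> (N #>\<^bsub>?G\<^esub> q y)"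
      using N.rcos_sum[of "q x" "q y"] q[OF xy] by (simp add: FactGroup_def)
  next
    show "(\<lambda>x. N #>\<^bsub>?G\<^esub> q x) ` E = carrier (?G Mod N)"
      using Z by (auto simp: FactGroup_def RCOSETS_def)
  next
    fix x assume x: "x \<in> E"
    then have "q x \<in> carrier ?G" using Z by auto
    then have "N #>\<^bsub>?G\<^esub> q x = N \<longleftrightarrow> q x \<in> N"
      using G'.coset_join1[OF _ _ \<open>subgroup N ?G\<close>] G'.coset_join2[OF _ \<open>subgroup N ?G\<close>] N.subset by blast
    then show "N #>\<^bsub>?G\<^esub> q x = \<one>\<^bsub>?G Mod N\<^esub> \<longleftrightarrow> x \<in> J" using N(3)[OF x] by (simp add: FactGroup_def)
  qed
qed

lemma free_abelian_rank_0_trivial: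
  assumes "free_abelian_of_rank G 0" shows "trivial_group G"
proof -
  have G: "group G" "G \<cong> free_Abelian_group {..<0::nat}"
    using assms by (auto simp: free_abelian_of_rank_def comm_group_def)
  have "trivial_group (free_Abelian_group {..<0::nat})"
    by (auto simp: trivial_group_def)
  then show ?thesis using isomorphic_group_triviality[OF G(2) G(1)] by simp
qed

context orlik_solomon
begin

section \<open>The Orlik-Solomon groups as quotients of exterior powers\<close>

definition lev where "lev p x = {I. I \<subseteq> ats x \<and> card I = p}"

lemma atoms_down': "x \<in> L \<Longrightarrow> atoms (down_set L x) = ats x" by (simp add: atoms_down)

lemma Fpow_ats: "Fpow (ats x) = Pow (ats x)"
  using finite_atom_set by (auto simp: Fpow_def)

lemma exterior_power_ats: "exterior_power p (ats x) = frags (lev p x)"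
  by (simp add: exterior_power_def frags_def lev_def Fpow_ats)

abbreviation EA where "EA x \<equiv> exterior_algebra lt (ats x)"

lemma EA_simps: "carrier (EA x) = frags (Pow (ats x))" "(\<otimes>\<^bsub>EA x\<^esub>) = ext_mult lt" "(\<oplus>\<^bsub>EA x\<^esub>) = (+)" "\<zero>\<^bsub>EA x\<^esub> = 0"
  by (auto simp: exterior_algebra_def frags_def Fpow_ats)

lemma monomial_anticommute:
  assumes I: "I \<subseteq> at" and a: "a \<in> at"
  shows "monomial_mult lt I {a} = frag_cmul ((-1) ^ card I) (monomial_mult lt {a} I)"
proof (cases "a \<in> I")
  case True then show ?thesis by (auto simp: monomial_mult_def)
next
  case False
  have "card {(i, j). i \<in> I \<and> j \<in> {a} \<and> lt j i} = card {i \<in> I. lt a i}"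
    by (rule bij_betw_same_card[of fst]) (auto simp: bij_betw_def inj_on_def image_iff)
  moreover have "card I = pos I a + card {i \<in> I. lt a i}"
  proof -
    have "I = {i \<in> I. lt i a} \<union> {i \<in> I. lt a i}" using lt_total[OF a] False I by blast
    moreover have "{i \<in> I. lt i a} \<inter> {i \<in> I. lt a i} = {}" using lt_total[OF a] False I by blast
    ultimately show ?thesis using finite_atom_set[OF I] card_Un_disjoint[of "{i \<in> I. lt i a}" "{i \<in> I. lt a i}"]
      by (auto simp: pos_def)
  qed
  moreover have sg: "(-1::int) ^ k * b * (-1) ^ k = b" for k b by (cases "even k") auto
  ultimately show ?thesis using False
    by (simp add: monomial_mult_atom) (simp add: monomial_mult_def power_add sg)
qed

lemma ext_mult_cmul: "ext_mult lt (frag_cmul c y) z = frag_cmul c (ext_mult lt y z)"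
  "ext_mult lt y (frag_cmul c z) = frag_cmul c (ext_mult lt y z)"
  by (simp_all add: frag_extend_cmul frag_extend_cmulfun)

lemma ext_mult_atom_right:
  assumes "y \<in> frags {I. I \<subseteq> at \<and> card I = n}" "a \<in> at"
  shows "ext_mult lt y (frag_of {a}) = frag_cmul ((-1) ^ n) (M a y)"
  using assms(1)
  by (induction rule: frags_induct)
     (auto simp: frag_extend_diff frag_cmul_diff2 monomial_anticommute[OF _ assms(2)])

lemma keys_Fpow: "y \<in> frags (Pow at) \<Longrightarrow> Poly_Mapping.keys y \<subseteq> Fpow at"
  using finite_atom_set by (auto simp: frags_def Fpow_def)

lemma J_keys: "y \<in> J x \<Longrightarrow> Poly_Mapping.keys y \<subseteq> Fpow at"
  by (rule keys_Fpow[OF frags_ats[OF J_frags]])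

lemma keys_monomial: "I \<subseteq> at \<Longrightarrow> Poly_Mapping.keys (frag_of I) \<subseteq> Fpow at"
  by (rule keys_Fpow) simp

text \<open>Closure of \<open>J\<close> is built in for left multiplication only. Moving an atom to
  the other side costs a sign that depends on the degree; the generators are homogeneous, and
  associativity carries the property through left multiples.\<close>

lemma J_right_atom: "y \<in> J x \<Longrightarrow> a \<in> ats x \<Longrightarrow> ext_mult lt y (frag_of {a}) \<in> J x"
proof (induction rule: J.induct)
  case zero then show ?case by (simp add: J.zero)
next
  case (diff y z) then show ?case using J.diff by (simp only: ext_mult_diff_left)
next
  case (gen C)
  then have C: "C \<subseteq> at" by auto
  have "alternating_deletion lt C \<in> frags {I. I \<subseteq> at \<and> card I = card C - 1}"
    unfolding alternating_deletion_eq using C finite_atom_set[OF C]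
    by (intro frags_sum frags_cmul) auto
  from ext_mult_atom_right[OF this, of a] gen
  have "ext_mult lt (alternating_deletion lt C) (frag_of {a}) =
      frag_cmul ((-1) ^ (card C - 1)) (M a (alternating_deletion lt C))" by blast
  then show ?case using gen J.gen[of C x] J.mul[of a x] by (simp only:) (auto intro: subgrp_cmul[OF subgrp_J])
next
  case (mul b y)
  then have "{b} \<subseteq> at" "{a} \<subseteq> at" by auto
  from ext_mult_assoc[OF keys_monomial[OF this(1)] J_keys[OF mul(2)] keys_monomial[OF this(2)], of lt]
  have "ext_mult lt (M b y) (frag_of {a}) = M b (ext_mult lt y (frag_of {a}))" by simp
  moreover have "M b (ext_mult lt y (frag_of {a})) \<in> J x" using mul by (intro J.mul) auto
  ultimately show ?case by (simp only:)
qed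

lemma J_left: "I \<subseteq> ats x \<Longrightarrow> y \<in> J x \<Longrightarrow> ext_mult lt (frag_of I) y \<in> J x"
proof -
  assume I: "I \<subseteq> ats x" and y: "y \<in> J x"
  then have "finite I" using finite_atom_set[of I] by auto
  then show ?thesis using I
  proof (induction I)
    case empty then show ?case using y by (simp only: ext_mult_one_left)
  next
    case (insert a I)
    then have "{a} \<subseteq> at" "I \<subseteq> at" by auto
    from ext_mult_assoc[OF keys_monomial[OF this(1)] keys_monomial[OF this(2)] J_keys[OF y], of lt]
    have "ext_mult lt (M a (frag_of I)) y = M a (ext_mult lt (frag_of I) y)" by simp
    moreover have "M a (ext_mult lt (frag_of I) y) \<in> J x" using insert by (intro J.mul) auto
    ultimately show ?case
      unfolding frag_of_insert[OF insert.hyps(2)] ext_mult_cmul by (simp only: subgrp_cmul[OF subgrp_J])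
  qed
qed

lemma J_right: "I \<subseteq> ats x \<Longrightarrow> y \<in> J x \<Longrightarrow> ext_mult lt y (frag_of I) \<in> J x"
proof -
  assume I: "I \<subseteq> ats x" and y: "y \<in> J x"
  then have "finite I" using finite_atom_set[of I] by auto
  then show ?thesis using I y
  proof (induction I arbitrary: y)
    case empty then show ?case by (simp only: ext_mult_one_right)
  next
    case (insert a I)
    then have "{a} \<subseteq> at" "I \<subseteq> at" by auto
    from ext_mult_assoc[OF J_keys[OF insert.prems(2)] keys_monomial[OF this(1)] keys_monomial[OF this(2)], of lt]
    have "ext_mult lt y (M a (frag_of I)) = ext_mult lt (ext_mult lt y (frag_of {a})) (frag_of I)" by simp
    moreover have "\<dots> \<in> J x" using insert J_right_atom by simp
    ultimately show ?case
      unfolding frag_of_insert[OF insert.hyps(2)] ext_mult_cmul by (simp only: subgrp_cmul[OF subgrp_J])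
  qed
qed

lemma ideal_J: "ideal (J x) (EA x)"
proof (rule idealI)
  show "ring (EA x)" by (rule ring_exterior_algebra)
  then interpret ring "EA x" .
  show "subgroup (J x) (add_monoid (EA x))"
  proof (rule group.subgroupI[OF a_group])
    show "J x \<subseteq> carrier (add_monoid (EA x))" using J_frags by (auto simp: EA_simps)
    fix y z assume y: "y \<in> J x"
    have "\<ominus>\<^bsub>EA x\<^esub> y = - y"
      using y J_frags[OF y] frags_uminus[of y "Pow (ats x)"] by (intro minus_equality) (auto simp: EA_simps)
    then show "inv\<^bsub>add_monoid (EA x)\<^esub> y \<in> J x"
      using subgrp_uminus[OF subgrp_J y] by (simp add: a_inv_def)
    assume "z \<in> J x"
    then show "y \<otimes>\<^bsub>add_monoid (EA x)\<^esub> z \<in> J x"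
      using subgrp_add[OF subgrp_J y] by (simp add: EA_simps)
  qed (use J.zero in auto)
  fix y z assume y: "y \<in> J x" and z: "z \<in> carrier (EA x)"
  have z: "z \<in> frags (Pow (ats x))" using z by (simp add: EA_simps)
  then show "z \<otimes>\<^bsub>EA x\<^esub> y \<in> J x" unfolding EA_simps
  proof (induction rule: frags_induct)
    case (diff u v) then show ?case using J.diff by (simp only: ext_mult_diff_left)
  next
    case (one I) then show ?case using J_left[OF _ y] by blast
  qed (simp add: J.zero)
  show "y \<otimes>\<^bsub>EA x\<^esub> z \<in> J x" unfolding EA_simps using z
  proof (induction rule: frags_induct)
    case (diff u v) then show ?case using J.diff by (simp only: ext_mult_diff_right)
  next
    case (one I) then show ?case using J_right[OF _ y] by blast
  qed (simp add: J.zero)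
qed

text \<open>One inclusion is minimality of the generated ideal, the other an induction over
  \<open>J\<close>, whose rules hold in every ideal containing the generators.\<close>

lemma OS_ideal_eq: "x \<in> L \<Longrightarrow> OS_ideal lt (down_set L x) = J x"
proof -
  assume x: "x \<in> L"
  interpret ring "EA x" by (rule ring_exterior_algebra)
  let ?S = "{alternating_deletion lt I | I. circuit (down_set L x) I}"
  have S: "?S = {alternating_deletion lt I | I. circ I \<and> I \<subseteq> ats x}"
  proof -
    have "circuit (down_set L x) I \<longleftrightarrow> circ I \<and> I \<subseteq> ats x" for I
      unfolding circuit_down[OF x] circ_def by blast
    then show ?thesis by simp
  qed
  have SJ: "?S \<subseteq> J x"
  proof
    fix y assume "y \<in> ?S"
    then obtain I where "y = alternating_deletion lt I" "circ I" "I \<subseteq> ats x" unfolding S by blast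
    then show "y \<in> J x" by (simp add: J.gen)
  qed
  have SR: "?S \<subseteq> carrier (EA x)"
    unfolding EA_simps using SJ J_frags by (rule subset_trans[OF _ subsetI])
  have eq: "OS_ideal lt (down_set L x) = Idl\<^bsub>EA x\<^esub> ?S" by (simp add: OS_ideal_def atoms_down'[OF x])
  have "Idl\<^bsub>EA x\<^esub> ?S \<subseteq> J x" by (rule genideal_minimal[OF ideal_J SJ])
  moreover have "J x \<subseteq> Idl\<^bsub>EA x\<^esub> ?S"
  proof
    interpret I: ideal "Idl\<^bsub>EA x\<^esub> ?S" "EA x" by (rule genideal_ideal[OF SR])
    fix y assume "y \<in> J x"
    then show "y \<in> Idl\<^bsub>EA x\<^esub> ?S"
    proof (induction rule: J.induct)
      case zero then show ?case using I.zero_closed by (simp add: EA_simps)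
    next
      case (diff y z)
      have zc: "z \<in> frags (Pow (ats x))" using I.Icarr[OF diff(4)] by (simp add: EA_simps)
      then have "\<ominus>\<^bsub>EA x\<^esub> z = - z"
        using frags_uminus[of z "Pow (ats x)"] by (intro minus_equality) (auto simp: EA_simps)
      then show ?case using I.a_closed[OF diff(3) I.a_inv_closed[OF diff(4)]] by (simp add: EA_simps)
    next
      case (gen C)
      then have "alternating_deletion lt C \<in> ?S" unfolding S by blast
      then show ?case by (rule subsetD[OF genideal_self[OF SR]])
    next
      case (mul a y)
      then show ?case using I.I_l_closed[of y "frag_of {a}"] by (simp add: EA_simps)
    qed
  qed
  ultimately show ?thesis unfolding eq by (rule subset_antisym)
qed

definition q where "q x y = OS_class lt (down_set L x) y"

lemma q_eq: "x \<in> L \<Longrightarrow> q x y = (\<lambda>j. j + y) ` J x"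
  by (auto simp: q_def OS_ideal_eq atoms_down' a_r_coset_def r_coset_def exterior_algebra_def)

lemma q_eq_iff: "x \<in> L \<Longrightarrow> q x y = q x z \<longleftrightarrow> y - z \<in> J x"
proof
  assume x: "x \<in> L" and "q x y = q x z"
  then have "0 + y \<in> (\<lambda>j. j + z) ` J x" using J.zero by (auto simp: q_eq)
  then show "y - z \<in> J x" by (auto simp: algebra_simps)
next
  assume x: "x \<in> L" and yz: "y - z \<in> J x"
  have sub: "(\<lambda>j. j + y) ` J x \<subseteq> (\<lambda>j. j + z) ` J x" if "y - z \<in> J x" for y z
  proof
    fix w assume "w \<in> (\<lambda>j. j + y) ` J x"
    then obtain j where j: "j \<in> J x" "w = j + y" by blast
    show "w \<in> (\<lambda>j. j + z) ` J x"
      by (rule image_eqI[of _ _ "j + (y - z)"]) (simp_all add: j subgrp_add[OF subgrp_J j(1) that])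
  qed
  show "q x y = q x z"
    unfolding q_eq[OF x]
    by (intro equalityI sub yz) (use subgrp_uminus[OF subgrp_J yz] in simp)
qed

lemma OS_simps:
  assumes x: "x \<in> L"
  shows "carrier (OS lt p (down_set L x)) = q x ` frags (lev p x)" "\<one>\<^bsub>OS lt p (down_set L x)\<^esub> = q x 0"
    "y \<in> frags (lev p x) \<Longrightarrow> z \<in> frags (lev p x) \<Longrightarrow> q x y \<otimes>\<^bsub>OS lt p (down_set L x)\<^esub> q x z = q x (y + z)"
proof -
  show "carrier (OS lt p (down_set L x)) = q x ` frags (lev p x)"
    by (simp add: OS_def q_def atoms_down'[OF x] exterior_power_ats)
  interpret ideal "J x" "EA x" by (rule ideal_J)
  have "q x 0 = J x" by (simp add: q_eq[OF x])
  then show "\<one>\<^bsub>OS lt p (down_set L x)\<^esub> = q x 0"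
    by (simp add: OS_def OS_algebra_def atoms_down'[OF x] OS_ideal_eq[OF x] FactRing_def)
  have sub: "frags (lev p x) \<subseteq> carrier (EA x)"
    unfolding EA_simps by (intro subsetI, rule frags_mono[rotated]) (auto simp: lev_def)
  show "q x y \<otimes>\<^bsub>OS lt p (down_set L x)\<^esub> q x z = q x (y + z)" if "y \<in> frags (lev p x)" "z \<in> frags (lev p x)"
    using a_rcos_sum[of y z] that sub
    by (auto simp: OS_def OS_algebra_def q_def atoms_down'[OF x] OS_ideal_eq[OF x] FactRing_def EA_simps)
qed

lemma comm_group_OS: "x \<in> L \<Longrightarrow> comm_group (OS lt p (down_set L x))"
  by (rule comm_group_image[OF subgrp_frags, of _ "q x" "lev p x"]) (simp_all add: OS_simps)

lemma free_rank_lev: "x \<in> L \<Longrightarrow> free_rank (frags (lev p x)) (J x) (\<Sum>X\<in>{X \<in> L. X \<le> x}. if r X = p then whitney X else 0)"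
  unfolding lev_def by (rule free_rank_level) (use free_rank_fiber in auto)

text \<open>Among the flats below z only z itself has rank p, so the whole degree p part is the
  single piece at z.\<close>

lemma free_OS:
  assumes z: "z \<in> rank_level L p"
  shows "free_abelian_of_rank (OS lt p (down_set L z)) ((-1) ^ poset_rank L z * mobius L bt z)"
proof -
  have zL: "z \<in> L" "r z = p" using z by (auto simp: rank_level_def r_def)
  have "free_rank (frags (lev p z)) (J z) (whitney z)"
  proof -
    have "(\<Sum>X\<in>{X \<in> L. X \<le> z}. if r X = p then whitney X else 0) = (\<Sum>X\<in>{X \<in> L. X \<le> z}. if X = z then whitney X else 0)"
      using r_eq[OF _ zL(1)] zL(2) by (intro sum.cong) auto
    also have "\<dots> = whitney z" using zL finite_L by (simp add: sum.delta')
    finally show ?thesis using free_rank_lev[OF zL(1), of p] by simp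
  qed
  from free_abelian_of_frk[OF subgrp_frags this, of "OS lt p (down_set L z)" "q z"]
  have "free_abelian_of_rank (OS lt p (down_set L z)) (int (whitney z))"
    using comm_group_OS[OF zL(1), of p] OS_simps[OF zL(1)] q_eq_iff[OF zL(1), of _ 0]
    by (auto simp: comm_group_def)
  moreover have "int (whitney z) = (-1) ^ poset_rank L z * mobius L bt z"
    using free_rank_fiber[OF zL(1)] by (simp add: whitney_def r_def)
  ultimately show ?thesis by simp
qed

text \<open>\<open>the_elem\<close> is legitimate because restriction maps the ideal at y into the
  ideal at x, so that a whole coset yields one class.\<close>

lemma OS_restriction_q:
  assumes x: "x \<in> L" and y: "y \<in> L" and w: "w \<in> frags (lev p y)"
  shows "OS_restriction lt (down_set L x) (q y w) = q x (restr x w)"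
proof -
  have "(\<lambda>z. OS_class lt (down_set L x) (frag_extend (\<lambda>I. if I \<subseteq> atoms (down_set L x) then frag_of I else 0) z)) ` q y w
     = (\<lambda>z. q x (restr x z)) ` q y w"
    by (simp add: q_def restr_def atoms_down'[OF x])
  also have "\<dots> = {q x (restr x w)}"
  proof -
    have "q x (restr x (j + w)) = q x (restr x w)" if "j \<in> J y" for j
      unfolding q_eq_iff[OF x] using J_restr[OF that x] by (simp add: restr_def frag_extend_add)
    moreover have "J y \<noteq> {}" using J.zero by blast
    ultimately show ?thesis unfolding q_eq[OF y] by auto
  qed
  finally show ?thesis by (simp add: OS_restriction_def)
qed

end


section \<open>The Orlik--Solomon sheaf\<close>

lemma rel_proj_diff: "rel_proj Q (x - y) = rel_proj Q x - rel_proj Q y"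
  by (simp add: rel_proj_def frag_extend_diff)

text \<open>Chains inside Q form a subcomplex, so discarding them before taking the boundary changes
  nothing modulo Q.\<close>

lemma rel_proj_Bd: "rel_proj Q (Bd (rel_proj Q c)) = rel_proj Q (Bd c)" if "c \<in> frags (chains P n)"
  using that
proof (rule frags_linear_eq[where f = "\<lambda>c. rel_proj Q (Bd (rel_proj Q c))" and g = "\<lambda>c. rel_proj Q (Bd c)"])
  fix s assume s: "s \<in> chains P n"
  show "rel_proj Q (Bd (rel_proj Q (frag_of s))) = rel_proj Q (Bd (frag_of s))"
  proof (cases "set s \<subseteq> Q")
    case True
    then have "s \<in> chains Q n" using s by (auto simp: chains_def)
    from bd_chains[OF this] have "rel_proj Q (bd s) = 0"
      by (induction rule: frags_induct) (auto simp: rel_proj_def frag_extend_diff chains_def)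
    then show ?thesis using True by (simp add: rel_proj_def)
  qed (simp add: rel_proj_def)
qed (auto simp: rel_proj_diff frag_extend_diff)

lemma rel_proj_frags: "c \<in> frags B \<Longrightarrow> rel_proj Q c \<in> frags {s \<in> B. \<not> set s \<subseteq> Q}"
  unfolding rel_proj_def by (rule frag_extend_frags) (auto simp: frags_0)

lemma bd_sum: "bd s = (\<Sum>i<length s. frag_cmul ((-1) ^ i) (frag_of (delete_nth i s)))"
proof (induction s)
  case (Cons x s)
  have 0: "delete_nth 0 (x # s) = s" "delete_nth (Suc i) (x # s) = x # delete_nth i s" for i
    by (simp_all add: delete_nth_def)
  have "frag_of [x] \<star> (\<Sum>i\<in>I. g i) = (\<Sum>i\<in>I. frag_of [x] \<star> g i)" if "finite I" for g and I :: "nat set"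
    using that by (induction I) auto
  then have "frag_of [x] \<star> bd s = (\<Sum>i<length s. frag_cmul ((-1) ^ i) (frag_of (x # delete_nth i s)))"
    using Cons by simp
  moreover have "(\<Sum>i<length (x # s). frag_cmul ((-1) ^ i) (frag_of (delete_nth i (x # s)))) =
     frag_of s + (\<Sum>i<length s. frag_cmul ((-1) ^ Suc i) (frag_of (x # delete_nth i s)))"
    unfolding list.size(4) add_Suc_right add_0_right sum.lessThan_Suc_shift 0 by simp
  ultimately show ?case by (simp add: sum_negf)
qed simp

lemma delete_nth_chains: "s \<in> chains Q (Suc n) \<Longrightarrow> i < Suc n \<Longrightarrow> delete_nth i s \<in> chains Q n"
proof -
  assume s: "s \<in> chains Q (Suc n)" and i: "i < Suc n"
  have "take (Suc i) s @ drop (Suc i) s = s" by simp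
  then have st: "sorted_wrt (>) (take (Suc i) s @ drop (Suc i) s)" using s by (simp add: chains_def)
  have "take (Suc i) s = take i s @ [s ! i]" using s i by (simp add: chains_def take_Suc_conv_app_nth)
  then show ?thesis using st s i unfolding chains_def delete_nth_def
    by (auto simp: sorted_wrt_append dest: in_set_takeD in_set_dropD)
qed

locale os_sheaf = orlik_solomon L lt for L :: "'a::order set" and lt +
  fixes p :: nat
  assumes p: "p > 0"
begin

section \<open>Sheaf chains and their lift\<close>

abbreviation P where "P \<equiv> punctured L"
abbreviation F where "F \<equiv> OS_sheaf lt p L"
abbreviation PC where "PC n \<equiv> poset_chains P n"
abbreviation CG where "CG n \<equiv> sheaf_chain_group P F n"
abbreviation NA where "NA I \<equiv> not_above L (js I)"

lemma P_eq: "P = L - {bt}" by (simp add: punctured_def bt_def)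

text \<open>The index shift of the whole section: sheaf chains are counted by degree,
  \<open>chains\<close> by number of elements.\<close>

lemma PC_eq: "PC n = chains P (Suc n)" by (auto simp: poset_chains_def chains_def)

lemma finite_PC: "finite (PC n)" unfolding PC_eq by (rule finite_chains) (simp add: P_eq finite_L)

lemma PC_0: "s \<in> PC n \<Longrightarrow> s ! 0 \<in> L" "s \<in> PC n \<Longrightarrow> s ! 0 = hd s" "s \<in> PC n \<Longrightarrow> s \<noteq> []"
  by (cases s; auto simp: poset_chains_def P_eq)+

lemma PC_1: "s \<in> PC (Suc n) \<Longrightarrow> s ! 1 \<in> L"
  by (cases s; cases "tl s") (auto simp: poset_chains_def P_eq)

text \<open>Sheaf chains are lifted to the free abelian group on the pairs of a chain and a monomial: \<open>QQ\<close> is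
  the quotient map, \<open>JJ\<close> its kernel and \<open>dh\<close> a lift of the differential.\<close>

definition bs where "bs n = {(s, I). s \<in> PC n \<and> I \<in> lev p (s ! 0)}"
definition co where "co s = frag_extend (\<lambda>(t, I). if t = s then frag_of I else 0)"
definition emb where "emb s = frag_extend (\<lambda>I. frag_of (s, I))"
definition tn where "tn I = frag_extend (\<lambda>s. frag_of (s, I))"
definition QQ where "QQ n G = (\<lambda>s\<in>PC n. q (s ! 0) (co s G))"
definition JJ where "JJ n = {G \<in> frags (bs n). \<forall>s\<in>PC n. co s G \<in> J (s ! 0)}"
definition dh where "dh = (\<lambda>(s, I). tn I (rel_proj (NA I) (bd s)))"

lemma linear_simps:
  "co s (G - H) = co s G - co s H" "co s (G + H) = co s G + co s H" "co s 0 = 0"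
  "emb s (x - y) = emb s x - emb s y" "emb s 0 = 0"
  "tn I (c - d) = tn I c - tn I d" "tn I (c + d) = tn I c + tn I d" "tn I 0 = 0"
  by (simp_all add: co_def emb_def tn_def frag_extend_diff frag_extend_add)

lemma co_frags: "G \<in> frags (bs n) \<Longrightarrow> co s G \<in> frags (lev p (s ! 0))"
  unfolding co_def by (rule frag_extend_frags) (auto simp: bs_def frags_0)

lemma emb_frags: "w \<in> frags (lev p (s ! 0)) \<Longrightarrow> s \<in> PC n \<Longrightarrow> emb s w \<in> frags (bs n)"
  unfolding emb_def by (rule frag_extend_frags) (auto simp: bs_def)

lemma co_emb: "co t (emb s w) = (if t = s then w else 0)"
  by (induction w rule: frag_all_induct) (auto simp: linear_simps, auto simp: emb_def co_def)

lemma stalk_F: "stalk F x = OS lt p (down_set L x)" by (simp add: OS_sheaf_def)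

lemma comm_group_stalk: "s \<in> PC n \<Longrightarrow> comm_group (stalk F (s ! 0))"
  by (simp add: stalk_F comm_group_OS PC_0(1))

lemma CG_carrier: "carrier (CG n) = (\<Pi>\<^sub>E s\<in>PC n. q (s ! 0) ` frags (lev p (s ! 0)))"
proof -
  have "group (stalk F (s ! 0))" if "s \<in> PC n" for s using comm_group_stalk[OF that] by (simp add: comm_group_def)
  then have "carrier (CG n) = (\<Pi>\<^sub>E s\<in>PC n. carrier (stalk F (s ! 0)))"
    using finite_PC[of n] by (auto simp: sheaf_chain_group_def carrier_sum_group)
  also have "\<dots> = (\<Pi>\<^sub>E s\<in>PC n. q (s ! 0) ` frags (lev p (s ! 0)))"
    by (intro PiE_cong) (simp add: stalk_F OS_simps PC_0(1))
  finally show ?thesis .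
qed

lemma QQ_add: "G \<in> frags (bs n) \<Longrightarrow> H \<in> frags (bs n) \<Longrightarrow> QQ n G \<otimes>\<^bsub>CG n\<^esub> QQ n H = QQ n (G + H)"
  unfolding QQ_def sheaf_chain_group_def mult_sum_group
  by (rule restrict_ext) (simp add: stalk_F OS_simps[OF PC_0(1)] co_frags linear_simps)

lemma QQ_0: "\<one>\<^bsub>CG n\<^esub> = QQ n 0"
  unfolding QQ_def sheaf_chain_group_def one_sum_group
  by (rule restrict_ext) (simp add: stalk_F OS_simps[OF PC_0(1)] linear_simps)

lemma co_sum: "finite I \<Longrightarrow> co s (\<Sum>i\<in>I. g i) = (\<Sum>i\<in>I. co s (g i))"
  by (induction I rule: finite_induct) (auto simp: linear_simps)

lemma QQ_image: "QQ n ` frags (bs n) = carrier (CG n)"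
proof (intro equalityI subsetI)
  fix f assume "f \<in> QQ n ` frags (bs n)"
  then show "f \<in> carrier (CG n)" unfolding CG_carrier by (auto simp: QQ_def co_frags)
next
  fix f assume f: "f \<in> carrier (CG n)"
  then have "\<forall>s\<in>PC n. \<exists>w. w \<in> frags (lev p (s ! 0)) \<and> f s = q (s ! 0) w" unfolding CG_carrier by (auto simp: PiE_iff)
  then obtain w where w: "\<And>s. s \<in> PC n \<Longrightarrow> w s \<in> frags (lev p (s ! 0))" "\<And>s. s \<in> PC n \<Longrightarrow> f s = q (s ! 0) (w s)"
    by metis
  define G where "G = (\<Sum>s\<in>PC n. emb s (w s))"
  have G: "G \<in> frags (bs n)" unfolding G_def by (intro frags_sum emb_frags w)
  have "co s G = w s" if "s \<in> PC n" for s
    using that finite_PC[of n] by (simp add: G_def co_sum co_emb sum.delta)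
  then have "QQ n G = restrict f (PC n)"
    unfolding QQ_def by (intro restrict_ext) (simp add: w(2))
  moreover have "f \<in> extensional (PC n)" using f unfolding CG_carrier by (simp add: PiE_iff)
  ultimately have "f = QQ n G" by (simp add: extensional_restrict)
  then show "f \<in> QQ n ` frags (bs n)" using G by blast
qed

lemma comm_group_CG: "comm_group (CG n)"
  by (rule comm_group_image[OF subgrp_frags QQ_image[symmetric] QQ_0 QQ_add])

lemma QQ_closed: "G \<in> frags (bs n) \<Longrightarrow> QQ n G \<in> carrier (CG n)" using QQ_image by blast

lemma QQ_eq_iff: "G \<in> frags (bs n) \<Longrightarrow> QQ n G = \<one>\<^bsub>CG n\<^esub> \<longleftrightarrow> G \<in> JJ n"
proof -
  assume G: "G \<in> frags (bs n)"
  have "QQ n G = QQ n 0 \<longleftrightarrow> (\<forall>s\<in>PC n. q (s ! 0) (co s G) = q (s ! 0) 0)"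
    by (auto simp: QQ_def linear_simps fun_eq_iff restrict_def)
  then show ?thesis unfolding QQ_0 JJ_def using G q_eq_iff[OF PC_0(1)] by auto
qed

lemma subgrp_JJ: "subgrp (JJ n)"
  unfolding subgrp_def JJ_def using frags_0 frags_diff
  by (auto simp: linear_simps J.zero J.diff)

lemma QQ_sum:
  assumes "finite A" "\<And>i. i \<in> A \<Longrightarrow> g i \<in> frags (bs n)"
  shows "finprod (CG n) (\<lambda>i. QQ n (g i)) A = QQ n (\<Sum>i\<in>A. g i)"
proof -
  interpret comm_group "CG n" by (rule comm_group_CG)
  show ?thesis using assms
  proof (induction A rule: finite_induct)
    case empty then show ?case by (simp add: QQ_0)
  next
    case (insert i A)
    then show ?case by (subst finprod_insert) (auto simp: QQ_closed QQ_add frags_sum)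
  qed
qed

lemma QQ_sign:
  assumes "G \<in> frags (bs n)"
  shows "QQ n G [^]\<^bsub>CG n\<^esub> ((-1::int) ^ i) = QQ n (frag_cmul ((-1) ^ i) G)"
proof -
  interpret comm_group "CG n" by (rule comm_group_CG)
  have "inv\<^bsub>CG n\<^esub> QQ n G = QQ n (- G)"
    using assms frags_uminus[OF assms]
    by (intro inv_equality) (simp_all add: QQ_add QQ_closed QQ_0)
  moreover have "QQ n G [^]\<^bsub>CG n\<^esub> (- 1 :: int) = inv\<^bsub>CG n\<^esub> QQ n G"
    using int_pow_neg[OF QQ_closed[OF assms], of 1] int_pow_1[OF QQ_closed[OF assms]] by simp
  ultimately show ?thesis using int_pow_1[OF QQ_closed[OF assms]] by (cases "even i") auto
qed

lemma place_q:
  assumes "s \<in> PC n" "w \<in> frags (lev p (s ! 0))"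
  shows "place P F n s (q (s ! 0) w) = QQ n (emb s w)"
  unfolding place_def QQ_def
  by (rule restrict_ext) (simp add: co_emb stalk_F OS_simps[OF PC_0(1)])

lemma emb_frag_of: "emb s (frag_of I) = frag_of (s, I)" by (simp add: emb_def)

lemma lev_js: "I \<in> lev p x \<Longrightarrow> I \<subseteq> L" "I \<in> lev p x \<Longrightarrow> x \<in> L \<Longrightarrow> js I \<le> x" "I \<in> lev p x \<Longrightarrow> js I \<in> L"
proof -
  show L: "I \<subseteq> L" if "I \<in> lev p x" using that atL by (auto simp: lev_def)
  show "js I \<le> x" if "I \<in> lev p x" "x \<in> L"
    using that js_props(3)[OF L[OF that(1)]] by (auto simp: lev_def)
  show "js I \<in> L" if "I \<in> lev p x" using js_props(1)[OF L[OF that]] .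
qed

text \<open>Here p > 0 enters: a nonempty set of atoms does not span the bottom, so
  \<open>acyclic_below_not_above\<close> applies to its flat.\<close>

lemma js_ne_bt: "I \<in> lev p x \<Longrightarrow> js I \<noteq> bt"
proof
  assume I: "I \<in> lev p x" "js I = bt"
  have "I \<noteq> {}" using I p by (auto simp: lev_def)
  then obtain a where a: "a \<in> I" by auto
  then have "a \<in> at" using I by (auto simp: lev_def)
  moreover have "a \<le> bt" using js_props(2)[OF lev_js(1)[OF I(1)] a] I by simp
  ultimately show False by (simp add: at_iff less_le_not_le)
qed

text \<open>The elements of P not above X form a down-set, so membership of a chain is decided by
  its top.\<close>

lemma chain_not_above:
  assumes "s \<in> PC n" "X \<in> L"
  shows "set s \<subseteq> not_above L X \<longleftrightarrow> \<not> X \<le> s ! 0"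
proof -
  obtain x t where s: "s = x # t" using PC_0(3)[OF assms(1)] by (cases s) auto
  have "set s \<subseteq> P" "\<forall>y\<in>set t. y < x" using assms s by (auto simp: poset_chains_def)
  then show ?thesis unfolding s using s by (auto simp: not_above_def dest: order_trans less_imp_le)
qed

text \<open>A monomial survives in the stalk at the top of a chain exactly if the chain is not
  inside the subposet attached to its flat. For a fixed monomial the sheaf complex is thus the
  relative complex of a pair.\<close>

lemma lev_iff_chain:
  assumes "s \<in> PC n" "I \<in> lev p x"
  shows "\<not> set s \<subseteq> NA I \<longleftrightarrow> I \<in> lev p (s ! 0)"
  using chain_not_above[OF assms(1) lev_js(3)[OF assms(2)]] js_le_iff[OF lev_js(1)[OF assms(2)] PC_0(1)[OF assms(1)]] assms(2)
  by (auto simp: lev_def)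

lemma tn_frags:
  assumes "c \<in> frags {s \<in> PC n. \<not> set s \<subseteq> NA I}" "I \<in> lev p x" shows "tn I c \<in> frags (bs n)"
  unfolding tn_def by (rule frag_extend_frags[OF assms(1)]) (use lev_iff_chain[OF _ assms(2)] in \<open>auto simp: bs_def\<close>)

lemma dh_basis_frags:
  assumes "s \<in> PC (Suc n)" "I \<in> lev p x" shows "dh (s, I) \<in> frags (bs n)"
proof -
  have "bd s \<in> frags (PC n)" using bd_chains[of s P "Suc (Suc n)"] assms by (simp add: PC_eq)
  then show ?thesis unfolding dh_def prod.case by (intro tn_frags[OF rel_proj_frags assms(2)])
qed

lemma dh_frags: "G \<in> frags (bs (Suc n)) \<Longrightarrow> frag_extend dh G \<in> frags (bs n)"
proof (erule frag_extend_frags)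
  fix b assume "b \<in> bs (Suc n)"
  then obtain s I where "b = (s, I)" "s \<in> PC (Suc n)" "I \<in> lev p (s ! 0)" by (auto simp: bs_def)
  then show "dh b \<in> frags (bs n)" by (simp add: dh_basis_frags)
qed

lemma dh_tn: "frag_extend dh (tn I c) = tn I (rel_proj (NA I) (Bd c))"
  by (induction c rule: frag_all_induct)
     (auto simp: linear_simps frag_extend_diff rel_proj_diff, auto simp: tn_def dh_def rel_proj_def)

lemma dh_dh: "G \<in> frags (bs n) \<Longrightarrow> frag_extend dh (frag_extend dh G) = 0"
proof (induction rule: frags_induct)
  case (one b)
  obtain s I where b: "b = (s, I)" "s \<in> PC n" using one by (auto simp: bs_def)
  have "bd s \<in> frags (chains P n)" using bd_chains[of s P "Suc n"] b by (simp add: PC_eq)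
  from rel_proj_Bd[OF this, of "NA I"] have "frag_extend dh (dh b) = 0"
    unfolding b dh_def prod.case dh_tn[unfolded dh_def] by (simp add: linear_simps) (simp add: rel_proj_def linear_simps)
  then show ?case by simp
qed (auto simp: frag_extend_diff)

text \<open>The only face of a one-element chain is the empty one, which \<open>rel_proj\<close>
  kills.\<close>

lemma dh_0: "G \<in> frags (bs 0) \<Longrightarrow> frag_extend dh G = 0"
proof (induction rule: frags_induct)
  case (one b)
  then obtain x I where "b = ([x], I)" by (auto simp: bs_def poset_chains_def length_Suc_conv)
  then show ?case by (simp add: dh_def rel_proj_def linear_simps)
qed (auto simp: frag_extend_diff)

lemma delete_nth_PC:
  assumes "s \<in> PC (Suc n)"
  shows "i \<le> Suc n \<Longrightarrow> delete_nth i s \<in> PC n" "delete_nth 0 s ! 0 = s ! 1" "0 < i \<Longrightarrow> delete_nth i s ! 0 = s ! 0"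
proof -
  show "i \<le> Suc n \<Longrightarrow> delete_nth i s \<in> PC n" using assms delete_nth_chains[of s P "Suc n" i] by (simp add: PC_eq)
  obtain x y t where "s = x # y # t" using assms by (auto simp: poset_chains_def length_Suc_conv)
  then show "delete_nth 0 s ! 0 = s ! 1" "0 < i \<Longrightarrow> delete_nth i s ! 0 = s ! 0"
    by (simp_all add: delete_nth_def nth_append)
qed

text \<open>Only deletion of the top changes the stalk. Restricting the monomial to the next element
  and discarding faces inside \<open>NA I\<close> are the same operation there; the other faces keep
  their top and none of them is discarded.\<close>

lemma dh_formula:
  assumes s: "s \<in> PC (Suc n)" and I: "I \<in> lev p (s ! 0)"
  shows "dh (s, I) = emb (delete_nth 0 s) (restr (s ! 1) (frag_of I)) +
    (\<Sum>i\<in>{1..n+1}. frag_cmul ((-1) ^ i) (emb (delete_nth i s) (frag_of I)))"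
proof -
  have len: "length s = Suc (Suc n)" using s by (simp add: poset_chains_def)
  let ?f = "\<lambda>t. if set t \<subseteq> NA I then 0 else frag_of (t, I)"
  have f: "tn I (rel_proj (NA I) c) = frag_extend ?f c" for c
  proof (induction c rule: frag_all_induct)
    case zero show ?case by (simp add: tn_def rel_proj_def)
  next
    case (one b) show ?case by (simp add: tn_def rel_proj_def)
  qed (simp add: linear_simps rel_proj_diff frag_extend_diff)
  have "dh (s, I) = (\<Sum>i<Suc (Suc n). frag_cmul ((-1) ^ i) (?f (delete_nth i s)))"
    unfolding dh_def prod.case f bd_sum len by (simp only: frag_extend_sum finite_lessThan o_def frag_extend_cmul frag_extend_of)
  also have "{..<Suc (Suc n)} = insert 0 {1..n+1}" by auto
  also have "(\<Sum>i\<in>insert 0 {1..n+1}. frag_cmul ((-1) ^ i) (?f (delete_nth i s))) =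
     ?f (delete_nth 0 s) + (\<Sum>i\<in>{1..n+1}. frag_cmul ((-1) ^ i) (?f (delete_nth i s)))" by simp
  also have "?f (delete_nth 0 s) = emb (delete_nth 0 s) (restr (s ! 1) (frag_of I))"
    using lev_iff_chain[OF delete_nth_PC(1)[OF s] I, of 0] delete_nth_PC(2)[OF s] I
    by (auto simp: restr_def emb_frag_of linear_simps lev_def)
  also have "(\<Sum>i\<in>{1..n+1}. frag_cmul ((-1) ^ i) (?f (delete_nth i s))) =
    (\<Sum>i\<in>{1..n+1}. frag_cmul ((-1) ^ i) (emb (delete_nth i s) (frag_of I)))"
    using lev_iff_chain[OF delete_nth_PC(1)[OF s] I] delete_nth_PC(3)[OF s] I
    by (intro sum.cong refl) (auto simp: emb_frag_of)
  finally show ?thesis .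
qed

lemma boundary_QQ:
  assumes G: "G \<in> frags (bs (Suc n))"
  shows "sheaf_boundary P F n (QQ (Suc n) G) = QQ n (frag_extend dh G)"
proof -
  interpret C: comm_group "CG n" by (rule comm_group_CG)
  define t where "t s w = emb (delete_nth 0 s) (restr (s ! 1) w) + (\<Sum>i\<in>{1..n+1}. frag_cmul ((-1) ^ i) (emb (delete_nth i s) w))" for s w
  have rsl: "restr (s ! 1) w \<in> frags (lev p (s ! 1))" if "w \<in> frags (lev p (s ! 0))" for s w
    unfolding restr_def by (rule frag_extend_frags[OF that]) (auto simp: lev_def frags_0)
  have e0: "emb (delete_nth 0 s) (restr (s ! 1) w) \<in> frags (bs n)"
    and ei: "\<And>i. i \<in> {1..n+1} \<Longrightarrow> emb (delete_nth i s) w \<in> frags (bs n)"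
    if "s \<in> PC (Suc n)" "w \<in> frags (lev p (s ! 0))" for s w
    using that delete_nth_PC[OF that(1)] rsl by (auto intro!: emb_frags)
  have tf: "t s w \<in> frags (bs n)" if "s \<in> PC (Suc n)" "w \<in> frags (lev p (s ! 0))" for s w
    unfolding t_def using e0[OF that] ei[OF that]
    by (intro frags_add frags_sum frags_cmul) auto
  have "place P F n (delete_nth 0 s) (res F (s ! 0) (s ! 1) (QQ (Suc n) G s)) \<otimes>\<^bsub>CG n\<^esub>
      (\<Otimes>\<^bsub>CG n\<^esub>i\<in>{1..n + 1}. place P F n (delete_nth i s) (QQ (Suc n) G s) [^]\<^bsub>CG n\<^esub> ((-1::int) ^ i)) =
      QQ n (t s (co s G))" if s: "s \<in> PC (Suc n)" for s
  proof -
    let ?w = "co s G"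
    have w: "?w \<in> frags (lev p (s ! 0))" by (rule co_frags[OF G])
    have Qs: "QQ (Suc n) G s = q (s ! 0) ?w" using s by (simp add: QQ_def)
    have "res F (s ! 0) (s ! 1) (q (s ! 0) ?w) = q (s ! 1) (restr (s ! 1) ?w)"
      using OS_restriction_q[OF PC_1[OF s] PC_0(1)[OF s] w] by (simp add: OS_sheaf_def)
    then have 1: "place P F n (delete_nth 0 s) (res F (s ! 0) (s ! 1) (QQ (Suc n) G s)) =
        QQ n (emb (delete_nth 0 s) (restr (s ! 1) ?w))"
      using place_q[of "delete_nth 0 s" n "restr (s ! 1) ?w"] delete_nth_PC[OF s] rsl[OF w] by (simp add: Qs)
    have "place P F n (delete_nth i s) (QQ (Suc n) G s) [^]\<^bsub>CG n\<^esub> ((-1::int) ^ i) =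
        QQ n (frag_cmul ((-1) ^ i) (emb (delete_nth i s) ?w))" if i: "i \<in> {1..n+1}" for i
      using place_q[of "delete_nth i s" n ?w] delete_nth_PC[OF s] i w QQ_sign[OF ei[OF s w i]] by (simp add: Qs)
    then have "(\<Otimes>\<^bsub>CG n\<^esub>i\<in>{1..n + 1}. place P F n (delete_nth i s) (QQ (Suc n) G s) [^]\<^bsub>CG n\<^esub> ((-1::int) ^ i)) =
       (\<Otimes>\<^bsub>CG n\<^esub>i\<in>{1..n + 1}. QQ n (frag_cmul ((-1) ^ i) (emb (delete_nth i s) ?w)))"
      by (intro C.finprod_cong' refl) (auto intro!: QQ_closed frags_cmul ei[OF s w])
    also have "\<dots> = QQ n (\<Sum>i\<in>{1..n+1}. frag_cmul ((-1) ^ i) (emb (delete_nth i s) ?w))"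
      by (rule QQ_sum) (auto intro!: frags_cmul ei[OF s w])
    finally show ?thesis
      unfolding 1 t_def by (simp only:) (intro QQ_add e0[OF s w] frags_sum frags_cmul ei[OF s w], auto)
  qed
  then have "sheaf_boundary P F n (QQ (Suc n) G) = (\<Otimes>\<^bsub>CG n\<^esub>s\<in>PC (Suc n). QQ n (t s (co s G)))"
    unfolding sheaf_boundary_def Suc_eq_plus1[symmetric]
    by (intro C.finprod_cong' refl) (auto intro!: QQ_closed tf co_frags[OF G])
  also have "\<dots> = QQ n (\<Sum>s\<in>PC (Suc n). t s (co s G))"
    by (rule QQ_sum[OF finite_PC]) (intro tf co_frags[OF G])
  also have "(\<Sum>s\<in>PC (Suc n). t s (co s G)) = frag_extend dh G"
  proof -
    have t0: "t s 0 = 0" for s by (simp add: t_def restr_def linear_simps)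
    have td: "t s (x - y) = t s x - t s y" for s x y
      by (simp add: t_def restr_def frag_extend_diff linear_simps frag_cmul_diff2 sum_subtractf)
    show ?thesis
      using G
    proof (rule frags_linear_eq[where f = "\<lambda>G. \<Sum>s\<in>PC (Suc n). t s (co s G)" and g = "frag_extend dh"])
      fix b assume "b \<in> bs (Suc n)"
      then obtain s I where b: "b = (s, I)" "s \<in> PC (Suc n)" "I \<in> lev p (s ! 0)" by (auto simp: bs_def)
      have "(\<Sum>s'\<in>PC (Suc n). t s' (co s' (frag_of b))) = (\<Sum>s'\<in>PC (Suc n). if s' = s then t s (frag_of I) else 0)"
        by (intro sum.cong refl) (auto simp: co_def b t0)
      then show "(\<Sum>s\<in>PC (Suc n). t s (co s (frag_of b))) = frag_extend dh (frag_of b)"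
        using b finite_PC[of "Suc n"] dh_formula[OF b(2,3)] by (simp add: t_def sum.delta)
    qed (auto simp: linear_simps td frag_extend_diff sum_subtractf)
  qed
  finally show ?thesis .
qed

text \<open>As \<open>JJ\<close> is the kernel of \<open>QQ\<close> and \<open>QQ\<close>
  intertwines the differentials, the kernel is preserved without any computation.\<close>

lemma dh_JJ: "G \<in> JJ (Suc n) \<Longrightarrow> frag_extend dh G \<in> JJ n"
proof -
  assume G: "G \<in> JJ (Suc n)"
  then have GB: "G \<in> frags (bs (Suc n))" by (simp add: JJ_def)
  have "QQ (Suc n) G = QQ (Suc n) 0" using QQ_eq_iff[OF GB] G by (simp add: QQ_0)
  then have "QQ n (frag_extend dh G) = QQ n (frag_extend dh 0)"
    using boundary_QQ[OF GB] boundary_QQ[OF frags_0, of n] by simp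
  then show ?thesis using QQ_eq_iff[OF dh_frags[OF GB]] by (simp add: QQ_0)
qed

section \<open>Ranks and exactness of the lifted complex\<close>

definition stalk_rank where "stalk_rank x = (\<Sum>X\<in>{X \<in> L. X \<le> x}. if r X = p then whitney X else 0)"

lemma free_rank_T: "free_rank (frags (bs n)) (JJ n) (\<Sum>s\<in>PC n. stalk_rank (s ! 0))"
proof (rule free_rank_direct_sum[where \<kappa> = fst])
  fix G s assume G: "G \<in> frags (bs n)" "G \<in> JJ n"
  let ?p = "frag_extend (\<lambda>b :: 'a list \<times> 'a set. if fst b = s then frag_of b else 0)"
  have "co t (?p G) = (if t = s then co s G else 0)" for t
    by (induction G rule: frag_all_induct) (auto simp: linear_simps frag_extend_diff, auto simp: co_def split: prod.splits)
  moreover have "?p G \<in> frags (bs n)" by (rule frag_extend_frags[OF G(1)]) (auto simp: frags_0)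
  ultimately show "?p G \<in> JJ n" using G(2) by (auto simp: JJ_def J.zero)
next
  fix s assume s: "s \<in> PC n"
  let ?B = "{b \<in> bs n. fst b = s}"
  have sub: "G \<in> frags (bs n)" if "G \<in> frags ?B" for G using that by (rule frags_mono[rotated]) auto
  have co: "co t G = 0" if "G \<in> frags ?B" "t \<noteq> s" for G t
    using that by (induction rule: frags_induct) (auto simp: linear_simps, auto simp: co_def)
  show "free_rank (frags ?B) (JJ n) (stalk_rank (s ! 0))"
  proof (rule free_rank_transfer[OF free_rank_lev[OF PC_0(1)[OF s], of p, folded stalk_rank_def], of _ "co s"])
    fix G assume G: "G \<in> frags ?B"
    have "co t G \<in> J (t ! 0)" if "co s G \<in> J (s ! 0)" for t
      using that co[OF G, of t] J.zero by (cases "t = s") auto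
    then show "co s G \<in> J (s ! 0) \<longleftrightarrow> G \<in> JJ n"
      using sub[OF G] s by (auto simp: JJ_def)
    show "co s G \<in> frags (lev p (s ! 0))" by (rule co_frags[OF sub[OF G]])
  next
    fix y assume y: "y \<in> frags (lev p (s ! 0))"
    have "emb s y \<in> frags ?B" unfolding emb_def by (rule frag_extend_frags[OF y]) (use s in \<open>auto simp: bs_def\<close>)
    then show "\<exists>x\<in>frags ?B. y - co s x \<in> J (s ! 0)" by (auto simp: co_emb J.zero intro!: bexI[of _ "emb s y"])
  qed (auto simp: additive_on_def linear_simps subgrp_frags)
qed (auto simp: finite_PC subgrp_JJ bs_def)

lemma chains_rank: "s \<in> PC n \<Longrightarrow> Suc n \<le> r (s ! 0)"
proof (induction n arbitrary: s)
  case 0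
  then have "s ! 0 \<in> L" "s ! 0 \<noteq> bt" by (auto simp: poset_chains_def length_Suc_conv P_eq)
  then show ?case using r_less[OF bt_least(1), of "s ! 0"] bt_least(2)[of "s ! 0"] by (auto simp: order_less_le)
next
  case (Suc n)
  have "delete_nth 0 s \<in> PC n" "delete_nth 0 s ! 0 = s ! 1" using delete_nth_PC[OF Suc.prems] by auto
  then have "Suc n \<le> r (s ! 1)" using Suc.IH by metis
  moreover have "s ! 1 < s ! 0" using Suc.prems by (auto simp: poset_chains_def length_Suc_conv)
  then have "r (s ! 1) < r (s ! 0)" using r_less PC_0(1)[OF Suc.prems] PC_1[OF Suc.prems] by auto
  ultimately show ?case by simp
qed

lemma PC_empty: "r tp \<le> n \<Longrightarrow> PC n = {}"
proof (rule ccontr)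
  assume n: "r tp \<le> n" "PC n \<noteq> {}"
  then obtain s where s: "s \<in> PC n" by auto
  then have "Suc n \<le> r tp" using chains_rank[OF s] r_le[OF PC_0(1)[OF s] tp_greatest(1) tp_greatest(2)[OF PC_0(1)[OF s]]] by simp
  then show False using n by simp
qed

text \<open>The relative contraction belonging to the flat of a monomial is applied to the chain
  alone. The real content is \<open>hJ\<close>: relations in the stalks must go to relations,
  although they mix monomials.\<close>

lemma lifted_exact:
  assumes n: "Suc n < r tp" and G: "G \<in> frags (bs n)" "n = 0 \<or> frag_extend dh G \<in> JJ (n - 1)"
  shows "\<exists>H\<in>frags (bs (Suc n)). G - frag_extend dh H \<in> JJ n"
proof -
  define good where "good X K \<longleftrightarrow> (\<forall>n. \<forall>s\<in>chains P n. K s \<in> frags {u \<in> chains P (Suc n). \<not> set u \<subseteq> not_above L X} \<and>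
    (n \<le> r tp - 1 \<longrightarrow> \<not> set s \<subseteq> not_above L X \<longrightarrow>
       rel_proj (not_above L X) (Bd (K s)) + frag_extend K (rel_proj (not_above L X) (bd s)) = frag_of s))" for X and K :: "'a list \<Rightarrow> 'a list \<Rightarrow>\<^sub>0 int"
  have "\<exists>K. good X K" if X: "X \<in> L" "X \<noteq> bt" for X
    unfolding good_def
  proof (rule relative_acycliclic)
    have "bt < X" using X bt_least(2)[OF X(1)] by (simp add: order_less_le)
    then show "tp \<in> P" using tp_greatest X bt_least by (auto simp: P_eq dest: order.strict_trans2)
    show "not_above L X \<subseteq> P" by (auto simp: not_above_def)
    show "acyclic_below (not_above L X) (r tp - 1)" by (rule acyclic_below_not_above[OF X])
  qed (use tp_greatest in \<open>auto simp: P_eq\<close>)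
  then obtain K where K: "\<And>X. X \<in> L \<Longrightarrow> X \<noteq> bt \<Longrightarrow> good X (K X)" by metis
  \<comment> \<open>One homotopy is fixed per flat, so that monomials with equal span are treated
    alike. Monomials whose span has rank other than p are dependent, hence zero in the stalk, and
    are sent to 0.\<close>
  define hh where "hh = (\<lambda>(s, I). if r (js I) = p then tn I (K (js I) s) else 0)"
  have hhB: "hh (s, I) \<in> frags (bs (Suc m))" if "(s, I) \<in> bs m" for s I m
  proof -
    have s: "s \<in> chains P (Suc m)" "I \<in> lev p (s ! 0)" using that by (auto simp: bs_def PC_eq)
    have "K (js I) s \<in> frags {u \<in> PC (Suc m). \<not> set u \<subseteq> NA I}"
      using K[OF lev_js(3)[OF s(2)] js_ne_bt[OF s(2)]] s(1) unfolding good_def PC_eq by blast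
    then show ?thesis using tn_frags[OF _ s(2)] by (auto simp: hh_def frags_0)
  qed
  have hhf: "frag_extend hh c \<in> frags (bs (Suc m))" if "c \<in> frags (bs m)" for c m
    by (rule frag_extend_frags[OF that]) (use hhB in auto)
  have hh_tn: "frag_extend hh (tn I c) = (if r (js I) = p then tn I (frag_extend (K (js I)) c) else 0)" for I c
    by (induction c rule: frag_all_induct) (auto simp: linear_simps frag_extend_diff, auto simp: tn_def hh_def)
  have base: "c - frag_extend dh (frag_extend hh c) - frag_extend hh (frag_extend dh c) \<in> JJ n" if "c \<in> frags (bs n)" for c
    using that
  proof (induction rule: frags_induct)
    case zero then show ?case by (simp add: subgrp_0[OF subgrp_JJ])
  next
    case (diff x y)
    have "x - y - frag_extend dh (frag_extend hh (x - y)) - frag_extend hh (frag_extend dh (x - y)) =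
      (x - frag_extend dh (frag_extend hh x) - frag_extend hh (frag_extend dh x)) -
      (y - frag_extend dh (frag_extend hh y) - frag_extend hh (frag_extend dh y))" by (simp add: frag_extend_diff)
    then show ?case using diff by (simp only: subgrp_diff[OF subgrp_JJ])
  next
    case (one b)
    then obtain s I where b: "b = (s, I)" "s \<in> PC n" "I \<in> lev p (s ! 0)" by (auto simp: bs_def)
    have sP: "s \<in> chains P (Suc n)" using b by (simp add: PC_eq)
    show ?case
    proof (cases "r (js I) = p")
      case True
      have "\<not> set s \<subseteq> NA I" using lev_iff_chain[OF b(2,3)] b(3) by simp
      then have "rel_proj (NA I) (Bd (K (js I) s)) + frag_extend (K (js I)) (rel_proj (NA I) (bd s)) = frag_of s"
        using K[OF lev_js(3)[OF b(3)] js_ne_bt[OF b(3)]] sP n unfolding good_def by auto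
      then have e1: "tn I (frag_of s) = tn I (rel_proj (NA I) (Bd (K (js I) s))) + tn I (frag_extend (K (js I)) (rel_proj (NA I) (bd s)))"
        by (simp only: flip: linear_simps)
      have dhh: "frag_extend dh (hh b) = tn I (rel_proj (NA I) (Bd (K (js I) s)))"
        using True by (simp add: b hh_def dh_tn)
      have hhd: "frag_extend hh (dh b) = tn I (frag_extend (K (js I)) (rel_proj (NA I) (bd s)))"
        using True by (simp add: b dh_def hh_tn)
      have "tn I (frag_of s) = frag_of b" by (simp add: tn_def b)
      then have "frag_of b - frag_extend dh (hh b) - frag_extend hh (dh b) = 0"
        unfolding dhh hhd using e1 by (simp only: diff_diff_eq) simp
      then show ?thesis by (simp only: frag_extend_of subgrp_0[OF subgrp_JJ])
    next
      case False
      have "frag_extend dh (hh b) = 0" "frag_extend hh (dh b) = 0" using False by (simp_all add: b hh_def dh_def hh_tn[unfolded hh_def])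
      moreover have "co t (frag_of b) \<in> J (t ! 0)" for t
        using False b J_dependent[of I "s ! 0"] by (auto simp: co_def lev_def J.zero)
      then have "frag_of b \<in> JJ n" using one by (simp add: JJ_def)
      ultimately show ?thesis by simp
    qed
  qed
  have hJ: "frag_extend hh c \<in> JJ (Suc m)" if c: "c \<in> JJ m" for c m
  proof -
    have cB: "c \<in> frags (bs m)" using c by (simp add: JJ_def)
    have "co t (frag_extend hh c) \<in> J (t ! 0)" if t: "t \<in> PC (Suc m)" for t
    proof -
      let ?R = "{X \<in> L. r X = p}"
      let ?S = "\<lambda>c. \<Sum>s\<in>PC m. \<Sum>X\<in>?R. frag_cmul (Poly_Mapping.lookup (K X s) t) (pr X (co s c))"
      have fR: "finite ?R" using finite_L by simp
      have cot: "co t (tn I d) = frag_cmul (Poly_Mapping.lookup d t) (frag_of I)" for I d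
      proof (induction d rule: frag_all_induct)
        case (one b) then show ?case by (simp add: tn_def co_def lookup_single)
      qed (auto simp: linear_simps lookup_minus frag_cmul_diff_distrib)
      \<comment> \<open>Since the homotopy sees a monomial only through its span, the coefficient at
        t is built from flat components of the coefficients of c.\<close>
      have "co t (frag_extend hh c) = ?S c"
        using cB
      proof (rule frags_linear_eq[where f = "\<lambda>c. co t (frag_extend hh c)" and g = ?S])
        fix b assume "b \<in> bs m"
        then obtain s I where b: "b = (s, I)" "s \<in> PC m" "I \<in> lev p (s ! 0)" by (auto simp: bs_def)
        have "?S (frag_of b) = (\<Sum>s'\<in>PC m. if s' = s then \<Sum>X\<in>?R. frag_cmul (Poly_Mapping.lookup (K X s) t) (pr X (frag_of I)) else 0)"
          by (intro sum.cong refl) (auto simp: b co_def pr_def intro!: sum.neutral)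
        also have "\<dots> = (\<Sum>X\<in>?R. frag_cmul (Poly_Mapping.lookup (K X s) t) (pr X (frag_of I)))"
          using b finite_PC[of m] by (simp add: sum.delta)
        also have "\<dots> = (\<Sum>X\<in>?R. if X = js I then frag_cmul (Poly_Mapping.lookup (K X s) t) (frag_of I) else 0)"
          by (intro sum.cong refl) (auto simp: pr_def)
        also have "\<dots> = (if r (js I) = p then frag_cmul (Poly_Mapping.lookup (K (js I) s) t) (frag_of I) else 0)"
          using fR lev_js(3)[OF b(3)] by (simp add: sum.delta)
        finally show "co t (frag_extend hh (frag_of b)) = ?S (frag_of b)"
          by (simp add: b hh_def cot linear_simps)
      qed (auto simp: linear_simps frag_extend_diff pr_diff frag_cmul_diff2 sum_subtractf)
      moreover have "frag_cmul (Poly_Mapping.lookup (K X s) t) (pr X (co s c)) \<in> J (t ! 0)" if s: "s \<in> PC m" and X: "X \<in> ?R" for s X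
      proof (cases "Poly_Mapping.lookup (K X s) t = 0")
        case True then show ?thesis by (simp add: J.zero)
      next
        case False
        have Xb: "X \<noteq> bt" using X r_bt p by auto
        have "K X s \<in> frags {u \<in> PC (Suc m). \<not> set u \<subseteq> not_above L X}"
          using K[of X] X Xb s unfolding good_def PC_eq by blast
        \<comment> \<open>The homotopy produces only chains outside the subposet of X, so X lies
          below the top of t, and relations of X are relations in that stalk.\<close>
        then have "\<not> set t \<subseteq> not_above L X" using False by (auto simp: frags_def in_keys_iff)
        then have Xt: "X \<le> t ! 0" using chain_not_above[OF t, of X] X by auto
        have "co s c \<in> J (s ! 0)" using c s by (simp add: JJ_def)
        then have "pr X (co s c) \<in> J X" using X by (intro J_flat) auto
        then show ?thesis using J_mono Xt by (intro subgrp_cmul[OF subgrp_J]) auto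
      qed
      then have "?S c \<in> J (t ! 0)" by (intro subgrp_sum[OF subgrp_J])
      ultimately show ?thesis by simp
    qed
    then show ?thesis using hhf[OF cB] by (simp add: JJ_def)
  qed
  have "frag_extend hh (frag_extend dh G) \<in> JJ n"
    using G hJ[of "frag_extend dh G" "n - 1"] dh_0[of G] subgrp_0[OF subgrp_JJ, of n] by (cases n) auto
  from subgrp_add[OF subgrp_JJ base[OF G(1)] this]
  have "G - frag_extend dh (frag_extend hh G) \<in> JJ n" by simp
  then show ?thesis using hhf[OF G(1)] by blast
qed

section \<open>Homology of the sheaf\<close>

definition Zc where "Zc n = {G \<in> frags (bs n). n = 0 \<or> frag_extend dh G \<in> JJ (n - 1)}"

lemma subgrp_Zc: "subgrp (Zc n)"
  unfolding subgrp_def Zc_def using frags_0 frags_diff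
    subgrp_0[OF subgrp_JJ] subgrp_diff[OF subgrp_JJ] by (auto simp: frag_extend_diff)

text \<open>The relations are the full preimage of the boundaries, to cover both uses: in the top
  degree they reduce to \<open>JJ\<close>, in all others they contain every cycle.\<close>

lemma homology_free:
  assumes n: "free_rank (Zc n) {G. QQ n G \<in> sheaf_boundary P F n ` carrier (CG (n + 1))} k"
  shows "free_abelian_of_rank (sheaf_homology n P F) (int k)"
  unfolding sheaf_homology_def
proof (rule quotient_free_abelian[OF comm_group_CG subgrp_Zc, of "QQ n"])
  let ?N = "sheaf_boundary P F n ` carrier (CG (n + 1))"
  have N: "?N = QQ n ` frag_extend dh ` frags (bs (Suc n))"
    unfolding Suc_eq_plus1[symmetric] QQ_image[symmetric] image_image by (intro image_cong refl boundary_QQ)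
  have Z: "Zc n \<subseteq> frags (bs n)" by (auto simp: Zc_def)
  show ZQ: "QQ n ` Zc n = sheaf_cycles P F n"
  proof (cases n)
    case 0 then show ?thesis using QQ_image[of 0] by (simp add: sheaf_cycles_def Zc_def)
  next
    case (Suc m)
    have "QQ n ` Zc n = {f \<in> QQ n ` frags (bs n). sheaf_boundary P F m f = \<one>\<^bsub>CG m\<^esub>}"
      using boundary_QQ[of _ m] QQ_eq_iff[OF dh_frags, of _ m] by (auto simp: Zc_def Suc)
    then show ?thesis unfolding QQ_image by (simp add: sheaf_cycles_def Suc kernel_def)
  qed
  show "sheaf_cycles P F n \<subseteq> carrier (CG n)" unfolding ZQ[symmetric] QQ_image[symmetric] using Z by auto
  show "QQ n (x + y) = QQ n x \<otimes>\<^bsub>CG n\<^esub> QQ n y" if "x \<in> Zc n" "y \<in> Zc n" for x y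
    using QQ_add[OF subsetD[OF Z that(1)] subsetD[OF Z that(2)]] by simp
  have sg: "subgrp (frag_extend dh ` frags (bs (Suc n)))"
    unfolding subgrp_def
  proof (intro conjI ballI)
    show "0 \<in> frag_extend dh ` frags (bs (Suc n))" using frags_0 by (force simp: image_iff)
    fix x y assume "x \<in> frag_extend dh ` frags (bs (Suc n))" "y \<in> frag_extend dh ` frags (bs (Suc n))"
    then obtain a b where "x = frag_extend dh a" "y = frag_extend dh b" "a \<in> frags (bs (Suc n))" "b \<in> frags (bs (Suc n))" by blast
    then show "x - y \<in> frag_extend dh ` frags (bs (Suc n))"
      using frags_diff by (metis frag_extend_diff imageI)
  qed
  have sub: "frag_extend dh ` frags (bs (Suc n)) \<subseteq> frags (bs n)" using dh_frags by auto
  show "?N \<subseteq> sheaf_cycles P F n"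
  proof -
    have "frag_extend dh ` frags (bs (Suc n)) \<subseteq> Zc n"
      using dh_frags dh_dh subgrp_0[OF subgrp_JJ] by (auto simp: Zc_def)
    then show ?thesis unfolding N ZQ[symmetric] by (rule image_mono)
  qed
  interpret C: comm_group "CG n" by (rule comm_group_CG)
  show "subgroup ?N (CG n)"
  proof (rule C.group_incl_imp_subgroup)
    show "?N \<subseteq> carrier (CG n)"
      unfolding N using image_mono[OF sub, of "QQ n"] by (simp only: QQ_image)
    have "comm_group (CG n\<lparr>carrier := ?N\<rparr>)"
    proof (rule comm_group_image[OF sg, of _ "QQ n"])
      show "carrier (CG n\<lparr>carrier := ?N\<rparr>) = QQ n ` frag_extend dh ` frags (bs (Suc n))"
        unfolding N[symmetric] by simp
      show "\<one>\<^bsub>CG n\<lparr>carrier := ?N\<rparr>\<^esub> = QQ n 0" using QQ_0 by simp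
      fix x y assume xy: "x \<in> frag_extend dh ` frags (bs (Suc n))" "y \<in> frag_extend dh ` frags (bs (Suc n))"
      show "QQ n x \<otimes>\<^bsub>CG n\<lparr>carrier := ?N\<rparr>\<^esub> QQ n y = QQ n (x + y)"
        using QQ_add[OF subsetD[OF sub xy(1)] subsetD[OF sub xy(2)]] by simp
    qed
    then show "group (CG n\<lparr>carrier := ?N\<rparr>)" by (simp add: comm_group_def)
  qed
qed (use n in auto)

text \<open>Below the top every cycle bounds by \<open>lifted_exact\<close>, above it there are no
  chains; in both cases the quotient is free of rank 0.\<close>

lemma homology_vanishing:
  assumes "n \<noteq> r tp - 1" "r tp > 0" shows "trivial_group (sheaf_homology n P F)"
proof -
  have "Zc n \<subseteq> {G. QQ n G \<in> sheaf_boundary P F n ` carrier (CG (n + 1))}"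
  proof
    fix G assume G: "G \<in> Zc n"
    have "\<exists>H\<in>frags (bs (Suc n)). G - frag_extend dh H \<in> JJ n"
    proof (cases "Suc n < r tp")
      case True then show ?thesis using lifted_exact[of n G] G by (auto simp: Zc_def)
    next
      case False
      then have "bs n = {}" using PC_empty[of n] assms by (auto simp: bs_def)
      then have "G = 0" using G by (simp add: Zc_def frags_def)
      then show ?thesis using frags_0 subgrp_0[OF subgrp_JJ] by (intro bexI[of _ 0]) auto
    qed
    then obtain H where H: "H \<in> frags (bs (Suc n))" "G - frag_extend dh H \<in> JJ n" by blast
    let ?d = "frag_extend dh H"
    have d: "?d \<in> frags (bs n)" by (rule dh_frags[OF H(1)])
    have GB: "G - ?d \<in> frags (bs n)" using H(2) by (simp add: JJ_def)
    interpret C: comm_group "CG n" by (rule comm_group_CG)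
    have "QQ n (G - ?d) \<otimes>\<^bsub>CG n\<^esub> QQ n ?d = QQ n G" using QQ_add[OF GB d] by simp
    then have "QQ n G = QQ n ?d" using QQ_eq_iff[OF GB] H(2) QQ_closed[OF d] by simp
    also have "\<dots> = sheaf_boundary P F n (QQ (Suc n) H)" by (rule boundary_QQ[OF H(1), symmetric])
    finally show "G \<in> {G. QQ n G \<in> sheaf_boundary P F n ` carrier (CG (n + 1))}"
      using QQ_closed[OF H(1)] by auto
  qed
  from homology_free[OF free_rank_0[OF subgrp_Zc this]] show ?thesis by (simp add: free_abelian_rank_0_trivial)
qed

text \<open>Ranks grow strictly along chains, so no chain of P has more than r tp elements and
  nothing bounds in the top degree. The homology is the group of cycles.\<close>

lemma homology_top_euler:
  assumes "r tp > 0"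
  shows "free_abelian_of_rank (sheaf_homology (r tp - 1) P F)
    (\<Sum>n\<le>r tp - 1. (-1) ^ (r tp - 1 - n) * int (\<Sum>s\<in>PC n. stalk_rank (s ! 0)))"
proof -
  define N where "N = r tp - 1"
  have N: "r tp = Suc N" using assms by (simp add: N_def)
  have "\<exists>k. free_rank (Zc N) (JJ N) k \<and> int k = (\<Sum>n\<le>N. (-1) ^ (N - n) * int (\<Sum>s\<in>PC n. stalk_rank (s ! 0)))"
  proof (rule free_rank_exact_complex[where E = "\<lambda>n. frags (bs n)" and J = JJ and d = "frag_extend dh"])
    show "frag_extend dh (frag_extend dh x) \<in> JJ n" if "x \<in> frags (bs (Suc (Suc n)))" for n x
      using dh_dh[OF that] subgrp_0[OF subgrp_JJ] by simp
    show "\<exists>y\<in>frags (bs (Suc n)). x - frag_extend dh y \<in> JJ n"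
      if "n < N" "x \<in> frags (bs n)" "n = 0 \<or> frag_extend dh x \<in> JJ (n - 1)" for n x
      using lifted_exact[of n x] that N by auto
  qed (auto simp: subgrp_frags subgrp_JJ frag_extend_diff dh_frags dh_JJ free_rank_T Zc_def, auto simp: JJ_def)
  then obtain k where k: "free_rank (Zc N) (JJ N) k" "int k = (\<Sum>n\<le>N. (-1) ^ (N - n) * int (\<Sum>s\<in>PC n. stalk_rank (s ! 0)))" by blast
  have "bs (Suc N) = {}" using PC_empty[of "Suc N"] N by (auto simp: bs_def)
  then have "frags (bs (Suc N)) = {0}" by (auto simp: frags_def)
  then have "carrier (CG (N + 1)) = {QQ (Suc N) 0}" using QQ_image[of "Suc N"] by auto
  then have "sheaf_boundary P F N ` carrier (CG (N + 1)) = {\<one>\<^bsub>CG N\<^esub>}"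
    using boundary_QQ[OF frags_0, of N] by (simp add: QQ_0)
  then have "free_rank (Zc N) {G. QQ N G \<in> sheaf_boundary P F N ` carrier (CG (N + 1))} k"
    using QQ_eq_iff[of _ N] by (intro free_rank_cong[OF k(1)]) (auto simp: Zc_def)
  from homology_free[OF this] show ?thesis using k(2) by (simp add: N_def)
qed

end


section \<open>Tensor products, reduced homology and ranks\<close>

lemma free_abelian_of_rank_iso:
  assumes "free_abelian_of_rank G n" "free_abelian_of_rank H n" shows "G \<cong> H"
proof -
  obtain k where k: "n = int k" "G \<cong> free_Abelian_group {..<k}" and G: "group G"
    using assms(1) by (auto simp: free_abelian_of_rank_def comm_group_def)
  obtain H: "H \<cong> free_Abelian_group {..<k}" "group H"
    using assms(2) k(1) by (auto simp: free_abelian_of_rank_def comm_group_def)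
  then show ?thesis using iso_trans[OF k(2) group.iso_sym[OF H(2,1)]] by simp
qed

lemma free_abelian_sum_group:
  assumes I: "finite I" and G: "\<And>i. i \<in> I \<Longrightarrow> free_abelian_of_rank (G i) (f i)"
  shows "free_abelian_of_rank (sum_group I G) (\<Sum>i\<in>I. f i)"
proof -
  have gp: "comm_group (G i)" "group (G i)" if "i \<in> I" for i
    using G[OF that] by (auto simp: free_abelian_of_rank_def comm_group_def)
  have "\<exists>n. \<forall>i\<in>I. f i = int (n i) \<and> G i \<cong> free_Abelian_group {..<n i}"
    using G by (intro bchoice) (auto simp: free_abelian_of_rank_def)
  then obtain n where n: "\<And>i. i \<in> I \<Longrightarrow> f i = int (n i)" "\<And>i. i \<in> I \<Longrightarrow> G i \<cong> free_Abelian_group {..<n i :: nat}" by blast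
  \<comment> \<open>Tagging with the index makes the bases of the summands disjoint.\<close>
  define S where "S i = {i} \<times> {..<n i}" for i
  have "G i \<cong> free_Abelian_group (S i)" if "i \<in> I" for i
  proof -
    have "{..<n i} \<approx> S i" unfolding S_def eqpoll_def
      by (intro exI[of _ "Pair i"]) (auto simp: bij_betw_def inj_on_def)
    then have "free_Abelian_group {..<n i} \<cong> free_Abelian_group (S i)" by (simp add: isomorphic_free_Abelian_groups)
    then show ?thesis using iso_trans[OF n(2)[OF that]] by blast
  qed
  then have "sum_group I G \<cong> sum_group I (\<lambda>i. free_Abelian_group (S i))"
    by (intro iso_sum_groupI) (auto simp: gp)
  also have "\<dots> \<cong> free_Abelian_group (\<Union>(S ` I))"
    using iso_free_Abelian_group_sum[of S I] by (auto simp: is_iso_def S_def pairwise_def disjnt_def)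
  also have "\<dots> \<cong> free_Abelian_group {..<\<Sum>i\<in>I. n i}"
  proof -
    have "card (\<Union>(S ` I)) = (\<Sum>i\<in>I. n i)"
      using I by (subst card_UN_disjoint) (auto simp: S_def)
    moreover have "finite (\<Union>(S ` I))" using I by (auto simp: S_def)
    ultimately have "\<Union>(S ` I) \<approx> {..<\<Sum>i\<in>I. n i}" by (simp add: eqpoll_iff_card)
    then show ?thesis by (simp add: isomorphic_free_Abelian_groups)
  qed
  finally have iso: "sum_group I G \<cong> free_Abelian_group {..<\<Sum>i\<in>I. n i}" .
  have "comm_group (sum_group I G)"
  proof (rule group.group_comm_groupI[OF sum_group])
    fix x y assume "x \<in> carrier (sum_group I G)" "y \<in> carrier (sum_group I G)"
    then have "x i \<in> carrier (G i)" "y i \<in> carrier (G i)" if "i \<in> I" for i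
      using that by (auto simp: carrier_sum_group gp)
    then show "x \<otimes>\<^bsub>sum_group I G\<^esub> y = y \<otimes>\<^bsub>sum_group I G\<^esub> x"
      using gp(1) unfolding mult_sum_group by (intro restrict_ext) (simp add: comm_monoid.m_comm comm_group.axioms(1))
  qed (simp add: gp)
  moreover have "(\<Sum>i\<in>I. f i) = int (\<Sum>i\<in>I. n i)" using n(1) by simp
  ultimately show ?thesis using iso unfolding free_abelian_of_rank_def by blast
qed

definition tens :: "('i \<Rightarrow>\<^sub>0 int) \<Rightarrow> ('j \<Rightarrow>\<^sub>0 int) \<Rightarrow> 'i \<times> 'j \<Rightarrow>\<^sub>0 int" where
  "tens c d = frag_extend (\<lambda>i. frag_extend (\<lambda>j. frag_of (i, j)) d) c"

lemma tens_simps: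
  "tens (c + c') d = tens c d + tens c' d" "tens (c - c') d = tens c d - tens c' d" "tens 0 d = 0"
  "tens c (d + d') = tens c d + tens c d'" "tens c 0 = 0" "tens (frag_of i) (frag_of j) = frag_of (i, j)"
  by (simp_all add: tens_def frag_extend_add frag_extend_diff frag_extend_addfun)

lemma tens_diff_right: "tens c (d - d') = tens c d - tens c d'"
  using tens_simps(4)[of c "d - d'" d'] by simp

lemma tens_frags: "c \<in> frags A \<Longrightarrow> d \<in> frags B \<Longrightarrow> tens c d \<in> frags (A \<times> B)"
  unfolding tens_def by (intro frag_extend_frags) auto

text \<open>\<open>\<psi>\<close> evaluates a formal tensor in coordinates and
  \<open>\<sigma>\<close> inserts basis tensors. As \<open>\<psi>\<close> kills the relations, it
  remains to expand every generator modulo N, in its second entry by \<open>key2\<close> and then in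
  its first by \<open>key1\<close>.\<close>

lemma free_abelian_tensor:
  assumes G: "free_abelian_of_rank G a" and H: "free_abelian_of_rank H b"
  shows "free_abelian_of_rank (tensor_product G H) (a * b)"
proof -
  obtain m n where mn: "a = int m" "b = int n" "G \<cong> free_Abelian_group {..<m}" "H \<cong> free_Abelian_group {..<n}"
    and gp: "comm_group G" "comm_group H"
    using assms by (auto simp: free_abelian_of_rank_def)
  interpret G: comm_group G by fact
  interpret H: comm_group H by fact
  obtain \<alpha> where \<alpha>: "\<alpha> \<in> iso G (free_Abelian_group {..<m})" using mn by (auto simp: is_iso_def)
  obtain \<beta> where \<beta>: "\<beta> \<in> iso H (free_Abelian_group {..<n})" using mn by (auto simp: is_iso_def)
  have am: "\<alpha> (x \<otimes>\<^bsub>G\<^esub> y) = \<alpha> x + \<alpha> y" if "x \<in> carrier G" "y \<in> carrier G" for x y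
    using \<alpha> that by (auto simp: iso_def hom_def)
  have bm: "\<beta> (x \<otimes>\<^bsub>H\<^esub> y) = \<beta> x + \<beta> y" if "x \<in> carrier H" "y \<in> carrier H" for x y
    using \<beta> that by (auto simp: iso_def hom_def)
  have ab: "bij_betw \<alpha> (carrier G) (frags {..<m})" using \<alpha> by (auto simp: iso_def frags_def free_Abelian_group_def)
  have bb: "bij_betw \<beta> (carrier H) (frags {..<n})" using \<beta> by (auto simp: iso_def frags_def free_Abelian_group_def)
  define \<alpha>' where "\<alpha>' = inv_into (carrier G) \<alpha>"
  define \<beta>' where "\<beta>' = inv_into (carrier H) \<beta>"
  have a': "\<alpha>' c \<in> carrier G" "\<alpha> (\<alpha>' c) = c" if "c \<in> frags {..<m}" for c
    using that bij_betw_inv_into_right[OF ab that] bij_betw_imp_surj_on[OF bij_betw_inv_into[OF ab]]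
    by (auto simp: \<alpha>'_def)
  have b': "\<beta>' c \<in> carrier H" "\<beta> (\<beta>' c) = c" if "c \<in> frags {..<n}" for c
    using that bij_betw_inv_into_right[OF bb that] bij_betw_imp_surj_on[OF bij_betw_inv_into[OF bb]]
    by (auto simp: \<beta>'_def)
  have aa: "\<alpha>' (\<alpha> x) = x" if "x \<in> carrier G" for x using bij_betw_inv_into_left[OF ab that] by (simp add: \<alpha>'_def)
  have bb': "\<beta>' (\<beta> x) = x" if "x \<in> carrier H" for x using bij_betw_inv_into_left[OF bb that] by (simp add: \<beta>'_def)
  have aF: "\<alpha> x \<in> frags {..<m}" if "x \<in> carrier G" for x using bij_betwE[OF ab] that by blast
  have bF: "\<beta> x \<in> frags {..<n}" if "x \<in> carrier H" for x using bij_betwE[OF bb] that by blast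
  \<comment> \<open>Additivity is stated with c as the sum of c - d and d, the shape in which the
    bilinearity relation meets an induction over differences.\<close>
  have ad: "\<alpha>' c = \<alpha>' (c - d) \<otimes>\<^bsub>G\<^esub> \<alpha>' d" if "c \<in> frags {..<m}" "d \<in> frags {..<m}" for c d
  proof -
    note cd = frags_diff[OF that]
    have "\<alpha> (\<alpha>' (c - d) \<otimes>\<^bsub>G\<^esub> \<alpha>' d) = c" using am a' cd that by simp
    then show ?thesis using aa[of "\<alpha>' (c - d) \<otimes>\<^bsub>G\<^esub> \<alpha>' d"] a' cd that by simp
  qed
  have bd: "\<beta>' c = \<beta>' (c - d) \<otimes>\<^bsub>H\<^esub> \<beta>' d" if "c \<in> frags {..<n}" "d \<in> frags {..<n}" for c d
  proof -
    note cd = frags_diff[OF that]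
    have "\<beta> (\<beta>' (c - d) \<otimes>\<^bsub>H\<^esub> \<beta>' d) = c" using bm b' cd that by simp
    then show ?thesis using bb'[of "\<beta>' (c - d) \<otimes>\<^bsub>H\<^esub> \<beta>' d"] b' cd that by simp
  qed
  let ?B = "carrier G \<times> carrier H"
  let ?F = "free_Abelian_group ?B"
  define N where "N = generate ?F (tensor_relations G H)"
  interpret F: comm_group ?F by (rule abelian_free_Abelian_group)
  have cF: "carrier ?F = frags ?B" by (auto simp: frags_def)
  have rel: "tensor_relations G H \<subseteq> carrier ?F"
    unfolding cF tensor_relations_def
    by (auto intro!: frags_diff)
  have sN: "subgroup N ?F" unfolding N_def by (rule F.generate_is_subgroup[OF rel])
  have NE: "N \<subseteq> frags ?B" using subgroup.subset[OF sN] unfolding cF .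
  have subN: "subgrp N"
    unfolding subgrp_def
  proof (intro conjI ballI)
    show "0 \<in> N" using subgroup.one_closed[OF sN] by simp
    fix x y assume xy: "x \<in> N" "y \<in> N"
    then have "- y \<in> N" using subgroup.m_inv_closed[OF sN xy(2)] NE by (auto simp: frags_def)
    then show "x - y \<in> N" using subgroup.m_closed[OF sN xy(1)] by fastforce
  qed
  have relN: "c \<in> N" if "c \<in> tensor_relations G H" for c
    unfolding N_def using that by (rule generate.incl)
  have r1: "frag_of (x \<otimes>\<^bsub>G\<^esub> x', y) - frag_of (x, y) - frag_of (x', y) \<in> N"
    if "x \<in> carrier G" "x' \<in> carrier G" "y \<in> carrier H" for x x' y
    by (rule relN) (use that in \<open>auto simp: tensor_relations_def\<close>)
  have r2: "frag_of (x, y \<otimes>\<^bsub>H\<^esub> y') - frag_of (x, y) - frag_of (x, y') \<in> N"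
    if "x \<in> carrier G" "y \<in> carrier H" "y' \<in> carrier H" for x y y'
    by (rule relN) (use that in \<open>auto simp: tensor_relations_def\<close>)
  define \<psi> where "\<psi> = frag_extend (\<lambda>(x, y). tens (\<alpha> x) (\<beta> y))"
  define \<sigma> where "\<sigma> = frag_extend (\<lambda>(i, j). frag_of (\<alpha>' (frag_of i), \<beta>' (frag_of j)))"
  have psi_diff: "\<psi> (x - y) = \<psi> x - \<psi> y" and psi_add: "\<psi> (x + y) = \<psi> x + \<psi> y" and psi_0: "\<psi> 0 = 0" for x y
    by (simp_all add: \<psi>_def frag_extend_diff frag_extend_add)
  have sg_diff: "\<sigma> (x - y) = \<sigma> x - \<sigma> y" and sg_0: "\<sigma> 0 = 0" for x y
    by (simp_all add: \<sigma>_def frag_extend_diff)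
  have psiN: "\<psi> c = 0" if "c \<in> N" for c
    using that unfolding N_def
  proof (induction rule: generate.induct)
    case one then show ?case by (simp add: psi_0)
  next
    case (incl h)
    then show ?case by (auto simp: tensor_relations_def psi_diff) (simp_all add: \<psi>_def am bm tens_simps)
  next
    case (inv h)
    then have "inv\<^bsub>?F\<^esub> h = 0 - h" using rel by (auto simp: cF frags_def)
    moreover have "\<psi> h = 0" using inv by (auto simp: tensor_relations_def psi_diff) (simp_all add: \<psi>_def am bm tens_simps)
    ultimately show ?case by (simp only: psi_diff psi_0) simp
  next
    case (eng h1 h2) then show ?case by (simp add: psi_add)
  qed
  \<comment> \<open>The relation for 0 + 0 = 0 is minus the generator in question.\<close>
  have zero_left: "frag_of (\<alpha>' 0, y) \<in> N" if "y \<in> carrier H" for y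
  proof -
    have z: "\<alpha>' 0 \<in> carrier G" "\<alpha>' 0 = \<alpha>' 0 \<otimes>\<^bsub>G\<^esub> \<alpha>' 0"
      using a'(1)[OF frags_0] ad[OF frags_0 frags_0]
      by (simp_all only: diff_self)
    have "- frag_of (\<alpha>' 0, y) \<in> N" using r1[OF z(1) z(1) that] unfolding z(2)[symmetric] by simp
    then show ?thesis using subgrp_uminus[OF subN, of "- frag_of (\<alpha>' 0, y)"] by simp
  qed
  have zero_right: "frag_of (x, \<beta>' 0) \<in> N" if "x \<in> carrier G" for x
  proof -
    have z: "\<beta>' 0 \<in> carrier H" "\<beta>' 0 = \<beta>' 0 \<otimes>\<^bsub>H\<^esub> \<beta>' 0"
      using b'(1)[OF frags_0] bd[OF frags_0 frags_0]
      by (simp_all only: diff_self)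
    have "- frag_of (x, \<beta>' 0) \<in> N" using r2[OF that z(1) z(1)] unfolding z(2)[symmetric] by simp
    then show ?thesis using subgrp_uminus[OF subN, of "- frag_of (x, \<beta>' 0)"] by simp
  qed
  have key2: "d \<in> frags {..<n} \<and> frag_of (\<alpha>' (frag_of i), \<beta>' d) - \<sigma> (tens (frag_of i) d) \<in> N"
    if "i < m" "d \<in> frags {..<n}" for i d
    using that(2)
  proof (induction rule: frags_induct)
    case zero
    then show ?case using zero_right[OF a'(1)[of "frag_of i"]] that(1) by (simp add: tens_simps sg_0 frags_0)
  next
    case (one j) then show ?case by (simp add: tens_simps \<sigma>_def subgrp_0[OF subN])
  next
    case (diff x y)
    let ?a = "\<alpha>' (frag_of i)"
    have a: "?a \<in> carrier G" using a'(1)[of "frag_of i"] that(1) by simp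
    have xy: "x \<in> frags {..<n}" "y \<in> frags {..<n}" "x - y \<in> frags {..<n}"
      using diff frags_diff by auto
    have "frag_of (?a, \<beta>' x) - frag_of (?a, \<beta>' (x - y)) - frag_of (?a, \<beta>' y) \<in> N"
      using r2[OF a b'(1)[OF xy(3)] b'(1)[OF xy(2)]] unfolding bd[OF xy(1,2), symmetric] .
    from subgrp_diff[OF subN subgrp_diff[OF subN conjunct2[OF diff(1)] conjunct2[OF diff(2)]] this]
    show ?case using xy(3) by (simp add: tens_diff_right sg_diff algebra_simps)
  qed
  have key1: "c \<in> frags {..<m} \<and> frag_of (\<alpha>' c, y) - \<sigma> (tens c (\<beta> y)) \<in> N"
    if "y \<in> carrier H" "c \<in> frags {..<m}" for c y
    using that(2)
  proof (induction rule: frags_induct)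
    case zero
    then show ?case using zero_left[OF that(1)] by (simp add: tens_simps sg_0 frags_0)
  next
    case (one i) then show ?case using key2[of i "\<beta> y"] bF[OF that(1)] bb'[OF that(1)] by simp
  next
    case (diff x z)
    have xy: "x \<in> frags {..<m}" "z \<in> frags {..<m}" "x - z \<in> frags {..<m}"
      using diff frags_diff by auto
    have "frag_of (\<alpha>' x, y) - frag_of (\<alpha>' (x - z), y) - frag_of (\<alpha>' z, y) \<in> N"
      using r1[OF a'(1)[OF xy(3)] a'(1)[OF xy(2)] that(1)] unfolding ad[OF xy(1,2), symmetric] .
    from subgrp_diff[OF subN subgrp_diff[OF subN conjunct2[OF diff(1)] conjunct2[OF diff(2)]] this]
    show ?case using xy(3) by (simp add: tens_simps sg_diff algebra_simps)
  qed
  have key: "c - \<sigma> (\<psi> c) \<in> N" if "c \<in> frags ?B" for c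
    using that
  proof (induction rule: frags_induct)
    case zero then show ?case by (simp add: psi_0 sg_0 subgrp_0[OF subN])
  next
    case (one b)
    then obtain x y where xy: "b = (x, y)" "x \<in> carrier G" "y \<in> carrier H" by auto
    then show ?case using key1[OF xy(3) aF[OF xy(2)]] aa[OF xy(2)] by (simp add: \<psi>_def)
  next
    case (diff x y)
    have "x - y - \<sigma> (\<psi> (x - y)) = (x - \<sigma> (\<psi> x)) - (y - \<sigma> (\<psi> y))" by (simp add: psi_diff sg_diff)
    then show ?case using diff by (simp only: subgrp_diff[OF subN])
  qed
  have ps: "\<psi> (\<sigma> c) = c \<and> \<sigma> c \<in> frags ?B" if "c \<in> frags ({..<m} \<times> {..<n})" for c
    using that
  proof (induction rule: frags_induct)
    case (one b)
    then obtain i j where "b = (i, j)" "i < m" "j < n" by auto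
    then show ?case using a'[of "frag_of i"] b'[of "frag_of j"] by (simp add: \<sigma>_def \<psi>_def tens_simps)
  next
    case (diff x y) then show ?case by (simp add: psi_diff sg_diff frags_diff)
  qed (simp add: psi_0 sg_0 frags_0)
  have "free_rank (frags ({..<m} \<times> {..<n})) {0} (m * n)" using free_rank_frags[of "{..<m} \<times> {..<n}"] by simp
  then have free_rank: "free_rank (frags ?B) N (m * n)"
  proof (rule free_rank_transfer[of _ _ _ _ \<psi>])
    fix c assume c: "c \<in> frags ?B"
    show "\<psi> c \<in> frags ({..<m} \<times> {..<n})"
      unfolding \<psi>_def by (rule frag_extend_frags[OF c]) (auto intro!: tens_frags aF bF)
    show "\<psi> c \<in> {0} \<longleftrightarrow> c \<in> N" using psiN[of c] key[OF c] sg_0 by auto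
  next
    fix c assume "c \<in> frags ({..<m} \<times> {..<n})"
    then show "\<exists>x\<in>frags ?B. c - \<psi> x \<in> {0}" using ps by (intro bexI[of _ "\<sigma> c"]) auto
  qed (simp_all add: additive_on_def psi_diff subgrp_frags)
  have "free_abelian_of_rank (?F\<lparr>carrier := carrier ?F\<rparr> Mod N) (int (m * n))"
    by (rule quotient_free_abelian[OF abelian_free_Abelian_group subgrp_frags[of ?B], of "\<lambda>x. x"])
      (use NE sN free_rank in \<open>auto simp: frags_def\<close>)
  then show ?thesis by (simp add: tensor_product_def Let_def N_def mn)
qed

section \<open>The simplicial order complex through decreasing lists\<close>

lemma set_inj_chains: "s \<in> chains Q n \<Longrightarrow> t \<in> chains Q m \<Longrightarrow> set s = set t \<Longrightarrow> s = t"
proof (induction s arbitrary: t n m)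
  case Nil then show ?case by simp
next
  case (Cons x s)
  then obtain y u where t: "t = y # u" by (cases t) auto
  have lt: "\<forall>z\<in>set s. z < x" "\<forall>z\<in>set u. z < y" using Cons.prems t by (auto simp: chains_def)
  have xy: "x = y"
  proof (rule ccontr)
    assume "x \<noteq> y"
    moreover have "x \<in> set (y # u)" "y \<in> set (x # s)" using Cons.prems(3) t by auto
    ultimately have "x < y" "y < x" using lt by auto
    then show False by simp
  qed
  have "x \<notin> set s" "x \<notin> set u" using lt xy by auto
  then have "set s = set u" using Cons.prems(3) t xy by auto
  then show ?case using Cons.IH[of "length s" u "length u"] Cons.prems t xy by (auto simp: chains_def)
qed

text \<open>Lists decrease while positions in a simplex are counted from below, so deletion at place
  i of the list is deletion at position n - i; this is the global sign.\<close>

lemma alternating_deletion_set: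
  assumes "s \<in> chains Q (Suc n)"
  shows "alternating_deletion (<) (set s) = frag_cmul ((-1) ^ n) (frag_extend (\<lambda>t. frag_of (set t)) (bd s))"
  using assms
proof (induction n arbitrary: s Q)
  case (0)
  then obtain x where "s = [x]" by (auto simp: chains_def length_Suc_conv)
  moreover have e: "{w. w = x \<and> w < x} = {}" by auto
  ultimately show ?case by (simp add: alternating_deletion_def e)
next
  case (Suc n)
  then obtain x t where s: "s = x # t" by (cases s) (auto simp: chains_def)
  then have t: "t \<in> chains Q (Suc n)" and lt: "\<And>y. y \<in> set t \<Longrightarrow> y < x" using Suc.prems by (auto simp: chains_def)
  have x: "x \<notin> set t" using lt by blast
  have fc: "frag_extend (\<lambda>t. frag_of (set t)) (frag_of [x] \<star> c) = frag_extend (\<lambda>u. frag_of (insert x u)) (frag_extend (\<lambda>t. frag_of (set t)) c)" for c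
    by (induction c rule: frag_all_induct) (auto simp: frag_extend_diff)
  have card: "card {w \<in> insert x (set t). w < x} = Suc n"
  proof -
    have "{w \<in> insert x (set t). w < x} = set t" using lt by auto
    then show ?thesis using chains_distinct[OF t] distinct_card[of t] t by (simp add: chains_def)
  qed
  have "alternating_deletion (<) (set s) = frag_cmul ((-1) ^ Suc n) (frag_of (set t)) +
     (\<Sum>v\<in>set t. frag_cmul ((-1) ^ card {w \<in> insert x (set t). w < v}) (frag_of (insert x (set t) - {v})))"
    using x card by (simp add: alternating_deletion_def s)
  also have "(\<Sum>v\<in>set t. frag_cmul ((-1) ^ card {w \<in> insert x (set t). w < v}) (frag_of (insert x (set t) - {v})))
     = frag_extend (\<lambda>u. frag_of (insert x u)) (alternating_deletion (<) (set t))"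
  proof -
    have "{w \<in> insert x (set t). w < v} = {w \<in> set t. w < v}" "insert x (set t) - {v} = insert x (set t - {v})" if "v \<in> set t" for v
      using lt[OF that] x that by auto
    then show ?thesis by (simp add: alternating_deletion_def frag_extend_sum frag_extend_cmul o_def)
  qed
  also have "\<dots> = frag_cmul ((-1) ^ n) (frag_extend (\<lambda>t. frag_of (set t)) (frag_of [x] \<star> bd t))"
    by (simp add: Suc.IH[OF t] fc frag_extend_cmul)
  finally show ?case by (simp add: s frag_extend_diff frag_cmul_diff2)
qed

lemma order_complex_chains:
  assumes "finite Q"
  shows "{s \<in> insert {} (order_complex Q). card s = k} = set ` chains Q k"
proof (intro equalityI subsetI)
  fix s assume "s \<in> set ` chains Q k"
  then obtain t where t: "s = set t" "t \<in> chains Q k" by auto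
  have "Complete_Partial_Order.chain (\<le>) (set t)"
    using t(2) unfolding chains_def chain_def
    by (auto simp: in_set_conv_nth sorted_wrt_iff_nth_less) (metis linorder_neqE_nat order_less_imp_le order_refl)
  then show "s \<in> {s \<in> insert {} (order_complex Q). card s = k}"
    using t chains_distinct[OF t(2)] distinct_card[of t] by (auto simp: order_complex_def chains_def)
next
  fix s assume "s \<in> {s \<in> insert {} (order_complex Q). card s = k}"
  then have s: "finite s" "s \<subseteq> Q" "Complete_Partial_Order.chain (\<le>) s" "card s = k"
    by (auto simp: order_complex_def chain_def)
  then show "s \<in> set ` chains Q k"
  proof (induction k arbitrary: s)
    case 0 then show ?case by (auto simp: chains_def image_iff)
  next
    case (Suc k)
    then have "s \<noteq> {}" by auto
    then obtain x where x: "x \<in> s" "\<And>y. y \<in> s \<Longrightarrow> x \<le> y \<Longrightarrow> x = y" using finite_has_maximal[OF Suc.prems(1)] by metis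
    have lt: "y < x" if "y \<in> s - {x}" for y
      using that x Suc.prems(3) unfolding chain_def by (metis DiffD1 DiffD2 insertCI order_less_le)
    have "s - {x} \<in> set ` chains Q k"
      using Suc.prems x by (intro Suc.IH) (auto simp: chain_def)
    then obtain t where t: "s - {x} = set t" "t \<in> chains Q k" by auto
    then have "x # t \<in> chains Q (Suc k)" using lt x Suc.prems(2) by (auto simp: chains_def)
    moreover have "s = set (x # t)" using t(1) x by auto
    ultimately show ?case by blast
  qed
qed

context os_sheaf
begin

section \<open>Euler characteristics and the final ranks\<close>

lemma chain_length_rank:
  assumes "s \<in> all_chains P" "s \<noteq> []" shows "s \<in> PC (length s - 1)" "length s \<le> r (hd s)" "hd s \<in> L" "length s \<le> r tp"
proof -
  show s: "s \<in> PC (length s - 1)" using assms by (auto simp: all_chains_def poset_chains_def)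
  then show "length s \<le> r (hd s)" "hd s \<in> L" using chains_rank[OF s] PC_0[OF s] assms(2) by auto
  then show "length s \<le> r tp" using r_le[OF _ tp_greatest(1) tp_greatest(2)] by (meson order_trans)
qed

lemma finite_all_chains_punctured: "finite (all_chains P)" by (rule finite_all_chains) (simp add: P_eq finite_L)

lemma hall_punctured: "X \<subseteq> L - {bt} \<Longrightarrow> (\<Sum>s\<in>{s \<in> all_chains P. s \<noteq> [] \<and> hd s \<in> X}. (-1) ^ length s) = (\<Sum>x\<in>X. mobius L bt x)"
  using hall_sum[OF finite_L bt_least] P_eq by simp

text \<open>Chains whose top is above X are sorted by their top and summed with Hall's theorem. The
  agreement with \<open>euler_not_above\<close> reflects that P is a cone, so that the pair and its
  subposet differ by a shift of one degree.\<close>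

lemma euler_relative:
  assumes "X \<in> L" "X \<noteq> bt" "r tp \<ge> 2"
  shows "(\<Sum>n\<le>r tp - 1. \<Sum>s\<in>PC n. if X \<le> s ! 0 then (-1) ^ (r tp - 1 - n) else 0) = b_number L X"
proof -
  let ?N = "r tp - 1"
  let ?A = "{s \<in> all_chains P. s \<noteq> []}"
  let ?g = "\<lambda>s. if X \<le> s ! 0 then (-1) ^ r tp * (-1) ^ length s else (0::int)"
  have A: "?A = (\<Union>n\<in>{..?N}. PC n)"
  proof (intro equalityI subsetI)
    fix s assume "s \<in> ?A"
    then show "s \<in> (\<Union>n\<in>{..?N}. PC n)" using chain_length_rank[of s] by (intro UN_I[of "length s - 1"]) auto
  qed (auto simp: poset_chains_def all_chains_def)
  have "(\<Sum>n\<le>?N. \<Sum>s\<in>PC n. if X \<le> s ! 0 then (-1) ^ (?N - n) else 0) = (\<Sum>n\<le>?N. \<Sum>s\<in>PC n. ?g s)"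
  proof (intro sum.cong refl)
    fix n s assume n: "n \<in> {..?N}" and s: "s \<in> PC n"
    have "r tp + Suc n = (?N - n) + 2 * Suc n" using n assms(3) by auto
    then have "(-1::int) ^ r tp * (-1) ^ Suc n = (-1) ^ ((?N - n) + 2 * Suc n)" by (simp only: flip: power_add)
    also have "\<dots> = (-1) ^ (?N - n)" by (simp add: power_add)
    finally show "(if X \<le> s ! 0 then (-1) ^ (?N - n) else 0) = ?g s" using s by (simp add: poset_chains_def)
  qed
  also have "\<dots> = (\<Sum>s\<in>?A. ?g s)"
    unfolding A by (rule sum.UNION_disjoint[symmetric]) (auto simp: finite_PC, auto simp: poset_chains_def)
  also have "\<dots> = (\<Sum>s\<in>{s \<in> all_chains P. s \<noteq> [] \<and> hd s \<in> up_set L X}. (-1) ^ r tp * (-1) ^ length s)"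
  proof (rule sum.mono_neutral_cong_right)
    show "finite ?A" using finite_all_chains_punctured by simp
    show "\<forall>i\<in>?A - {s \<in> all_chains P. s \<noteq> [] \<and> hd s \<in> up_set L X}. ?g i = 0"
      using chain_length_rank(3) by (auto simp: up_set_def hd_conv_nth)
    fix s assume "s \<in> {s \<in> all_chains P. s \<noteq> [] \<and> hd s \<in> up_set L X}"
    then show "?g s = (-1) ^ r tp * (-1) ^ length s" by (auto simp: up_set_def hd_conv_nth)
  qed auto
  also have "\<dots> = (-1) ^ r tp * (\<Sum>x\<in>up_set L X. mobius L bt x)"
  proof -
    have "up_set L X \<subseteq> L - {bt}" using assms bt_least by (auto simp: up_set_def intro: antisym)
    from hall_punctured[OF this] show ?thesis by (simp flip: sum_distrib_left)
  qed
  also have "(-1::int) ^ r tp = (-1) ^ (r tp - 2)" using assms(3) by (cases "r tp"; cases "r tp - 1") auto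
  finally show ?thesis by (simp add: b_number_def lattice_rank_def bt_def tp_def r_def)
qed

text \<open>Here n counts elements, and the empty chain contributes 1. Moebius values over all of L
  sum to 0, so those at the bottom and in the subposet sum to minus those above X; this minus turns
  the exponent r tp - 1 into r tp - 2.\<close>

lemma euler_not_above:
  assumes X: "X \<in> L" "X \<noteq> bt" and l: "r tp \<ge> 2"
  shows "(\<Sum>n\<le>r tp - 1. (-1) ^ (r tp - 1 - n) * int (card (chains (not_above L X) n))) = b_number L X"
proof -
  let ?N = "r tp - 1" and ?Q = "not_above L X"
  have QP: "?Q \<subseteq> P" by (auto simp: not_above_def)
  have finQ: "finite ?Q" using finite_subset[OF QP] finite_L by (simp add: P_eq)
  have down: "y \<in> ?Q" if "x \<in> ?Q" "y \<in> P" "y \<le> x" for x y using that by (auto simp: not_above_def intro: order_trans)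
  have A: "all_chains ?Q = (\<Union>n\<in>{..?N}. chains ?Q n)"
  proof (intro equalityI subsetI)
    fix s assume s: "s \<in> all_chains ?Q"
    have "length s \<le> ?N"
    proof (cases "s = []")
      case False
      have "s \<in> all_chains P" using s QP by (auto simp: all_chains_def)
      note len = chain_length_rank[OF this False]
      have "hd s \<in> ?Q" using s False by (auto simp: all_chains_def)
      then have "hd s \<noteq> tp" using tp_greatest(2)[OF X(1)] by (auto simp: not_above_def)
      then have "hd s < tp" using tp_greatest(2)[OF len(3)] by (simp add: order_less_le)
      then show ?thesis using r_less[OF len(3) tp_greatest(1)] len(2) by simp
    qed simp
    then show "s \<in> (\<Union>n\<in>{..?N}. chains ?Q n)" using s by (auto simp: all_chains_def chains_def)
  qed (auto simp: all_chains_def chains_def)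
  have "(\<Sum>n\<le>?N. (-1) ^ (?N - n) * int (card (chains ?Q n))) = (\<Sum>n\<le>?N. \<Sum>s\<in>chains ?Q n. (-1) ^ ?N * (-1) ^ length s)"
  proof (intro sum.cong refl)
    fix n assume n: "n \<in> {..?N}"
    have "?N + n = (?N - n) + 2 * n" using n by auto
    then have "(-1::int) ^ ?N * (-1) ^ n = (-1) ^ ((?N - n) + 2 * n)" by (simp only: flip: power_add)
    also have "\<dots> = (-1) ^ (?N - n)" by (simp add: power_add)
    finally have "(\<Sum>s\<in>chains ?Q n. (-1) ^ ?N * (-1) ^ length s) = (\<Sum>s\<in>chains ?Q n. (-1::int) ^ (?N - n))"
      by (intro sum.cong refl) (simp add: chains_def)
    then show "(-1) ^ (?N - n) * int (card (chains ?Q n)) = (\<Sum>s\<in>chains ?Q n. (-1) ^ ?N * (-1) ^ length s)" by simp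
  qed
  also have "\<dots> = (\<Sum>s\<in>all_chains ?Q. (-1) ^ ?N * (-1) ^ length s)"
    unfolding A by (rule sum.UNION_disjoint[symmetric]) (auto simp: finite_chains[OF finQ], auto simp: chains_def)
  also have "\<dots> = (-1) ^ ?N * (\<Sum>s\<in>all_chains ?Q. (-1) ^ length s)" by (simp add: sum_distrib_left)
  also have "all_chains ?Q = insert [] {s \<in> all_chains P. s \<noteq> [] \<and> hd s \<in> ?Q}"
  proof (intro equalityI subsetI)
    fix s assume "s \<in> insert [] {s \<in> all_chains P. s \<noteq> [] \<and> hd s \<in> ?Q}"
    then show "s \<in> all_chains ?Q"
    proof
      assume s: "s \<in> {s \<in> all_chains P. s \<noteq> [] \<and> hd s \<in> ?Q}"
      then obtain x t where "s = x # t" by (cases s) auto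
      then show ?thesis using s down[of x] by (auto simp: all_chains_def intro: less_imp_le)
    qed (simp add: all_chains_def)
  qed (use QP in \<open>auto simp: all_chains_def\<close>)
  also have "(\<Sum>s\<in>insert [] {s \<in> all_chains P. s \<noteq> [] \<and> hd s \<in> ?Q}. (-1::int) ^ length s) = 1 + (\<Sum>x\<in>?Q. mobius L bt x)"
    using finite_all_chains_punctured hall_punctured[of ?Q] QP by (subst sum.insert) (auto simp: P_eq)
  also have "1 + (\<Sum>x\<in>?Q. mobius L bt x) = - (\<Sum>x\<in>up_set L X. mobius L bt x)"
  proof -
    have "bt < X" using X bt_least(2)[OF X(1)] by (simp add: order_less_le)
    then have "bt < tp" using tp_greatest(2)[OF X(1)] by (rule order.strict_trans2)
    from mobius_sum[OF finite_L bt_least(1) tp_greatest(1) this] have "(\<Sum>w\<in>L. mobius L bt w) = 0"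
      using bt_least(2) tp_greatest(2) by (simp cong: conj_cong)
    moreover have "L = insert bt ?Q \<union> up_set L X"
      using X bt_least by (auto simp: not_above_def P_eq up_set_def)
    moreover have "insert bt ?Q \<inter> up_set L X = {}" using \<open>bt < X\<close> by (auto simp: not_above_def up_set_def)
    moreover have "finite (up_set L X)" using finite_L by (simp add: up_set_def)
    ultimately have "(\<Sum>w\<in>insert bt ?Q. mobius L bt w) + (\<Sum>w\<in>up_set L X. mobius L bt w) = 0"
      using finQ by (metis finite_insert sum.union_disjoint)
    moreover have "bt \<notin> ?Q" by (auto simp: not_above_def P_eq)
    ultimately show ?thesis using finQ mobius_self[OF finite_L bt_least(1)] by simp
  qed
  also have "(-1::int) ^ ?N = - ((-1) ^ (r tp - 2))" using l by (cases "r tp"; cases "r tp - 1") auto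
  finally show ?thesis by (simp add: b_number_def lattice_rank_def bt_def tp_def r_def)
qed

text \<open>The top of L is above X, so chains of the subposet have at most r tp - 1 elements.
  Degree r tp - 2 is therefore the last one, nothing bounds in it, and its homology is the group of
  cycles.\<close>

lemma free_reduced_homology:
  assumes X: "X \<in> L" "X \<noteq> bt" and l: "r tp \<ge> 2"
  shows "free_abelian_of_rank (reduced_homology (r tp - 2) (order_complex (not_above L X))) (b_number L X)"
proof -
  define N where "N = r tp - 1"
  have N: "r tp = Suc N" "r tp - 2 + 1 = N" "r tp - 2 + 2 = Suc N" "N > 0" using l by (auto simp: N_def)
  let ?Q = "not_above L X" and ?O = "order_complex (not_above L X)"
  have QP: "?Q \<subseteq> P" by (auto simp: not_above_def)
  have finQ: "finite ?Q" using finite_subset[OF QP] finite_L by (simp add: P_eq)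
  obtain h where h: "contracts ?Q (chains ?Q) N h" using acyclic_below_not_above[OF X] by (auto simp: acyclic_below_def N_def)
  define Z where "Z n = {c \<in> frags (chains ?Q n). n = 0 \<or> Bd c \<in> {0}}" for n
  have hf: "Bd (frag_extend h c) + frag_extend h (Bd c) = c" if "n < N" "c \<in> frags (chains ?Q n)" for n c
    using that(2)
    by (rule frags_linear_eq[where f = "\<lambda>c. Bd (frag_extend h c) + frag_extend h (Bd c)" and g = "\<lambda>c. c"])
       (use h that(1) in \<open>auto simp: contracts_def frag_extend_diff\<close>)
  have B0: "Bd c = 0" if "c \<in> frags (chains ?Q 0)" for c
    using that by (induction rule: frags_induct) (auto simp: frag_extend_diff chains_def)
  have "\<exists>k. free_rank (Z N) {0} k \<and> int k = (\<Sum>n\<le>N. (-1) ^ (N - n) * int (card (chains ?Q n)))"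
  proof (rule free_rank_exact_complex[where E = "\<lambda>n. frags (chains ?Q n)" and J = "\<lambda>_. {0}" and d = Bd])
    fix n c assume n: "n < N" and c: "c \<in> frags (chains ?Q n)" "n = 0 \<or> Bd c \<in> {0}"
    then have "Bd c = 0" using B0 by auto
    then have "c - Bd (frag_extend h c) \<in> {0}" using hf[OF n c(1)] by simp
    moreover have "frag_extend h c \<in> frags (chains ?Q (Suc n))"
      by (rule frag_extend_frags[OF c(1)]) (use h in \<open>auto simp: contracts_def\<close>)
    ultimately show "\<exists>y\<in>frags (chains ?Q (Suc n)). c - Bd y \<in> {0}" by blast
  next
    show "free_rank (frags (chains ?Q n)) {0} (card (chains ?Q n))" for n by (rule free_rank_frags[OF finite_chains[OF finQ]])
    show "Bd c \<in> frags (chains ?Q n)" if "c \<in> frags (chains ?Q (Suc n))" for n c using Bd_chains[OF that] by simp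
  qed (auto simp: subgrp_frags frag_extend_diff Z_def frags_0, simp add: subgrp_def)
  then obtain k where k: "free_rank (Z N) {0} k" "int k = b_number L X" using euler_not_above[OF X l] by (auto simp: N_def)
  define cs where "cs = frag_extend (\<lambda>t :: 'a list. frag_of (set t))"
  define srt where "srt m s = (SOME t. t \<in> chains ?Q m \<and> set t = s)" for m s
  have srt: "srt m (set t) = t" if t: "t \<in> chains ?Q m" for m t
    unfolding srt_def using t set_inj_chains by (intro some_equality) blast+
  define ci where "ci m = frag_extend (\<lambda>s. frag_of (srt m s))" for m
  have ci: "ci m (cs c) = c" if "c \<in> frags (chains ?Q m)" for m c
    using that unfolding ci_def cs_def by (induction rule: frags_induct) (auto simp: frag_extend_diff srt)
  have cs_ci: "cs (ci m c) = c \<and> ci m c \<in> frags (chains ?Q m)" if "c \<in> frags (set ` chains ?Q m)" for m c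
    using that unfolding ci_def cs_def
    by (induction rule: frags_induct) (auto simp: frag_extend_diff srt frags_0 frags_diff)
  have csf: "cs c \<in> frags (set ` chains ?Q m)" if "c \<in> frags (chains ?Q m)" for m c
    unfolding cs_def by (rule frag_extend_frags[OF that]) auto
  have A: "aug_chain_group ?O m = free_Abelian_group (set ` chains ?Q m)" for m
    by (simp only: aug_chain_group_def order_complex_chains[OF finQ])
  have cA: "carrier (aug_chain_group ?O m) = frags (set ` chains ?Q m)" for m
    unfolding A by (auto simp: frags_def)
  \<comment> \<open>Passing from lists to sets changes the boundary by a sign depending only on the
    degree, which leaves kernels unchanged.\<close>
  have sb: "simplicial_boundary (cs c) = frag_cmul ((-1) ^ m) (cs (Bd c))" if "c \<in> frags (chains ?Q (Suc m))" for m c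
    using that
    by (rule frags_linear_eq[where f = "\<lambda>c. simplicial_boundary (cs c)" and g = "\<lambda>c. frag_cmul ((-1) ^ m) (cs (Bd c))"])
       (auto simp: cs_def frag_extend_diff frag_cmul_diff2 alternating_deletion_set)
  obtain M where M: "N = Suc M" using N(4) by (cases N) auto
  have Bd0: "cs (Bd c) = 0 \<longleftrightarrow> Bd c = 0" if "c \<in> frags (chains ?Q N)" for c
    using ci[OF Bd_chains[OF that]] by (auto simp: cs_def ci_def)
  have noN: "chains ?Q (Suc N) = {}"
  proof (rule ccontr)
    assume "chains ?Q (Suc N) \<noteq> {}"
    then obtain s where s: "s \<in> chains ?Q (Suc N)" by blast
    then have sP: "s \<in> all_chains P" "s \<noteq> []" using QP by (auto simp: chains_def all_chains_def)
    note len = chain_length_rank[OF sP]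
    have "hd s \<in> ?Q" using s sP(2) by (auto simp: chains_def)
    then have "hd s \<noteq> tp" using tp_greatest(2)[OF X(1)] by (auto simp: not_above_def)
    then have "hd s < tp" using tp_greatest(2)[OF len(3)] by (simp add: order_less_le)
    then have "r (hd s) < r tp" using r_less[OF len(3) tp_greatest(1)] by simp
    then show False using len(2) s N by (simp add: chains_def)
  qed
  have im: "simplicial_boundary ` carrier (aug_chain_group ?O (Suc N)) = {0}"
    unfolding cA noN by (auto simp: frags_def image_iff)
  have ker: "cs ` Z N = kernel (aug_chain_group ?O N) (aug_chain_group ?O M) simplicial_boundary"
  proof -
    have "cs ` Z N = {x \<in> cs ` frags (chains ?Q N). simplicial_boundary x = 0}"
      using sb[of _ M] Bd0 M by (auto simp: Z_def) (simp_all add: cs_def)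
    also have "cs ` frags (chains ?Q N) = frags (set ` chains ?Q N)"
      using csf cs_ci by (auto simp: image_iff) metis
    finally show ?thesis by (simp add: kernel_def A frags_def)
  qed
  have sZ: "subgrp (Z N)"
    unfolding subgrp_def Z_def using frags_0 frags_diff
    by (auto simp: frag_extend_diff)
  have "free_abelian_of_rank (aug_chain_group ?O N\<lparr>carrier := kernel (aug_chain_group ?O N) (aug_chain_group ?O M) simplicial_boundary\<rparr> Mod {0}) (int k)"
  proof (rule quotient_free_abelian[OF _ sZ ker])
    show "comm_group (aug_chain_group ?O N)" unfolding A by (rule abelian_free_Abelian_group)
    then interpret C: comm_group "aug_chain_group ?O N" .
    show "subgroup {0} (aug_chain_group ?O N)" using C.triv_subgroup by (simp add: A)
    show "{0} \<subseteq> kernel (aug_chain_group ?O N) (aug_chain_group ?O M) simplicial_boundary"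
      by (auto simp: kernel_def A)
    show "cs x \<in> {0} \<longleftrightarrow> x \<in> {0}" if "x \<in> Z N" for x
      using ci[of x N] that by (auto simp: Z_def ci_def cs_def)
    show "cs (x + y) = cs x \<otimes>\<^bsub>aug_chain_group ?O N\<^esub> cs y" for x y by (simp add: A cs_def frag_extend_add)
  qed (use k in \<open>auto simp: kernel_def\<close>)
  moreover have "r tp - 2 = M" using N M by simp
  ultimately show ?thesis
    using im unfolding reduced_homology_def k(2) N(2,3) by (simp add: M)
qed

lemma rank_level_eq: "rank_level L p = {X \<in> L. r X = p}" by (simp add: rank_level_def r_def)

text \<open>Stalk ranks are sums over the flats of rank p below the point; exchanging the sums
  leaves \<open>euler_relative\<close> for each flat.\<close>

lemma euler_rank:
  assumes l: "r tp \<ge> 2"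
  shows "(\<Sum>n\<le>r tp - 1. (-1) ^ (r tp - 1 - n) * int (\<Sum>s\<in>PC n. stalk_rank (s ! 0))) =
    (\<Sum>z\<in>rank_level L p. (-1) ^ poset_rank L z * mobius L bt z * b_number L z)"
proof -
  let ?R = "rank_level L p" and ?N = "r tp - 1"
  have w: "int (stalk_rank x) = (\<Sum>X\<in>?R. int (whitney X) * (if X \<le> x then 1 else 0))" for x
  proof -
    have "int (stalk_rank x) = (\<Sum>X\<in>{X \<in> L. X \<le> x}. if r X = p then int (whitney X) else 0)"
      unfolding stalk_rank_def by (simp add: if_distrib cong: if_cong)
    also have "\<dots> = (\<Sum>X\<in>L. if X \<le> x then (if r X = p then int (whitney X) else 0) else 0)"
      using finite_L by (simp add: sum.inter_filter)
    also have "\<dots> = (\<Sum>X\<in>L. if r X = p then int (whitney X) * (if X \<le> x then 1 else 0) else 0)"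
      by (intro sum.cong) auto
    also have "\<dots> = (\<Sum>X\<in>?R. int (whitney X) * (if X \<le> x then 1 else 0))"
      unfolding rank_level_eq using finite_L by (simp add: sum.inter_filter)
    finally show ?thesis .
  qed
  have "(\<Sum>n\<le>?N. (-1) ^ (?N - n) * int (\<Sum>s\<in>PC n. stalk_rank (s ! 0))) =
     (\<Sum>n\<le>?N. \<Sum>s\<in>PC n. \<Sum>X\<in>?R. int (whitney X) * (if X \<le> s ! 0 then (-1) ^ (?N - n) else 0))"
    by (intro sum.cong refl) (auto simp: w sum_distrib_left intro!: sum.cong)
  also have "\<dots> = (\<Sum>n\<le>?N. \<Sum>X\<in>?R. \<Sum>s\<in>PC n. int (whitney X) * (if X \<le> s ! 0 then (-1) ^ (?N - n) else 0))"
    by (intro sum.cong refl sum.swap)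
  also have "\<dots> = (\<Sum>X\<in>?R. \<Sum>n\<le>?N. \<Sum>s\<in>PC n. int (whitney X) * (if X \<le> s ! 0 then (-1) ^ (?N - n) else 0))"
    by (rule sum.swap)
  also have "\<dots> = (\<Sum>X\<in>?R. int (whitney X) * b_number L X)"
  proof (rule sum.cong[OF refl])
    fix X assume "X \<in> ?R"
    then have X: "X \<in> L" "X \<noteq> bt" using p r_bt by (auto simp: rank_level_eq)
    show "(\<Sum>n\<le>?N. \<Sum>s\<in>PC n. int (whitney X) * (if X \<le> s ! 0 then (-1) ^ (?N - n) else 0)) = int (whitney X) * b_number L X"
      unfolding euler_relative[OF X l, symmetric] by (simp only: sum_distrib_left)
  qed
  also have "\<dots> = (\<Sum>z\<in>?R. (-1) ^ poset_rank L z * mobius L bt z * b_number L z)"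
    using free_rank_fiber by (intro sum.cong refl) (auto simp: rank_level_eq whitney_def r_def)
  finally show ?thesis .
qed

end


theorem theorem3p1:
  fixes L :: "'a::order set" and l p :: nat and lt :: "'a \<Rightarrow> 'a \<Rightarrow> bool"
  assumes "geometric_lattice L"
    and "l = lattice_rank L" and "l \<ge> 2" and "p > 0"
    and "transp_on (atoms L) lt" and "asymp_on (atoms L) lt" and "totalp_on (atoms L) lt"
  shows
    "sheaf_homology (l - 1) (punctured L) (OS_sheaf lt p L) \<cong>
       sum_group (rank_level L p)
         (\<lambda>z. tensor_product (OS lt p (down_set L z))
                (reduced_homology (l - 2) (order_complex (not_above L z))))
     \<and> (\<forall>i. i \<noteq> l - 1 \<longrightarrow> trivial_group (sheaf_homology i (punctured L) (OS_sheaf lt p L)))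
     \<and> (\<forall>z\<in>rank_level L p.
          free_abelian_of_rank (OS lt p (down_set L z))
            ((-1) ^ poset_rank L z * mobius L \<bottom>\<^bsub>poset_of L\<^esub> z)
          \<and> free_abelian_of_rank (reduced_homology (l - 2) (order_complex (not_above L z)))
              (b_number L z))
     \<and> free_abelian_of_rank (sheaf_homology (l - 1) (punctured L) (OS_sheaf lt p L))
         (\<Sum>z\<in>rank_level L p.
            (-1) ^ poset_rank L z * mobius L \<bottom>\<^bsub>poset_of L\<^esub> z * b_number L z)"
proof -
  interpret os_sheaf L lt p
    using assms by unfold_locales auto
  have l: "l = r tp" using assms(2) by (simp add: lattice_rank_def r_def tp_def)
  have l2: "r tp \<ge> 2" using assms(3) l by simp
  let ?R = "rank_level L p"
  let ?f = "\<lambda>z. (-1) ^ poset_rank L z * mobius L bt z * b_number L z"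
  have OS: "free_abelian_of_rank (OS lt p (down_set L z)) ((-1) ^ poset_rank L z * mobius L bt z)" if "z \<in> ?R" for z
    by (rule free_OS[OF that])
  have RH: "free_abelian_of_rank (reduced_homology (r tp - 2) (order_complex (not_above L z))) (b_number L z)" if "z \<in> ?R" for z
    using that p r_bt by (intro free_reduced_homology l2) (auto simp: rank_level_eq)
  have top: "free_abelian_of_rank (sheaf_homology (r tp - 1) P F) (\<Sum>z\<in>?R. ?f z)"
    using homology_top_euler l2 unfolding euler_rank[OF l2] by simp
  have "free_abelian_of_rank (sum_group ?R (\<lambda>z. tensor_product (OS lt p (down_set L z))
      (reduced_homology (r tp - 2) (order_complex (not_above L z))))) (\<Sum>z\<in>?R. ?f z)"
    by (rule free_abelian_sum_group) (simp add: rank_level_eq finite_L, intro free_abelian_tensor OS RH)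
  from free_abelian_of_rank_iso[OF top this] show ?thesis
    using top OS RH homology_vanishing l2 unfolding l bt_def[symmetric] by auto
qed

end
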